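(* Let $\mathcal{G}=(G^0,\mathcal{G}^1,r,s)$ be an ultragraph, let $\{R_e,D_A,f_e\}_{e\in\mathcal{G}^1,A\in\mathcal{G}^0}$ be a $\mathcal{G}$-branching system on a measure space $(X,\mu)$ such that $\mu(D_A)\ne0$ for all nonempty $A\in\mathcal{G}^0$, and let $\pi:C^*(\mathcal{G})\to B(\mathcal{L}^2(X,\mu))$ be the representation induced from the branching system. Suppose that for any simple cycle $\alpha=(\alpha_1,\dots,\alpha_k)$ without exits, and for any finite subset $\mathcal{F}$ of $\mathbb{N}$, there exists a measurable subset $E$ of $D_{s(\alpha_1)}$ with $\mu(E)\ne0$ such that $f_{n\alpha}(E)\cap E=\emptyset$ up to a $\mu$-null set for all $n\in\mathcal{F}$. Then $\pi$ is faithful.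
   Context: Standing conventions: $\mathbb{N}$ is the set of positive integers; measure spaces are $\sigma$-finite; C*-algebras are separable; all representations are on separable infinite-dimensional Hilbert spaces (so $\mathcal{L}^2(X,\mu)$ is such); a representation is a $*$-homomorphism into $B(H)$; faithful means injective. Ultragraph: $\mathcal{G}=(G^0,\mathcal{G}^1,r,s)$ consists of countable sets $G^0$ (vertices) and $\mathcal{G}^1$ (edges), a map $s:\mathcal{G}^1\to G^0$ and a map $r:\mathcal{G}^1\to P(G^0)\setminus\{\emptyset\}$, $P(G^0)$ being the power set. $\mathcal{G}^0$ denotes the smallest subset of $P(G^0)$ containing $\{v\}$ for all $v\in G^0$ and $r(e)$ for all $e\in\mathcal{G}^1$, and closed under finite unions and nonempty finite intersections (intersections of nonempty finite families); $\emptyset$ is regarded as an element of $\mathcal{G}^0$. A vertex $v$ is identified with $\{v\}$ in subscripts. $C^*(\mathcal{G})$ is the universal C*-algebra generated by partial isometries $\{s_e:e\in\mathcal{G}^1\}$ with mutually orthogonal ranges and projections $\{p_A:A\in\mathcal{G}^0\}$ such that: (1) $p_\emptyset=0$, $p_Ap_B=p_{A\cap B}$, $p_{A\cup B}=p_A+p_B-p_{A\cap B}$; (2) $s_e^*s_e=p_{r(e)}$; (3) $s_es_e^*\le p_{s(e)}$; (4) $p_v=\sum_{s(e)=v}s_es_e^*$ whenever $0<|s^{-1}(v)|<\infty$. Paths and cycles: a path of length $k\ge1$ is $\alpha=(\alpha_1,\dots,\alpha_k)\in\prod_{i=1}^k\mathcal{G}^1$ with $s(\alpha_{i+1})\in r(\alpha_i)$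 for $1\le i\le k-1$. It is a cycle if $s(\alpha_1)\in r(\alpha_k)$, and a simple cycle if moreover $\alpha_i\ne\alpha_j$ for $i\ne j$. For a set $A$ of vertices, $s^{-1}(A)=\{e\in\mathcal{G}^1:s(e)\in A\}$. A cycle $\alpha$ of length $k$ has exits if one of the following holds: (i) $s^{-1}(r(\alpha_i))\ne\{\alpha_{i+1}\}$ for some $1\le i\le k-1$; (ii) $s^{-1}(r(\alpha_k))\ne\{\alpha_1\}$; (iii) there are $1\le i\le k$ and $v\in r(\alpha_i)$ with $s^{-1}(v)=\emptyset$. For a cycle $\alpha$ and $n\in\mathbb{N}$, $n\alpha$ denotes the concatenation of $n$ copies of $\alpha$. $\mathcal{G}$-branching system on $(X,\mu)$: measurable subsets $\{R_e,D_A\}_{e\in\mathcal{G}^1,A\in\mathcal{G}^0}$ of $X$ with, up to $\mu$-null sets: (1) $R_e\cap R_f=\emptyset$ if $e\ne f$; (2) $D_\emptyset=\emptyset$ (exactly), $D_A\cap D_B=D_{A\cap B}$, $D_A\cup D_B=D_{A\cup B}$; (3) $R_e\subseteq D_{s(e)}$; (4) $D_v=\bigcup_{e\in s^{-1}(v)}R_e$ if $0<|s^{-1}(v)|<\infty$; and (5) for each $e$, measurable maps $f_e:D_{r(e)}\to R_e$ and $f_e^{-1}:R_e\to D_{r(e)}$ with $f_e\circ f_e^{-1}=\mathrm{id}_{R_e}$ and $f_e^{-1}\circ f_e=\mathrm{id}_{D_{r(e)}}$ $\mu$-a.e., such that the pushforward measure $\mu\circ f_e$ on $D_{r(e)}$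 (pushforward of $\mu|_{R_e}$ under $f_e^{-1}$) is absolutely continuous with respect to $\mu$ on $D_{r(e)}$, and the pushforward measure $\mu\circ f_e^{-1}$ on $R_e$ (pushforward of $\mu|_{D_{r(e)}}$ under $f_e$) is absolutely continuous with respect to $\mu$ on $R_e$. Write $\Phi_{f_e}=d(\mu\circ f_e)/d\mu$ and $\Phi_{f_e^{-1}}=d(\mu\circ f_e^{-1})/d\mu$ for the Radon-Nikodym derivatives. For a path $\beta=(\beta_1,\dots,\beta_m)$, $f_\beta=f_{\beta_1}\circ\cdots\circ f_{\beta_m}$ (defined $\mu$-a.e.). The induced representation is the unique representation $\pi:C^*(\mathcal{G})\to B(\mathcal{L}^2(X,\mu))$ with $\pi(s_e)(\phi)=\Phi_{f_e^{-1}}^{1/2}\cdot(\phi\circ f_e^{-1})$ (extended by zero outside $R_e$) and $\pi(p_A)(\phi)=\chi_{D_A}\phi$. *)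

theory Defs
  imports "HOL-Analysis.Analysis" "HOL-Algebra.Module"
begin

section \<open>C*-algebras\<close>

text \<open>
  The additive, multiplicative and scalar structure is inherited from the records of HOL-Algebra.
  C*-algebras need not be unital; the record field for the unit is never referred to.
\<close>

record 'a cstar = "(complex, 'a) module" +
  star :: "'a \<Rightarrow> 'a"
  nrm :: "'a \<Rightarrow> real"

locale cstar_algebra = abelian_group A for A :: "'a cstar" (structure) +
  assumes mult_closed: "\<lbrakk>x \<in> carrier A; y \<in> carrier A\<rbrakk> \<Longrightarrow> x \<otimes> y \<in> carrier A"
    and mult_assoc: "\<lbrakk>x \<in> carrier A; y \<in> carrier A; z \<in> carrier A\<rbrakk> \<Longrightarrow> (x \<otimes> y) \<otimes> z = x \<otimes> (y \<otimes> z)"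
    and distrib_right: "\<lbrakk>x \<in> carrier A; y \<in> carrier A; z \<in> carrier A\<rbrakk> \<Longrightarrow> (x \<oplus> y) \<otimes> z = x \<otimes> z \<oplus> y \<otimes> z"
    and distrib_left: "\<lbrakk>x \<in> carrier A; y \<in> carrier A; z \<in> carrier A\<rbrakk> \<Longrightarrow> z \<otimes> (x \<oplus> y) = z \<otimes> x \<oplus> z \<otimes> y"
    and scale_closed: "x \<in> carrier A \<Longrightarrow> c \<odot> x \<in> carrier A"
    and scale_add_left: "x \<in> carrier A \<Longrightarrow> (c + d) \<odot> x = c \<odot> x \<oplus> d \<odot> x"
    and scale_add_right: "\<lbrakk>x \<in> carrier A; y \<in> carrier A\<rbrakk> \<Longrightarrow> c \<odot> (x \<oplus> y) = c \<odot> x \<oplus> c \<odot> y"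
    and scale_scale: "x \<in> carrier A \<Longrightarrow> c \<odot> (d \<odot> x) = (c * d) \<odot> x"
    and scale_one: "x \<in> carrier A \<Longrightarrow> 1 \<odot> x = x"
    and scale_mult_left: "\<lbrakk>x \<in> carrier A; y \<in> carrier A\<rbrakk> \<Longrightarrow> (c \<odot> x) \<otimes> y = c \<odot> (x \<otimes> y)"
    and scale_mult_right: "\<lbrakk>x \<in> carrier A; y \<in> carrier A\<rbrakk> \<Longrightarrow> x \<otimes> (c \<odot> y) = c \<odot> (x \<otimes> y)"
    and star_closed: "x \<in> carrier A \<Longrightarrow> star A x \<in> carrier A"
    and star_star: "x \<in> carrier A \<Longrightarrow> star A (star A x) = x"
    and star_add: "\<lbrakk>x \<in> carrier A; y \<in> carrier A\<rbrakk> \<Longrightarrow> star A (x \<oplus> y) = star A x \<oplus> star A y"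
    and star_scale: "x \<in> carrier A \<Longrightarrow> star A (c \<odot> x) = cnj c \<odot> star A x"
    and star_mult: "\<lbrakk>x \<in> carrier A; y \<in> carrier A\<rbrakk> \<Longrightarrow> star A (x \<otimes> y) = star A y \<otimes> star A x"
    and nrm_eq_0: "x \<in> carrier A \<Longrightarrow> nrm A x = 0 \<longleftrightarrow> x = \<zero>"
    and nrm_triangle: "\<lbrakk>x \<in> carrier A; y \<in> carrier A\<rbrakk> \<Longrightarrow> nrm A (x \<oplus> y) \<le> nrm A x + nrm A y"
    and nrm_scale: "x \<in> carrier A \<Longrightarrow> nrm A (c \<odot> x) = cmod c * nrm A x"
    and nrm_mult: "\<lbrakk>x \<in> carrier A; y \<in> carrier A\<rbrakk> \<Longrightarrow> nrm A (x \<otimes> y) \<le> nrm A x * nrm A y"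
    and cstar_identity: "x \<in> carrier A \<Longrightarrow> nrm A (star A x \<otimes> x) = (nrm A x)\<^sup>2"
    and complete:
      "\<lbrakk>\<And>n. X n \<in> carrier A;
        \<And>\<epsilon>. \<epsilon> > 0 \<Longrightarrow> \<exists>N::nat. \<forall>m\<ge>N. \<forall>n\<ge>N. nrm A (X m \<ominus> X n) < \<epsilon>\<rbrakk>
       \<Longrightarrow> \<exists>x\<in>carrier A. (\<lambda>n. nrm A (X n \<ominus> x)) \<longlonglongrightarrow> 0"

definition separable_cstar :: "'a cstar \<Rightarrow> bool" where
  "separable_cstar A \<longleftrightarrow>
     (\<exists>C. countable C \<and> C \<subseteq> carrier A \<and>
        (\<forall>x\<in>carrier A. \<forall>\<epsilon>>0. \<exists>c\<in>C. nrm A (x \<ominus>\<^bsub>A\<^esub> c) < \<epsilon>))"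

definition star_hom :: "'a cstar \<Rightarrow> 'b cstar \<Rightarrow> ('a \<Rightarrow> 'b) \<Rightarrow> bool" where
  "star_hom A B \<phi> \<longleftrightarrow>
     \<phi> \<in> carrier A \<rightarrow> carrier B \<and>
     (\<forall>x\<in>carrier A. \<forall>y\<in>carrier A. \<phi> (x \<oplus>\<^bsub>A\<^esub> y) = \<phi> x \<oplus>\<^bsub>B\<^esub> \<phi> y) \<and>
     (\<forall>c. \<forall>x\<in>carrier A. \<phi> (c \<odot>\<^bsub>A\<^esub> x) = c \<odot>\<^bsub>B\<^esub> \<phi> x) \<and>
     (\<forall>x\<in>carrier A. \<forall>y\<in>carrier A. \<phi> (x \<otimes>\<^bsub>A\<^esub> y) = \<phi> x \<otimes>\<^bsub>B\<^esub> \<phi> y) \<and>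
     (\<forall>x\<in>carrier A. \<phi> (star A x) = star B (\<phi> x))"

definition cstar_subalgebra :: "'a cstar \<Rightarrow> 'a set \<Rightarrow> bool" where
  "cstar_subalgebra A V \<longleftrightarrow>
     V \<subseteq> carrier A \<and> \<zero>\<^bsub>A\<^esub> \<in> V \<and>
     (\<forall>x\<in>V. \<forall>y\<in>V. x \<oplus>\<^bsub>A\<^esub> y \<in> V) \<and>
     (\<forall>c. \<forall>x\<in>V. c \<odot>\<^bsub>A\<^esub> x \<in> V) \<and>
     (\<forall>x\<in>V. \<forall>y\<in>V. x \<otimes>\<^bsub>A\<^esub> y \<in> V) \<and>
     (\<forall>x\<in>V. star A x \<in> V) \<and>
     (\<forall>X x. (\<forall>n. X n \<in> V) \<longrightarrow> x \<in> carrier A \<longrightarrow>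
        (\<lambda>n. nrm A (X n \<ominus>\<^bsub>A\<^esub> x)) \<longlonglongrightarrow> 0 \<longrightarrow> x \<in> V)"

definition generated_cstar :: "'a cstar \<Rightarrow> 'a set \<Rightarrow> 'a set" where
  "generated_cstar A S = \<Inter> {V. cstar_subalgebra A V \<and> S \<subseteq> V}"

definition is_projection :: "'a cstar \<Rightarrow> 'a \<Rightarrow> bool" where
  "is_projection A p \<longleftrightarrow> p \<in> carrier A \<and> p \<otimes>\<^bsub>A\<^esub> p = p \<and> star A p = p"

definition is_partial_isometry :: "'a cstar \<Rightarrow> 'a \<Rightarrow> bool" where
  "is_partial_isometry A u \<longleftrightarrow> u \<in> carrier A \<and> u \<otimes>\<^bsub>A\<^esub> star A u \<otimes>\<^bsub>A\<^esub> u = u"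

definition proj_le :: "'a cstar \<Rightarrow> 'a \<Rightarrow> 'a \<Rightarrow> bool" where
  "proj_le A q p \<longleftrightarrow> p \<otimes>\<^bsub>A\<^esub> q = q \<and> q \<otimes>\<^bsub>A\<^esub> p = q"


section \<open>Ultragraphs\<close>

record ('v, 'e) ultragraph =
  verts :: "'v set"
  edges :: "'e set"
  rng :: "'e \<Rightarrow> 'v set"
  src :: "'e \<Rightarrow> 'v"

definition wf_ultragraph :: "('v, 'e) ultragraph \<Rightarrow> bool" where
  "wf_ultragraph G \<longleftrightarrow>
     countable (verts G) \<and> countable (edges G) \<and>
     (\<forall>e\<in>edges G. src G e \<in> verts G \<and> rng G e \<subseteq> verts G \<and> rng G e \<noteq> {})"

inductive_set gen_verts :: "('v, 'e) ultragraph \<Rightarrow> 'v set set" for G :: "('v, 'e) ultragraph" where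
  empty: "{} \<in> gen_verts G"
| vertex: "v \<in> verts G \<Longrightarrow> {v} \<in> gen_verts G"
| range: "e \<in> edges G \<Longrightarrow> rng G e \<in> gen_verts G"
| union: "\<lbrakk>B \<in> gen_verts G; C \<in> gen_verts G\<rbrakk> \<Longrightarrow> B \<union> C \<in> gen_verts G"
| inter: "\<lbrakk>B \<in> gen_verts G; C \<in> gen_verts G\<rbrakk> \<Longrightarrow> B \<inter> C \<in> gen_verts G"

definition out_edges :: "('v, 'e) ultragraph \<Rightarrow> 'v set \<Rightarrow> 'e set" where
  "out_edges G B = {e \<in> edges G. src G e \<in> B}"

definition ug_path :: "('v, 'e) ultragraph \<Rightarrow> 'e list \<Rightarrow> bool" where
  "ug_path G \<alpha> \<longleftrightarrow> \<alpha> \<noteq> [] \<and> set \<alpha> \<subseteq> edges G \<and>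
     (\<forall>i. Suc i < length \<alpha> \<longrightarrow> src G (\<alpha> ! Suc i) \<in> rng G (\<alpha> ! i))"

definition ug_cycle :: "('v, 'e) ultragraph \<Rightarrow> 'e list \<Rightarrow> bool" where
  "ug_cycle G \<alpha> \<longleftrightarrow> ug_path G \<alpha> \<and> src G (hd \<alpha>) \<in> rng G (last \<alpha>)"

definition ug_simple_cycle :: "('v, 'e) ultragraph \<Rightarrow> 'e list \<Rightarrow> bool" where
  "ug_simple_cycle G \<alpha> \<longleftrightarrow> ug_cycle G \<alpha> \<and> distinct \<alpha>"

definition has_exits :: "('v, 'e) ultragraph \<Rightarrow> 'e list \<Rightarrow> bool" where
  "has_exits G \<alpha> \<longleftrightarrow>
     (\<exists>i. Suc i < length \<alpha> \<and> out_edges G (rng G (\<alpha> ! i)) \<noteq> {\<alpha> ! Suc i}) \<or>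
     out_edges G (rng G (last \<alpha>)) \<noteq> {hd \<alpha>} \<or>
     (\<exists>i<length \<alpha>. \<exists>v\<in>rng G (\<alpha> ! i). out_edges G {v} = {})"


section \<open>The C*-algebra of an ultragraph\<close>

definition ck_family ::
  "('v, 'e) ultragraph \<Rightarrow> 'a cstar \<Rightarrow> ('e \<Rightarrow> 'a) \<Rightarrow> ('v set \<Rightarrow> 'a) \<Rightarrow> bool" where
  "ck_family G A S P \<longleftrightarrow>
     (\<forall>e\<in>edges G. is_partial_isometry A (S e)) \<and>
     (\<forall>e\<in>edges G. \<forall>f\<in>edges G. e \<noteq> f \<longrightarrow>
        (S e \<otimes>\<^bsub>A\<^esub> star A (S e)) \<otimes>\<^bsub>A\<^esub> (S f \<otimes>\<^bsub>A\<^esub> star A (S f)) = \<zero>\<^bsub>A\<^esub>) \<and>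
     (\<forall>B\<in>gen_verts G. is_projection A (P B)) \<and>
     P {} = \<zero>\<^bsub>A\<^esub> \<and>
     (\<forall>B\<in>gen_verts G. \<forall>C\<in>gen_verts G.
        P B \<otimes>\<^bsub>A\<^esub> P C = P (B \<inter> C) \<and>
        P (B \<union> C) = (P B \<oplus>\<^bsub>A\<^esub> P C) \<ominus>\<^bsub>A\<^esub> P (B \<inter> C)) \<and>
     (\<forall>e\<in>edges G. star A (S e) \<otimes>\<^bsub>A\<^esub> S e = P (rng G e)) \<and>
     (\<forall>e\<in>edges G. proj_le A (S e \<otimes>\<^bsub>A\<^esub> star A (S e)) (P {src G e})) \<and>
     (\<forall>v\<in>verts G. finite (out_edges G {v}) \<and> out_edges G {v} \<noteq> {} \<longrightarrow>
        P {v} = finsum A (\<lambda>e. S e \<otimes>\<^bsub>A\<^esub> star A (S e)) (out_edges G {v}))"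

text \<open>
  \<open>A\<close>, generated by the family \<open>(S, P)\<close>, is the universal C*-algebra of \<open>G\<close>. The test algebras \<open>B\<close>
  have their elements in the type of real numbers. This restricts nothing beyond separability:
  a separable metric space has at most continuum many points, so every separable C*-algebra is
  isomorphic to one whose carrier is a set of reals. The homomorphism is unique because \<open>A\<close> is
  generated by the family.
\<close>

definition universal_ck_algebra ::
  "('v, 'e) ultragraph \<Rightarrow> 'a cstar \<Rightarrow> ('e \<Rightarrow> 'a) \<Rightarrow> ('v set \<Rightarrow> 'a) \<Rightarrow> bool" where
  "universal_ck_algebra G A S P \<longleftrightarrow>
     cstar_algebra A \<and> ck_family G A S P \<and>
     generated_cstar A (S ` edges G \<union> P ` gen_verts G) = carrier A \<and>
     (\<forall>(B :: real cstar) T Q.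
        cstar_algebra B \<and> separable_cstar B \<and> ck_family G B T Q \<longrightarrow>
        (\<exists>\<phi>. star_hom A B \<phi> \<and>
           (\<forall>e\<in>edges G. \<phi> (S e) = T e) \<and> (\<forall>C\<in>gen_verts G. \<phi> (P C) = Q C)))"


section \<open>Hilbert spaces of square-integrable functions and representations\<close>

record 'h hilbert =
  hcarrier :: "'h set"
  hzero :: 'h
  hadd :: "'h \<Rightarrow> 'h \<Rightarrow> 'h"
  hscale :: "complex \<Rightarrow> 'h \<Rightarrow> 'h"
  hinner :: "'h \<Rightarrow> 'h \<Rightarrow> complex"

definition hnorm :: "'h hilbert \<Rightarrow> 'h \<Rightarrow> real" where
  "hnorm H x = sqrt (Re (hinner H x x))"

definition hspan :: "'h hilbert \<Rightarrow> 'h set \<Rightarrow> 'h set" where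
  "hspan H S = \<Inter> {V. S \<subseteq> V \<and> V \<subseteq> hcarrier H \<and> hzero H \<in> V \<and>
     (\<forall>x\<in>V. \<forall>y\<in>V. hadd H x y \<in> V) \<and> (\<forall>c. \<forall>x\<in>V. hscale H c x \<in> V)}"

definition infinite_dimensional :: "'h hilbert \<Rightarrow> bool" where
  "infinite_dimensional H \<longleftrightarrow> \<not> (\<exists>S. finite S \<and> S \<subseteq> hcarrier H \<and> hspan H S = hcarrier H)"

definition separable_hilbert :: "'h hilbert \<Rightarrow> bool" where
  "separable_hilbert H \<longleftrightarrow>
     (\<exists>C. countable C \<and> C \<subseteq> hcarrier H \<and>
        (\<forall>x\<in>hcarrier H. \<forall>\<epsilon>>0. \<exists>c\<in>C. hnorm H (hadd H x (hscale H (-1) c)) < \<epsilon>))"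

text \<open>
  The set underlying \<open>B(H)\<close>. Operators are extensional functions on the carrier of \<open>H\<close>, so that
  equality of operators is equality of functions.
\<close>

definition bounded_operators :: "'h hilbert \<Rightarrow> ('h \<Rightarrow> 'h) set" where
  "bounded_operators H =
     {T \<in> hcarrier H \<rightarrow>\<^sub>E hcarrier H.
        (\<forall>x\<in>hcarrier H. \<forall>y\<in>hcarrier H. T (hadd H x y) = hadd H (T x) (T y)) \<and>
        (\<forall>c. \<forall>x\<in>hcarrier H. T (hscale H c x) = hscale H c (T x)) \<and>
        (\<exists>C. \<forall>x\<in>hcarrier H. hnorm H (T x) \<le> C * hnorm H x)}"

text \<open>
  A *-homomorphism into \<open>B(H)\<close>, with the operations of \<open>B(H)\<close> written out pointwise; the last
  clause says that \<open>\<pi> (star A a)\<close> is the adjoint of \<open>\<pi> a\<close>.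
\<close>

definition representation :: "'a cstar \<Rightarrow> 'h hilbert \<Rightarrow> ('a \<Rightarrow> 'h \<Rightarrow> 'h) \<Rightarrow> bool" where
  "representation A H \<pi> \<longleftrightarrow>
     \<pi> \<in> carrier A \<rightarrow> bounded_operators H \<and>
     (\<forall>a\<in>carrier A. \<forall>b\<in>carrier A. \<forall>x\<in>hcarrier H. \<pi> (a \<oplus>\<^bsub>A\<^esub> b) x = hadd H (\<pi> a x) (\<pi> b x)) \<and>
     (\<forall>c. \<forall>a\<in>carrier A. \<forall>x\<in>hcarrier H. \<pi> (c \<odot>\<^bsub>A\<^esub> a) x = hscale H c (\<pi> a x)) \<and>
     (\<forall>a\<in>carrier A. \<forall>b\<in>carrier A. \<forall>x\<in>hcarrier H. \<pi> (a \<otimes>\<^bsub>A\<^esub> b) x = \<pi> a (\<pi> b x)) \<and>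
     (\<forall>a\<in>carrier A. \<forall>x\<in>hcarrier H. \<forall>y\<in>hcarrier H.
        hinner H (\<pi> (star A a) x) y = hinner H x (\<pi> a y))"

definition faithful :: "'a cstar \<Rightarrow> ('a \<Rightarrow> 'h \<Rightarrow> 'h) \<Rightarrow> bool" where
  "faithful A \<pi> \<longleftrightarrow> inj_on \<pi> (carrier A)"

definition L2_fun :: "'x measure \<Rightarrow> ('x \<Rightarrow> complex) set" where
  "L2_fun M = {f \<in> borel_measurable M. integrable M (\<lambda>x. (cmod (f x))\<^sup>2)}"

text \<open>Elements of \<open>L\<^sup>2\<close> are classes of functions modulo almost everywhere equality.\<close>

definition L2_class :: "'x measure \<Rightarrow> ('x \<Rightarrow> complex) \<Rightarrow> ('x \<Rightarrow> complex) set" where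
  "L2_class M f = {g \<in> L2_fun M. AE x in M. g x = f x}"

definition L2_rep :: "('x \<Rightarrow> complex) set \<Rightarrow> 'x \<Rightarrow> complex" where
  "L2_rep F = (SOME f. f \<in> F)"

definition L2 :: "'x measure \<Rightarrow> ('x \<Rightarrow> complex) set hilbert" where
  "L2 M =
     \<lparr> hcarrier = L2_class M ` L2_fun M,
       hzero = L2_class M (\<lambda>x. 0),
       hadd = (\<lambda>F K. L2_class M (\<lambda>x. L2_rep F x + L2_rep K x)),
       hscale = (\<lambda>c F. L2_class M (\<lambda>x. c * L2_rep F x)),
       hinner = (\<lambda>F K. integral\<^sup>L M (\<lambda>x. cnj (L2_rep F x) * L2_rep K x)) \<rparr>"


section \<open>Branching systems\<close>

text \<open>The pushforward, as a measure on \<open>Y2\<close>, of the restriction of \<open>M\<close> to \<open>Y1\<close> under \<open>g: Y1 \<rightarrow> Y2\<close>.\<close>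

definition pushforward :: "'x measure \<Rightarrow> 'x set \<Rightarrow> 'x set \<Rightarrow> ('x \<Rightarrow> 'x) \<Rightarrow> 'x measure" where
  "pushforward M Y1 Y2 g = distr (restrict_space M Y1) (restrict_space M Y2) g"

text \<open>\<open>finv e\<close> is the map called \<open>f\<^sub>e\<close> inverse; it inverts \<open>f e\<close> only almost everywhere.\<close>

definition branching_system ::
  "('v, 'e) ultragraph \<Rightarrow> 'x measure \<Rightarrow> ('e \<Rightarrow> 'x set) \<Rightarrow> ('v set \<Rightarrow> 'x set) \<Rightarrow>
   ('e \<Rightarrow> 'x \<Rightarrow> 'x) \<Rightarrow> ('e \<Rightarrow> 'x \<Rightarrow> 'x) \<Rightarrow> bool" where
  "branching_system G M R D f finv \<longleftrightarrow>
     (\<forall>e\<in>edges G. R e \<in> sets M) \<and>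
     (\<forall>B\<in>gen_verts G. D B \<in> sets M) \<and>
     (\<forall>e\<in>edges G. \<forall>e'\<in>edges G. e \<noteq> e' \<longrightarrow> (AE x in M. \<not> (x \<in> R e \<and> x \<in> R e'))) \<and>
     D {} = {} \<and>
     (\<forall>B\<in>gen_verts G. \<forall>C\<in>gen_verts G.
        (AE x in M. x \<in> D B \<inter> D C \<longleftrightarrow> x \<in> D (B \<inter> C)) \<and>
        (AE x in M. x \<in> D B \<union> D C \<longleftrightarrow> x \<in> D (B \<union> C))) \<and>
     (\<forall>e\<in>edges G. AE x in M. x \<in> R e \<longrightarrow> x \<in> D {src G e}) \<and>
     (\<forall>v\<in>verts G. finite (out_edges G {v}) \<and> out_edges G {v} \<noteq> {} \<longrightarrow>
        (AE x in M. x \<in> D {v} \<longleftrightarrow> x \<in> (\<Union>e\<in>out_edges G {v}. R e))) \<and>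
     (\<forall>e\<in>edges G.
        f e \<in> measurable (restrict_space M (D (rng G e))) (restrict_space M (R e)) \<and>
        finv e \<in> measurable (restrict_space M (R e)) (restrict_space M (D (rng G e))) \<and>
        (AE x in M. x \<in> R e \<longrightarrow> f e (finv e x) = x) \<and>
        (AE x in M. x \<in> D (rng G e) \<longrightarrow> finv e (f e x) = x) \<and>
        absolutely_continuous (restrict_space M (D (rng G e)))
          (pushforward M (R e) (D (rng G e)) (finv e)) \<and>
        absolutely_continuous (restrict_space M (R e))
          (pushforward M (D (rng G e)) (R e) (f e)))"

text \<open>The Radon-Nikodym derivative \<open>d(\<mu> \<circ> f\<^sub>e\<^sup>-\<^sup>1)/d\<mu>\<close> on \<open>R e\<close>.\<close>

definition Phi_inv ::
  "('v, 'e) ultragraph \<Rightarrow> 'x measure \<Rightarrow> ('e \<Rightarrow> 'x set) \<Rightarrow> ('v set \<Rightarrow> 'x set) \<Rightarrow>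
   ('e \<Rightarrow> 'x \<Rightarrow> 'x) \<Rightarrow> 'e \<Rightarrow> 'x \<Rightarrow> real" where
  "Phi_inv G M R D f e x =
     enn2real (RN_deriv (restrict_space M (R e)) (pushforward M (D (rng G e)) (R e) (f e)) x)"

text \<open>
  \<open>f\<^sub>\<beta> = f\<^sub>\<beta>\<^sub>1 \<circ> \<dots> \<circ> f\<^sub>\<beta>\<^sub>m\<close> is only a partial map: \<open>path_dom\<close> is the set of
  points at which every stage of the composition is evaluated inside its domain. Images under
  \<open>f\<^sub>\<beta>\<close> are images of points of the domain.
\<close>

fun path_map :: "('e \<Rightarrow> 'x \<Rightarrow> 'x) \<Rightarrow> 'e list \<Rightarrow> 'x \<Rightarrow> 'x" where
  "path_map f [] = id"
| "path_map f (e # \<beta>) = f e \<circ> path_map f \<beta>"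

fun path_dom ::
  "('v, 'e) ultragraph \<Rightarrow> ('v set \<Rightarrow> 'x set) \<Rightarrow> ('e \<Rightarrow> 'x \<Rightarrow> 'x) \<Rightarrow> 'e list \<Rightarrow> 'x set" where
  "path_dom G D f [] = UNIV"
| "path_dom G D f (e # \<beta>) = {x \<in> path_dom G D f \<beta>. path_map f \<beta> x \<in> D (rng G e)}"

definition branch_image ::
  "('v, 'e) ultragraph \<Rightarrow> ('v set \<Rightarrow> 'x set) \<Rightarrow> ('e \<Rightarrow> 'x \<Rightarrow> 'x) \<Rightarrow> 'e list \<Rightarrow> 'x set \<Rightarrow> 'x set" where
  "branch_image G D f \<beta> E = path_map f \<beta> ` (E \<inter> path_dom G D f \<beta>)"

definition iterate_path :: "nat \<Rightarrow> 'e list \<Rightarrow> 'e list" where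
  "iterate_path n \<alpha> = concat (replicate n \<alpha>)"

definition induced_representation ::
  "('v, 'e) ultragraph \<Rightarrow> 'x measure \<Rightarrow> ('e \<Rightarrow> 'x set) \<Rightarrow> ('v set \<Rightarrow> 'x set) \<Rightarrow>
   ('e \<Rightarrow> 'x \<Rightarrow> 'x) \<Rightarrow> ('e \<Rightarrow> 'x \<Rightarrow> 'x) \<Rightarrow>
   'a cstar \<Rightarrow> ('e \<Rightarrow> 'a) \<Rightarrow> ('v set \<Rightarrow> 'a) \<Rightarrow>
   ('a \<Rightarrow> ('x \<Rightarrow> complex) set \<Rightarrow> ('x \<Rightarrow> complex) set) \<Rightarrow> bool" where
  "induced_representation G M R D f finv A S P \<pi> \<longleftrightarrow>
     representation A (L2 M) \<pi> \<and>
     (\<forall>e\<in>edges G. \<forall>\<phi>\<in>L2_fun M.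
        \<pi> (S e) (L2_class M \<phi>) =
          L2_class M (\<lambda>x. if x \<in> R e
                           then complex_of_real (sqrt (Phi_inv G M R D f e x)) * \<phi> (finv e x)
                           else 0)) \<and>
     (\<forall>B\<in>gen_verts G. \<forall>\<phi>\<in>L2_fun M.
        \<pi> (P B) (L2_class M \<phi>) = L2_class M (\<lambda>x. indicator (D B) x * \<phi> x))"

end

theory Submission
  imports Defs
begin

text \<open>
  Only the restriction of \<open>\<pi>\<close> to vectors matters, through the vector states
  \<open>\<tau> x = \<langle>w, \<pi> x w\<rangle>\<close>; it suffices that an element \<open>a\<close> with \<open>\<tau> (y a z) = 0\<close> for all of them is 0.

  Let \<open>b = h + o'\<close> be a combination of the elements \<open>S\<^sub>\<alpha> P\<^sub>B S\<^sub>\<beta>\<^sup>*\<close>, where \<open>h\<close> collects those with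
  \<open>|\<alpha>| = |\<beta>|\<close>. All powers of \<open>h\<^sup>* h\<close> stay in one finite-dimensional algebra, whose norm is
  controlled, up to a constant, by its action on vectors \<open>S\<^sub>\<gamma> s w\<close> with \<open>|\<gamma>| = k\<close>, where \<open>s\<close> and
  the vector \<open>w\<close> of the state are chosen such that \<open>s w\<close> is orthogonal to \<open>S\<^sub>\<epsilon> s w\<close> for all short
  \<open>\<epsilon>\<close>. Around a vertex on a cycle with an exit, an aperiodic path provides such an \<open>s\<close>; on a
  cycle without exits, the set \<open>E\<close> of the hypothesis provides such a \<open>w\<close>. On these vectors \<open>o'\<close>
  is invisible, so \<open>\<parallel>h\<parallel>\<close> is at most the operator norm \<open>q\<close> of \<open>\<pi> b\<close>; the constant goes away by
  taking powers. Applied to \<open>b\<^sub>d\<^sup>* b\<close>, this bounds every homogeneous component \<open>b\<^sub>d\<close> of \<open>b\<close> by \<open>q\<close>.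
  As the number of components of \<open>b\<^sup>n\<close> is linear in \<open>n\<close>, powers of a self-adjoint \<open>b\<close> give
  \<open>\<parallel>b\<parallel> \<le> q\<close>, and by density \<open>\<pi>\<close> is isometric.
\<close>

section \<open>C*-algebras and positive functionals\<close>

text \<open>No conditional expectation onto the degree-zero part is constructed, and homogeneous
  components are not known to be unique in advance. So every estimate is stated for an arbitrary
  decomposition, and the way from degree zero to degree \<open>d\<close> is algebraic: the
  degree-zero part of \<open>b\<^sub>d\<^sup>* b\<close> is
  \<open>b\<^sub>d\<^sup>* b\<^sub>d\<close>, whence \<open>\<parallel>b\<^sub>d\<parallel>\<^sup>2
  \<le> \<parallel>b\<^sub>d\<parallel> q\<close>.

  The constant at a finite stage is there because its levels are estimated one by one and added with
  the triangle inequality. It depends on the stage only, not on the element, and this is what makes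
  it harmless: all powers of one element share a stage.

  Vectors are handled as algebra elements: \<open>sq \<tau> z\<close> is the squared length of
  \<pi>(z) w. Every statement about \<pi> thereby becomes an inequality between values of positive
  functionals. The set \<open>E\<close> enters through one fact only: its indicator function is
  orthogonal to the image of that function under the partial isometry of the path n\<alpha>, because
  that image lives on f(E) for the path n\<alpha>.\<close>

inductive_set (in cstar_algebra) addspan :: "'a set \<Rightarrow> 'a set" for X where
  zero: "\<zero> \<in> addspan X"
| add: "x \<in> X \<Longrightarrow> y \<in> addspan X \<Longrightarrow> x \<oplus> y \<in> addspan X"

text \<open>If \<rho> < t, the powers of \<rho>/t decay faster than any linear factor grows. It is
  needed twice: with \<open>a = 0\<close> to remove the constant of a finite stage, and with
  \<open>a = 2 N\<close> to remove the number of degrees.\<close>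

lemma power_le_linear_times_power:
  fixes t \<rho> a b :: real
  assumes "0 \<le> t" "0 \<le> \<rho>" and le: "\<And>n. t ^ (2 ^ n) \<le> (a * 2 ^ n + b) * \<rho> ^ (2 ^ n)"
  shows "t \<le> \<rho>"
proof (rule ccontr)
  assume "\<not> t \<le> \<rho>"
  hence t: "t > 0" "\<rho> / t < 1" using assms by auto
  have "(\<lambda>m. a * (of_nat m * (\<rho> / t) ^ m) + b * (\<rho> / t) ^ m) \<longlonglongrightarrow> a * 0 + b * 0"
    using t assms by (intro tendsto_intros powser_times_n_limit_0 LIMSEQ_power_zero) auto
  hence lim: "(\<lambda>m. (a * of_nat m + b) * (\<rho> / t) ^ m) \<longlonglongrightarrow> 0"
    by (simp add: algebra_simps)
  have "strict_mono (\<lambda>n::nat. (2::nat) ^ n)" by (simp add: strict_mono_def)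
  from LIMSEQ_subseq_LIMSEQ[OF lim this]
  have "(\<lambda>n. (a * 2 ^ n + b) * (\<rho> / t) ^ (2 ^ n)) \<longlonglongrightarrow> 0" by (simp add: o_def)
  from order_tendstoD(2)[OF this, of 1] obtain n where "(a * 2 ^ n + b) * (\<rho> / t) ^ (2 ^ n) < 1"
    by (auto simp: eventually_sequentially)
  with le[of n] t show False by (simp add: power_divide divide_less_eq)
qed

context cstar_algebra
begin

section \<open>Arithmetic and norm without a unit\<close>

abbreviation carr :: "'a set" ("\<A>") where "\<A> \<equiv> carrier A"

declare mult_closed [simp, intro] scale_closed [simp, intro] star_closed [simp, intro]
  star_star [simp] scale_one [simp]

lemma smult_zero [simp]: "x \<in> \<A> \<Longrightarrow> 0 \<odot> x = \<zero>"
proof -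
  assume x: "x \<in> \<A>"
  have "0 \<odot> x \<oplus> 0 \<odot> x = \<zero> \<oplus> 0 \<odot> x"
    using scale_add_left[OF x, of 0 0] x by simp
  with x show ?thesis using add.right_cancel[of "0 \<odot> x" "0 \<odot> x" \<zero>] by simp
qed

lemma smult_zero_right [simp]: "c \<odot> \<zero> = \<zero>"
proof -
  have "c \<odot> \<zero> \<oplus> c \<odot> \<zero> = \<zero> \<oplus> c \<odot> \<zero>"
    using scale_add_right[of \<zero> \<zero> c] by simp
  thus ?thesis using add.right_cancel[of "c \<odot> \<zero>" "c \<odot> \<zero>" \<zero>] by simp
qed

lemma l_null [simp]: "x \<in> \<A> \<Longrightarrow> \<zero> \<otimes> x = \<zero>"
  using scale_mult_left[of \<zero> x 0] by simp

lemma r_null [simp]: "x \<in> \<A> \<Longrightarrow> x \<otimes> \<zero> = \<zero>"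
  using scale_mult_right[of x \<zero> 0] by simp

lemma star_zero [simp]: "star A \<zero> = \<zero>"
  using star_scale[of \<zero> 0] by simp

lemma a_inv_scale: "x \<in> \<A> \<Longrightarrow> \<ominus> x = (-1) \<odot> x"
proof -
  assume x: "x \<in> \<A>"
  have "(-1) \<odot> x \<oplus> x = \<zero>"
    using scale_add_left[OF x, of "-1" 1] x by simp
  thus ?thesis using x by (metis minus_equality scale_closed)
qed

lemma minus_scale: "x \<in> \<A> \<Longrightarrow> y \<in> \<A> \<Longrightarrow> x \<ominus> y = x \<oplus> (-1) \<odot> y"
  by (simp add: minus_eq a_inv_scale)

lemma nrm_zero [simp]: "nrm A \<zero> = 0"
  using nrm_eq_0 by blast

lemma minus_self [simp]: "x \<in> \<A> \<Longrightarrow> x \<ominus> x = \<zero>"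
  by (simp add: minus_eq r_neg)

lemma nrm_minus_commute: "x \<in> \<A> \<Longrightarrow> y \<in> \<A> \<Longrightarrow> nrm A (x \<ominus> y) = nrm A (y \<ominus> x)"
proof -
  assume xy: "x \<in> \<A>" "y \<in> \<A>"
  have "x \<ominus> y = (-1) \<odot> (y \<ominus> x)"
    using xy by (simp add: minus_scale scale_add_right scale_scale a_comm)
  thus ?thesis using xy by (simp add: nrm_scale)
qed

lemma nrm_nonneg [simp]: "x \<in> \<A> \<Longrightarrow> 0 \<le> nrm A x"
proof -
  assume x: "x \<in> \<A>"
  have "nrm A (x \<oplus> (-1) \<odot> x) \<le> nrm A x + nrm A ((-1) \<odot> x)"
    using x by (intro nrm_triangle) auto
  moreover have "x \<oplus> (-1) \<odot> x = \<zero>" using x by (metis minus_scale minus_self)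
  ultimately show ?thesis using x by (simp add: nrm_scale)
qed

lemma nrm_star [simp]: "x \<in> \<A> \<Longrightarrow> nrm A (star A x) = nrm A x"
proof -
  have le: "nrm A x \<le> nrm A (star A x)" if x: "x \<in> \<A>" for x
  proof (cases "nrm A x = 0")
    case False
    hence "nrm A x > 0" using nrm_nonneg[OF x] by linarith
    moreover have "nrm A x * nrm A x \<le> nrm A (star A x) * nrm A x"
      using cstar_identity[OF x] nrm_mult[of "star A x" x] x by (simp add: power2_eq_square)
    ultimately show ?thesis by simp
  qed (use x in simp)
  assume "x \<in> \<A>"
  with le[of x] le[of "star A x"] show ?thesis by simp
qed

lemma minus_trans: "\<lbrakk>x \<in> \<A>; y \<in> \<A>; z \<in> \<A>\<rbrakk> \<Longrightarrow> x \<ominus> z = (x \<ominus> y) \<oplus> (y \<ominus> z)"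
  by (simp add: minus_eq a_assoc[symmetric]) (simp add: a_assoc l_neg)

lemma nrm_minus_triangle:
  "\<lbrakk>x \<in> \<A>; y \<in> \<A>; z \<in> \<A>\<rbrakk> \<Longrightarrow> nrm A (x \<ominus> z) \<le> nrm A (x \<ominus> y) + nrm A (y \<ominus> z)"
  using minus_trans[of x y z] nrm_triangle[of "x \<ominus> y" "y \<ominus> z"] by simp

lemma add_minus_cancel [simp]: "\<lbrakk>x \<in> \<A>; y \<in> \<A>\<rbrakk> \<Longrightarrow> y \<oplus> (x \<ominus> y) = x"
  by (simp add: minus_eq a_lcomm r_neg)

lemma nrm_le_minus: "\<lbrakk>x \<in> \<A>; y \<in> \<A>\<rbrakk> \<Longrightarrow> nrm A x \<le> nrm A y + nrm A (x \<ominus> y)"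
  using nrm_triangle[of y "x \<ominus> y"] by simp

lemma minus_eq_zeroD: "\<lbrakk>x \<in> \<A>; y \<in> \<A>; x \<ominus> y = \<zero>\<rbrakk> \<Longrightarrow> x = y"
  using add_minus_cancel[of x y] by simp

lemma mult_minus_right:
  "\<lbrakk>x \<in> \<A>; y \<in> \<A>; z \<in> \<A>\<rbrakk> \<Longrightarrow> z \<otimes> (x \<ominus> y) = z \<otimes> x \<ominus> z \<otimes> y"
  by (simp add: minus_scale distrib_left scale_mult_right)

lemma mult_minus_left:
  "\<lbrakk>x \<in> \<A>; y \<in> \<A>; z \<in> \<A>\<rbrakk> \<Longrightarrow> (x \<ominus> y) \<otimes> z = x \<otimes> z \<ominus> y \<otimes> z"
  by (simp add: minus_scale distrib_right scale_mult_left)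

lemma scale_minus:
  "\<lbrakk>x \<in> \<A>; y \<in> \<A>\<rbrakk> \<Longrightarrow> c \<odot> (x \<ominus> y) = c \<odot> x \<ominus> c \<odot> y"
  by (simp add: minus_scale scale_add_right scale_scale mult.commute)

lemma star_minus:
  "\<lbrakk>x \<in> \<A>; y \<in> \<A>\<rbrakk> \<Longrightarrow> star A (x \<ominus> y) = star A x \<ominus> star A y"
  by (simp add: minus_scale star_add star_scale)

lemma add_minus_add:
  assumes "x \<in> \<A>" "y \<in> \<A>" "x' \<in> \<A>" "y' \<in> \<A>"
  shows "(x \<oplus> y) \<ominus> (x' \<oplus> y') = (x \<ominus> x') \<oplus> (y \<ominus> y')"
  using assms by (simp add: minus_eq minus_add a_ac)

section \<open>Norm limits\<close>

definition tends :: "(nat \<Rightarrow> 'a) \<Rightarrow> 'a \<Rightarrow> bool" where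
  "tends X x \<longleftrightarrow> (\<lambda>n. nrm A (X n \<ominus> x)) \<longlonglongrightarrow> 0"

lemma tends_unique:
  assumes "tends X x" "tends X y" and [simp]: "\<And>n. X n \<in> \<A>" "x \<in> \<A>" "y \<in> \<A>"
  shows "x = y"
proof -
  have "(\<lambda>n. nrm A (X n \<ominus> x) + nrm A (X n \<ominus> y)) \<longlonglongrightarrow> 0"
    using tendsto_add[OF assms(1,2)[unfolded tends_def]] by simp
  moreover have "nrm A (x \<ominus> y) \<le> nrm A (X n \<ominus> x) + nrm A (X n \<ominus> y)" for n
    using nrm_minus_triangle[of x "X n" y] nrm_minus_commute[of x "X n"] by simp
  ultimately have "nrm A (x \<ominus> y) \<le> 0"
    by (intro LIMSEQ_le[OF tendsto_const]) auto
  moreover have "nrm A (x \<ominus> y) \<ge> 0" by (intro nrm_nonneg) auto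
  ultimately have "x \<ominus> y = \<zero>" using nrm_eq_0[of "x \<ominus> y"] by (simp add: antisym)
  thus ?thesis by (simp add: minus_eq_zeroD)
qed

lemma tends_star:
  assumes "tends X x" and [simp]: "\<And>n. X n \<in> \<A>" "x \<in> \<A>"
  shows "tends (\<lambda>n. star A (X n)) (star A x)"
  using assms by (simp add: tends_def star_minus[symmetric])

lemma tends_scale:
  assumes "tends X x" and [simp]: "\<And>n. X n \<in> \<A>" "x \<in> \<A>"
  shows "tends (\<lambda>n. c \<odot> X n) (c \<odot> x)"
  using assms(1) by (simp add: tends_def scale_minus[symmetric] nrm_scale tendsto_mult_right_zero)

lemma tends_add:
  assumes "tends X x" "tends Y y"
    and [simp]: "\<And>n. X n \<in> \<A>" "x \<in> \<A>" "\<And>n. Y n \<in> \<A>" "y \<in> \<A>"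
  shows "tends (\<lambda>n. X n \<oplus> Y n) (x \<oplus> y)"
  unfolding tends_def
proof (rule tendsto_sandwich[OF _ _ tendsto_const])
  show "(\<lambda>n. nrm A (X n \<ominus> x) + nrm A (Y n \<ominus> y)) \<longlonglongrightarrow> 0"
    using tendsto_add[OF assms(1,2)[unfolded tends_def]] by simp
  show "\<forall>\<^sub>F n in sequentially. nrm A (X n \<oplus> Y n \<ominus> (x \<oplus> y)) \<le> nrm A (X n \<ominus> x) + nrm A (Y n \<ominus> y)"
    by (simp add: add_minus_add nrm_triangle)
qed auto

lemma tends_mult:
  assumes "tends X x" "tends Y y"
    and [simp]: "\<And>n. X n \<in> \<A>" "x \<in> \<A>" "\<And>n. Y n \<in> \<A>" "y \<in> \<A>"
  shows "tends (\<lambda>n. X n \<otimes> Y n) (x \<otimes> y)"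
  unfolding tends_def
proof (rule tendsto_sandwich[OF _ _ tendsto_const])
  let ?b = "\<lambda>n. nrm A (X n \<ominus> x) * (nrm A y + nrm A (Y n \<ominus> y)) + nrm A x * nrm A (Y n \<ominus> y)"
  have "?b \<longlonglongrightarrow> 0 * (nrm A y + 0) + nrm A x * 0"
    using assms(1,2) unfolding tends_def by (intro tendsto_intros)
  thus "?b \<longlonglongrightarrow> 0" by simp
  show "\<forall>\<^sub>F n in sequentially. nrm A (X n \<otimes> Y n \<ominus> x \<otimes> y) \<le> ?b n"
  proof (intro always_eventually allI)
    fix n
    have "nrm A (X n \<otimes> Y n \<ominus> x \<otimes> y) \<le> nrm A ((X n \<ominus> x) \<otimes> Y n) + nrm A (x \<otimes> (Y n \<ominus> y))"
      using nrm_minus_triangle[of "X n \<otimes> Y n" "x \<otimes> Y n" "x \<otimes> y"]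
      by (simp add: mult_minus_left mult_minus_right)
    also have "\<dots> \<le> nrm A (X n \<ominus> x) * nrm A (Y n) + nrm A x * nrm A (Y n \<ominus> y)"
      by (intro add_mono nrm_mult) auto
    also have "\<dots> \<le> ?b n"
      using nrm_le_minus[of "Y n" y] by (intro add_mono mult_left_mono) auto
    finally show "nrm A (X n \<otimes> Y n \<ominus> x \<otimes> y) \<le> ?b n" .
  qed
qed auto

text \<open>\<open>1 - m\<close> is the square root of \<open>1 - x\<close>; it is the limit of the iteration
  \<open>m \<mapsto> (x + m\<^sup>2) / 2\<close>, a contraction on a ball of radius less than 1.\<close>

lemma sqrt_exists:
  assumes x [simp]: "x \<in> \<A>" "star A x = x" and lt: "nrm A x < 1"
  obtains m where "m \<in> \<A>" "star A m = m" "m = (1/2) \<odot> (x \<oplus> m \<otimes> m)"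
proof -
  define X where "X = rec_nat \<zero> (\<lambda>_ m. (1/2) \<odot> (x \<oplus> m \<otimes> m))"
  have X0: "X 0 = \<zero>" and XS: "X (Suc n) = (1/2) \<odot> (x \<oplus> X n \<otimes> X n)" for n
    by (simp_all add: X_def)
  have [simp]: "X n \<in> \<A>" for n
    by (induction n) (auto simp: X0 XS)
  have sa: "star A (X n) = X n" for n
    by (induction n) (auto simp: X0 XS star_scale star_add star_mult)
  \<comment> \<open>The smaller fixed point of the scalar iteration
    \<open>t \<mapsto> (nrm A x + t\<^sup>2) / 2\<close>. It serves both as the radius of an
    invariant ball and as the contraction factor.\<close>
  define \<rho> where "\<rho> = 1 - sqrt (1 - nrm A x)"
  have \<rho>: "0 \<le> \<rho>" "\<rho> < 1" "(nrm A x + \<rho>\<^sup>2) / 2 = \<rho>"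
    using lt nrm_nonneg[OF x(1)] by (auto simp: \<rho>_def power2_eq_square field_simps)
  have bd: "nrm A (X n) \<le> \<rho>" for n
  proof (induction n)
    case (Suc n)
    have "nrm A (X (Suc n)) \<le> (nrm A x + nrm A (X n) * nrm A (X n)) / 2"
      using nrm_triangle[of x "X n \<otimes> X n"] nrm_mult[of "X n" "X n"] by (simp add: XS nrm_scale)
    also have "\<dots> \<le> (nrm A x + \<rho> * \<rho>) / 2"
      using Suc \<rho> by (intro divide_right_mono add_left_mono mult_mono) auto
    finally show ?case using \<rho> by (simp add: power2_eq_square)
  qed (use \<rho> in \<open>simp add: X0\<close>)
  have step: "nrm A (X (Suc (Suc n)) \<ominus> X (Suc n)) \<le> \<rho> * nrm A (X (Suc n) \<ominus> X n)" for n
  proof -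
    have "X (Suc (Suc n)) \<ominus> X (Suc n) = (1/2) \<odot> (X (Suc n) \<otimes> X (Suc n) \<ominus> X n \<otimes> X n)"
      unfolding XS[of "Suc n"] XS[of n] by (subst scale_minus[symmetric]) (auto simp: add_minus_add simp flip: XS)
    hence "nrm A (X (Suc (Suc n)) \<ominus> X (Suc n)) = nrm A (X (Suc n) \<otimes> X (Suc n) \<ominus> X n \<otimes> X n) / 2"
      by (simp add: nrm_scale)
    \<comment> \<open>This splitting of a difference of squares does not use that the iterates
      commute. Each of the two terms carries a factor \<rho>, which the 1/2 in front
      averages.\<close>
    also have "nrm A (X (Suc n) \<otimes> X (Suc n) \<ominus> X n \<otimes> X n) \<le>
        nrm A ((X (Suc n) \<ominus> X n) \<otimes> X (Suc n)) + nrm A (X n \<otimes> (X (Suc n) \<ominus> X n))"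
      using nrm_minus_triangle[of "X (Suc n) \<otimes> X (Suc n)" "X n \<otimes> X (Suc n)" "X n \<otimes> X n"]
      by (simp add: mult_minus_left mult_minus_right)
    also have "\<dots> \<le> nrm A (X (Suc n) \<ominus> X n) * nrm A (X (Suc n)) + nrm A (X n) * nrm A (X (Suc n) \<ominus> X n)"
      by (intro add_mono nrm_mult) auto
    also have "\<dots> \<le> nrm A (X (Suc n) \<ominus> X n) * \<rho> + \<rho> * nrm A (X (Suc n) \<ominus> X n)"
      using bd by (intro add_mono mult_mono) (auto simp: \<rho>)
    finally show ?thesis by (simp add: algebra_simps)
  qed
  have step': "nrm A (X (Suc n) \<ominus> X n) \<le> \<rho> ^ n * nrm A (X 1 \<ominus> X 0)" for n
  proof (induction n)
    case (Suc n)
    have "nrm A (X (Suc (Suc n)) \<ominus> X (Suc n)) \<le> \<rho> * (\<rho> ^ n * nrm A (X 1 \<ominus> X 0))"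
      using step[of n] Suc \<rho> by (meson mult_left_mono order_trans)
    thus ?case by (simp add: mult.assoc)
  qed auto
  define d where "d = nrm A (X 1 \<ominus> X 0)"
  have d: "d \<ge> 0" by (simp add: d_def)
  have tail: "nrm A (X (n + k) \<ominus> X n) \<le> d * \<rho> ^ n / (1 - \<rho>)" for n k
  proof -
    have "nrm A (X (n + k) \<ominus> X n) \<le> (\<Sum>i<k. d * \<rho> ^ (n + i))"
    proof (induction k)
      case (Suc k)
      have "nrm A (X (n + Suc k) \<ominus> X n) \<le> nrm A (X (Suc (n + k)) \<ominus> X (n + k)) + nrm A (X (n + k) \<ominus> X n)"
        using nrm_minus_triangle[of "X (n + Suc k)" "X (n + k)" "X n"] by simp
      with Suc step'[of "n + k"] show ?case by (simp add: d_def mult.commute)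
    qed auto
    also have "\<dots> = d * \<rho> ^ n * (\<Sum>i<k. \<rho> ^ i)"
      by (simp add: sum_distrib_left power_add mult.assoc)
    also have "\<dots> \<le> d * \<rho> ^ n * (1 / (1 - \<rho>))"
    proof (intro mult_left_mono)
      have "(\<Sum>i<k. \<rho> ^ i) \<le> (\<Sum>i. \<rho> ^ i)"
        using \<rho> by (intro sum_le_suminf summable_geometric) auto
      thus "(\<Sum>i<k. \<rho> ^ i) \<le> 1 / (1 - \<rho>)" using \<rho> by (simp add: suminf_geometric)
    qed (use d \<rho> in auto)
    finally show ?thesis by simp
  qed
  have "\<exists>m\<in>\<A>. (\<lambda>n. nrm A (X n \<ominus> m)) \<longlonglongrightarrow> 0"
  proof (rule complete)
    fix \<epsilon> :: real assume "\<epsilon> > 0"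
    have "(\<lambda>n. 2 * (d * \<rho> ^ n / (1 - \<rho>))) \<longlonglongrightarrow> 2 * (d * 0 / (1 - \<rho>))"
      using \<rho> by (intro tendsto_intros LIMSEQ_power_zero) auto
    from order_tendstoD(2)[OF this, of \<epsilon>] \<open>\<epsilon> > 0\<close>
    obtain N where N: "2 * (d * \<rho> ^ N / (1 - \<rho>)) < \<epsilon>"
      by (auto simp: eventually_sequentially)
    have "nrm A (X m \<ominus> X n) < \<epsilon>" if "m \<ge> N" "n \<ge> N" for m n
    proof -
      have "nrm A (X m \<ominus> X n) \<le> nrm A (X m \<ominus> X N) + nrm A (X n \<ominus> X N)"
        using nrm_minus_triangle[of "X m" "X N" "X n"] nrm_minus_commute[of "X N" "X n"] by simp
      also have "\<dots> \<le> 2 * (d * \<rho> ^ N / (1 - \<rho>))"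
        unfolding mult_2 using tail[of N "m - N"] tail[of N "n - N"] that
        by (metis add_mono le_add_diff_inverse)
      finally show ?thesis using N by simp
    qed
    thus "\<exists>N::nat. \<forall>m\<ge>N. \<forall>n\<ge>N. nrm A (X m \<ominus> X n) < \<epsilon>" by blast
  qed auto
  then obtain m where m [simp]: "m \<in> \<A>" and lim: "tends X m"
    by (auto simp: tends_def)
  have "tends (\<lambda>n. (1/2) \<odot> (x \<oplus> X n \<otimes> X n)) ((1/2) \<odot> (x \<oplus> m \<otimes> m))"
  proof (intro tends_scale tends_add tends_mult lim)
    show "tends (\<lambda>n. x) x" by (simp add: tends_def)
  qed auto
  moreover have "tends (\<lambda>n. (1/2) \<odot> (x \<oplus> X n \<otimes> X n)) m"
    using LIMSEQ_Suc[OF lim[unfolded tends_def]] by (simp add: tends_def XS)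
  ultimately have "m = (1/2) \<odot> (x \<oplus> m \<otimes> m)"
    by (intro tends_unique) auto
  moreover have "star A m = m"
    using tends_star[OF lim] lim by (intro tends_unique[of X]) (auto simp: sa)
  ultimately show ?thesis using that m by blast
qed

text \<open>The power with exponent 2^n. For a self-adjoint element the C*-identity makes the norm
  exactly multiplicative along repeated squaring, so these exponents suffice for all limit
  arguments.\<close>

primrec square_iter :: "'a \<Rightarrow> nat \<Rightarrow> 'a" where
  "square_iter x 0 = x"
| "square_iter x (Suc n) = square_iter x n \<otimes> square_iter x n"

lemma nrm_square_iter:
  assumes [simp]: "x \<in> \<A>" and sa: "star A x = x"
  shows "square_iter x n \<in> \<A> \<and> star A (square_iter x n) = square_iter x n \<and>
    nrm A (square_iter x n) = nrm A x ^ (2 ^ n)"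
proof (induction n)
  case (Suc n)
  hence "nrm A (square_iter x (Suc n)) = (nrm A x ^ (2 ^ n))\<^sup>2"
    using cstar_identity[of "square_iter x n"] by simp
  also have "\<dots> = nrm A x ^ (2 ^ Suc n)" by (simp add: mult.commute flip: power_mult)
  finally show ?case using Suc by (auto simp: star_mult)
qed (use assms in auto)

lemma square_iter_closed [simp]: "x \<in> \<A> \<Longrightarrow> square_iter x n \<in> \<A>"
  by (induction n) auto

lemma nrm_le_of_square_iter:
  assumes "x \<in> \<A>" "star A x = x" "0 \<le> \<rho>"
    and "\<And>n. nrm A (square_iter x n) \<le> (a * 2 ^ n + b) * \<rho> ^ (2 ^ n)"
  shows "nrm A x \<le> \<rho>"
  using assms nrm_square_iter[OF assms(1,2)]
  by (intro power_le_linear_times_power[of "nrm A x" \<rho> a b]) auto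

section \<open>Positive functionals\<close>

definition pos_fun :: "('a \<Rightarrow> complex) \<Rightarrow> bool" where
  "pos_fun \<tau> \<longleftrightarrow>
     (\<forall>x\<in>\<A>. \<forall>y\<in>\<A>. \<tau> (x \<oplus> y) = \<tau> x + \<tau> y) \<and>
     (\<forall>c. \<forall>x\<in>\<A>. \<tau> (c \<odot> x) = c * \<tau> x) \<and>
     (\<forall>x\<in>\<A>. \<tau> (star A x) = cnj (\<tau> x)) \<and>
     (\<forall>x\<in>\<A>. 0 \<le> Re (\<tau> (star A x \<otimes> x)))"

text \<open>The squared GNS seminorm. For the vector state of \<open>w\<close> it is the squared
  norm of \<pi>(z) w.\<close>

definition sq :: "('a \<Rightarrow> complex) \<Rightarrow> 'a \<Rightarrow> real" where
  "sq \<tau> z = Re (\<tau> (star A z \<otimes> z))"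

lemma
  assumes "pos_fun \<tau>"
  shows pos_fun_add: "\<lbrakk>x \<in> \<A>; y \<in> \<A>\<rbrakk> \<Longrightarrow> \<tau> (x \<oplus> y) = \<tau> x + \<tau> y"
    and pos_fun_scale: "x \<in> \<A> \<Longrightarrow> \<tau> (c \<odot> x) = c * \<tau> x"
    and pos_fun_star: "x \<in> \<A> \<Longrightarrow> \<tau> (star A x) = cnj (\<tau> x)"
    and sq_nonneg: "x \<in> \<A> \<Longrightarrow> 0 \<le> sq \<tau> x"
  using assms by (auto simp: pos_fun_def sq_def)

lemma pos_fun_minus:
  assumes "pos_fun \<tau>" "x \<in> \<A>" "y \<in> \<A>"
  shows "\<tau> (x \<ominus> y) = \<tau> x - \<tau> y"
  using assms by (simp add: minus_scale pos_fun_add pos_fun_scale)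

lemma pos_fun_zero: "pos_fun \<tau> \<Longrightarrow> \<tau> \<zero> = 0"
  using pos_fun_scale[of \<tau> \<zero> 0] by simp

lemma of_real_sq:
  assumes "pos_fun \<tau>" "x \<in> \<A>"
  shows "\<tau> (star A x \<otimes> x) = of_real (sq \<tau> x)"
proof -
  have "cnj (\<tau> (star A x \<otimes> x)) = \<tau> (star A x \<otimes> x)"
    using pos_fun_star[OF assms(1), of "star A x \<otimes> x"] assms(2) by (simp add: star_mult)
  hence "Im (\<tau> (star A x \<otimes> x)) = 0" by (simp add: complex_eq_iff)
  thus ?thesis by (simp add: sq_def complex_eq_iff)
qed

lemma Cauchy_Schwarz:
  assumes \<tau>: "pos_fun \<tau>" and [simp]: "y \<in> \<A>" "z \<in> \<A>"
  shows "(cmod (\<tau> (star A y \<otimes> z)))\<^sup>2 \<le> sq \<tau> y * sq \<tau> z"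
proof -
  define u where "u = \<tau> (star A y \<otimes> z)"
  have u': "\<tau> (star A z \<otimes> y) = cnj u"
    using pos_fun_star[OF \<tau>, of "star A y \<otimes> z"] by (simp add: star_mult u_def)
  have cu: "of_real ((cmod u)\<^sup>2) = u * cnj u" by (rule complex_norm_square)
  have quad: "0 \<le> sq \<tau> y - 2 * s * (cmod u)\<^sup>2 + s\<^sup>2 * (cmod u)\<^sup>2 * sq \<tau> z" for s :: real
  proof -
    \<comment> \<open>With this phase both cross terms become the same real number, minus s times
      the squared modulus of \<open>u\<close>.\<close>
    define t where "t = - (of_real s * cnj u)"
    have "star A (y \<oplus> t \<odot> z) \<otimes> (y \<oplus> t \<odot> z) =
        (star A y \<otimes> y \<oplus> t \<odot> (star A y \<otimes> z)) \<oplus>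
        (cnj t \<odot> (star A z \<otimes> y) \<oplus> (cnj t * t) \<odot> (star A z \<otimes> z))"
      by (simp add: star_add star_scale distrib_left distrib_right scale_mult_left scale_mult_right
          scale_scale scale_add_right a_ac mult.commute)
    hence "\<tau> (star A (y \<oplus> t \<odot> z) \<otimes> (y \<oplus> t \<odot> z)) =
        of_real (sq \<tau> y) + t * u + cnj t * cnj u + t * cnj t * of_real (sq \<tau> z)"
      by (simp add: pos_fun_add[OF \<tau>] pos_fun_scale[OF \<tau>] u' of_real_sq[OF \<tau>] flip: u_def)
    also have "t * u = - of_real (s * (cmod u)\<^sup>2)"
      unfolding of_real_mult cu by (simp add: t_def)
    also have "cnj t * cnj u = - of_real (s * (cmod u)\<^sup>2)"
      unfolding of_real_mult cu by (simp add: t_def)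
    also have "t * cnj t = of_real (s\<^sup>2 * (cmod u)\<^sup>2)"
      unfolding of_real_mult cu by (simp add: t_def power2_eq_square)
    finally have "sq \<tau> (y \<oplus> t \<odot> z) = sq \<tau> y - 2 * s * (cmod u)\<^sup>2 + s\<^sup>2 * (cmod u)\<^sup>2 * sq \<tau> z"
      by (simp add: sq_def)
    thus ?thesis using sq_nonneg[OF \<tau>, of "y \<oplus> t \<odot> z"] by simp
  qed
  have nn: "0 \<le> sq \<tau> y" "0 \<le> sq \<tau> z" using \<tau> by (auto intro: sq_nonneg)
  show ?thesis
  proof (cases "sq \<tau> z = 0")
    case True
    have "(cmod u)\<^sup>2 \<le> 0"
    proof (rule ccontr)
      assume "\<not> (cmod u)\<^sup>2 \<le> 0"
      \<comment> \<open>Without a quadratic term, the linear one alone can exceed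
        \<open>sq \<tau> y\<close>; this value of \<open>s\<close> makes it twice
        \<open>sq \<tau> y + 1\<close>.\<close>
      hence "2 * ((sq \<tau> y + 1) / (cmod u)\<^sup>2) * (cmod u)\<^sup>2 = 2 * (sq \<tau> y + 1)" by simp
      thus False using quad[of "(sq \<tau> y + 1) / (cmod u)\<^sup>2"] nn unfolding True by simp
    qed
    thus ?thesis using True by (simp add: u_def)
  next
    case False
    hence pos: "sq \<tau> z > 0" using nn by linarith
    have "(1 / sq \<tau> z)\<^sup>2 * (cmod u)\<^sup>2 * sq \<tau> z = (cmod u)\<^sup>2 / sq \<tau> z"
      using pos by (simp add: power2_eq_square)
    hence "(cmod u)\<^sup>2 / sq \<tau> z \<le> sq \<tau> y" using quad[of "1 / sq \<tau> z"] by simp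
    thus ?thesis using pos by (simp add: pos_divide_le_eq u_def)
  qed
qed

text \<open>Let x be \<open>star A c \<otimes> c\<close> and let 1 - m be the square root of 1 - x.
  Then the difference of the two sides is \<open>sq \<tau>\<close> of (1 - m) z, hence nonnegative.
  As there is no unit, (1 - m) z is written \<open>z \<ominus> m \<otimes> z\<close>.\<close>

lemma sq_mult_le_lt1:
  assumes \<tau>: "pos_fun \<tau>" and [simp]: "c \<in> \<A>" "z \<in> \<A>" and lt: "nrm A c < 1"
  shows "sq \<tau> (c \<otimes> z) \<le> sq \<tau> z"
proof -
  define x where "x = star A c \<otimes> c"
  have [simp]: "x \<in> \<A>" by (simp add: x_def)
  have "nrm A x < 1"
    using lt nrm_nonneg[of c] by (simp add: x_def cstar_identity power_less_one_iff)
  then obtain m where [simp]: "m \<in> \<A>" "star A m = m" and m: "m = (1/2) \<odot> (x \<oplus> m \<otimes> m)"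
    using sqrt_exists[of x] by (auto simp: x_def star_mult)
  have "\<tau> (star A z \<otimes> (m \<otimes> z)) = (\<tau> (star A z \<otimes> (x \<otimes> z)) + \<tau> (star A z \<otimes> (m \<otimes> (m \<otimes> z)))) / 2"
    by (subst (1) m) (simp add: distrib_left distrib_right scale_mult_left scale_mult_right
        pos_fun_add[OF \<tau>] pos_fun_scale[OF \<tau>] mult_assoc)
  hence m2: "\<tau> (star A z \<otimes> (x \<otimes> z)) = 2 * \<tau> (star A z \<otimes> (m \<otimes> z)) - \<tau> (star A z \<otimes> (m \<otimes> (m \<otimes> z)))"
    by (simp add: eq_diff_eq mult.commute)
  have "\<tau> (star A (z \<ominus> m \<otimes> z) \<otimes> (z \<ominus> m \<otimes> z)) =
      \<tau> (star A z \<otimes> z) - \<tau> (star A z \<otimes> (x \<otimes> z))"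
    unfolding m2 by (simp add: star_minus mult_minus_left mult_minus_right star_mult mult_assoc
        pos_fun_minus[OF \<tau>])
  also have "star A z \<otimes> (x \<otimes> z) = star A (c \<otimes> z) \<otimes> (c \<otimes> z)"
    by (simp add: x_def star_mult mult_assoc)
  finally have "\<tau> (star A (z \<ominus> m \<otimes> z) \<otimes> (z \<ominus> m \<otimes> z)) =
      \<tau> (star A z \<otimes> z) - \<tau> (star A (c \<otimes> z) \<otimes> (c \<otimes> z))" .
  with sq_nonneg[OF \<tau>, of "z \<ominus> m \<otimes> z"] show ?thesis by (simp add: sq_def)
qed

lemma sq_scale:
  assumes \<tau>: "pos_fun \<tau>" and [simp]: "z \<in> \<A>"
  shows "sq \<tau> (c \<odot> z) = (cmod c)\<^sup>2 * sq \<tau> z"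
proof -
  have cc: "of_real ((cmod c)\<^sup>2) = c * cnj c" by (rule complex_norm_square)
  have "\<tau> (star A (c \<odot> z) \<otimes> (c \<odot> z)) = of_real ((cmod c)\<^sup>2 * sq \<tau> z)"
    by (simp add: star_scale scale_mult_left scale_mult_right pos_fun_scale[OF \<tau>]
        of_real_sq[OF \<tau>] cc mult_ac del: of_real_power)
  thus ?thesis by (simp add: sq_def)
qed

text \<open>Scale \<open>c\<close> by 1/t for t above its norm and let t decrease to the norm. The
  limit also covers \<open>c\<close> of norm 0.\<close>

lemma sq_mult_le:
  assumes \<tau>: "pos_fun \<tau>" and [simp]: "c \<in> \<A>" "z \<in> \<A>"
  shows "sq \<tau> (c \<otimes> z) \<le> (nrm A c)\<^sup>2 * sq \<tau> z"
proof (rule tendsto_lowerbound)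
  show "((\<lambda>t. t\<^sup>2 * sq \<tau> z) \<longlongrightarrow> (nrm A c)\<^sup>2 * sq \<tau> z) (at_right (nrm A c))"
    by (intro tendsto_intros)
  show "\<forall>\<^sub>F t in at_right (nrm A c). sq \<tau> (c \<otimes> z) \<le> t\<^sup>2 * sq \<tau> z"
    unfolding eventually_at_right_field
  proof (intro exI[of _ "nrm A c + 1"] conjI allI impI)
    fix t assume t: "nrm A c < t"
    have t0: "t > 0" using le_less_trans[OF nrm_nonneg t] by simp
    have "sq \<tau> ((of_real (1/t) \<odot> c) \<otimes> z) \<le> sq \<tau> z"
      using t t0 by (intro sq_mult_le_lt1 \<tau>) (auto simp: nrm_scale norm_divide)
    thus "sq \<tau> (c \<otimes> z) \<le> t\<^sup>2 * sq \<tau> z"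
      using t0 by (simp add: scale_mult_left sq_scale \<tau> norm_divide power_divide divide_le_eq mult.commute)
  qed auto
qed auto

section \<open>Additive spans\<close>

lemma addspan_closed: "x \<in> addspan X \<Longrightarrow> X \<subseteq> \<A> \<Longrightarrow> x \<in> \<A>"
  by (induction rule: addspan.induct) auto

lemma addspan_base: "x \<in> X \<Longrightarrow> X \<subseteq> \<A> \<Longrightarrow> x \<in> addspan X"
  using addspan.add[OF _ addspan.zero, of x X] by auto

lemma addspan_mono: "x \<in> addspan X \<Longrightarrow> X \<subseteq> Y \<Longrightarrow> x \<in> addspan Y"
  by (induction rule: addspan.induct) (auto intro: addspan.intros)

lemma addspan_add:
  "x \<in> addspan X \<Longrightarrow> y \<in> addspan X \<Longrightarrow> X \<subseteq> \<A> \<Longrightarrow> x \<oplus> y \<in> addspan X"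
  by (induction rule: addspan.induct) (auto simp: addspan_closed a_assoc subset_iff intro: addspan.intros)

lemma addspan_map:
  assumes "x \<in> addspan X" "X \<subseteq> \<A>" "Y \<subseteq> \<A>"
    and "h \<zero> = \<zero>" "\<And>x y. x \<in> \<A> \<Longrightarrow> y \<in> \<A> \<Longrightarrow> h (x \<oplus> y) = h x \<oplus> h y"
    and "\<And>x. x \<in> X \<Longrightarrow> h x \<in> addspan Y"
  shows "h x \<in> addspan Y"
  using assms(1)
proof (induction rule: addspan.induct)
  case (add x y)
  have "x \<in> \<A>" "y \<in> \<A>" using add assms(2) by (auto dest: addspan_closed)
  hence "h (x \<oplus> y) = h x \<oplus> h y" by (rule assms(5))
  thus ?case using assms add by (auto intro!: addspan_add)
qed (use assms in \<open>auto intro: addspan.zero\<close>)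

lemma addspan_mult_left:
  assumes "x \<in> addspan X" "X \<subseteq> \<A>" "Y \<subseteq> \<A>" "c \<in> \<A>"
    and "\<And>x. x \<in> X \<Longrightarrow> c \<otimes> x \<in> addspan Y"
  shows "c \<otimes> x \<in> addspan Y"
  by (rule addspan_map[where X = X]) (use assms in \<open>auto simp: distrib_left\<close>)

lemma addspan_mult_right:
  assumes "x \<in> addspan X" "X \<subseteq> \<A>" "Y \<subseteq> \<A>" "c \<in> \<A>"
    and "\<And>x. x \<in> X \<Longrightarrow> x \<otimes> c \<in> addspan Y"
  shows "x \<otimes> c \<in> addspan Y"
  by (rule addspan_map[where X = X]) (use assms in \<open>auto simp: distrib_right\<close>)

lemma addspan_mult:
  assumes "x \<in> addspan X" "y \<in> addspan Y" "X \<subseteq> \<A>" "Y \<subseteq> \<A>" "Z \<subseteq> \<A>"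
    and "\<And>x y. x \<in> X \<Longrightarrow> y \<in> Y \<Longrightarrow> x \<otimes> y \<in> addspan Z"
  shows "x \<otimes> y \<in> addspan Z"
  using assms by (intro addspan_mult_right[OF assms(1)] addspan_mult_left[OF assms(2)])
    (auto dest: addspan_closed)

text \<open>\<open>addspan\<close> closes under addition only. It is a linear span because every
  generating set in use contains the multiples of its members.\<close>

lemma addspan_scale:
  assumes "x \<in> addspan X" "X \<subseteq> \<A>" "\<And>x. x \<in> X \<Longrightarrow> c \<odot> x \<in> X"
  shows "c \<odot> x \<in> addspan X"
  by (rule addspan_map[where X = X]) (use assms in \<open>auto simp: scale_add_right intro: addspan_base\<close>)

lemma addspan_star:
  assumes "x \<in> addspan X" "X \<subseteq> \<A>" "Y \<subseteq> \<A>" "\<And>x. x \<in> X \<Longrightarrow> star A x \<in> addspan Y"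
  shows "star A x \<in> addspan Y"
  by (rule addspan_map[where X = X]) (use assms in \<open>auto simp: star_add\<close>)

lemma minus_zero_right: "x \<in> \<A> \<Longrightarrow> x \<ominus> \<zero> = x"
  by (simp add: minus_scale)

section \<open>Finite sums\<close>

lemma finsum_scale_left:
  assumes "s \<in> \<A>"
  shows "finsum A (\<lambda>i. a i \<odot> s) I = (\<Sum>i\<in>I. a i) \<odot> s"
proof (cases "finite I")
  case True
  thus ?thesis
  proof (induction I)
    case (insert i I)
    have "(\<lambda>i. a i \<odot> s) \<in> I \<rightarrow> \<A>" using assms by auto
    with insert show ?case using assms by (simp add: finsum_insert scale_add_left)
  qed (use assms in auto)
qed (use assms in \<open>simp add: finsum_infinite\<close>)

lemma mult_finsum:
  assumes "c \<in> \<A>" "\<And>i. i \<in> I \<Longrightarrow> g i \<in> \<A>"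
  shows "c \<otimes> finsum A g I = finsum A (\<lambda>i. c \<otimes> g i) I"
proof (cases "finite I")
  case True
  thus ?thesis using assms
  proof (induction I)
    case (insert i I)
    hence "g \<in> I \<rightarrow> \<A>" "(\<lambda>i. c \<otimes> g i) \<in> I \<rightarrow> \<A>" by auto
    with insert show ?case by (simp add: finsum_insert distrib_left)
  qed auto
qed (use assms in \<open>simp add: finsum_infinite\<close>)

lemma finsum_mult:
  assumes "c \<in> \<A>" "\<And>i. i \<in> I \<Longrightarrow> g i \<in> \<A>"
  shows "finsum A g I \<otimes> c = finsum A (\<lambda>i. g i \<otimes> c) I"
proof (cases "finite I")
  case True
  thus ?thesis using assms
  proof (induction I)
    case (insert i I)
    hence "g \<in> I \<rightarrow> \<A>" "(\<lambda>i. g i \<otimes> c) \<in> I \<rightarrow> \<A>" by auto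
    with insert show ?case by (simp add: finsum_insert distrib_right)
  qed auto
qed (use assms in \<open>simp add: finsum_infinite\<close>)

lemma star_finsum:
  assumes "\<And>i. i \<in> I \<Longrightarrow> g i \<in> \<A>"
  shows "star A (finsum A g I) = finsum A (\<lambda>i. star A (g i)) I"
proof (cases "finite I")
  case True
  thus ?thesis using assms
  proof (induction I)
    case (insert i I)
    hence "g \<in> I \<rightarrow> \<A>" "(\<lambda>i. star A (g i)) \<in> I \<rightarrow> \<A>" by auto
    with insert show ?case by (simp add: finsum_insert star_add)
  qed auto
qed (use assms in \<open>simp add: finsum_infinite\<close>)

lemma nrm_finsum:
  assumes "\<And>i. i \<in> I \<Longrightarrow> g i \<in> \<A>"
  shows "nrm A (finsum A g I) \<le> (\<Sum>i\<in>I. nrm A (g i))"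
proof (cases "finite I")
  case True
  thus ?thesis using assms
  proof (induction I)
    case (insert i I)
    hence "g \<in> I \<rightarrow> \<A>" by auto
    moreover from this have "nrm A (g i \<oplus> finsum A g I) \<le> nrm A (g i) + nrm A (finsum A g I)"
      using insert by (intro nrm_triangle) (auto intro: finsum_closed)
    ultimately show ?case using insert by (simp add: finsum_insert)
  qed auto
qed (use assms in \<open>simp add: finsum_infinite\<close>)

lemma addspan_orthogonal:
  assumes "pos_fun \<tau>" and X: "X \<subseteq> \<A>" and Y: "Y \<subseteq> \<A>"
    and "\<And>x y. x \<in> X \<Longrightarrow> y \<in> Y \<Longrightarrow> \<tau> (star A x \<otimes> y) = 0"
    and "x \<in> addspan X" "y \<in> addspan Y"
  shows "\<tau> (star A x \<otimes> y) = 0"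
proof -
  have 1: "\<tau> (star A x \<otimes> y) = 0" if "x \<in> X" "y \<in> addspan Y" for x y
    using that(2)
  proof (induction rule: addspan.induct)
    case (add y y')
    hence "y \<in> \<A>" "y' \<in> \<A>" "x \<in> \<A>" using that X Y by (auto dest: addspan_closed)
    thus ?case using add that assms by (simp add: distrib_left pos_fun_add)
  qed (use that X in \<open>auto simp: pos_fun_zero[OF assms(1)]\<close>)
  have y: "y \<in> \<A>" using assms Y by (auto dest: addspan_closed)
  show ?thesis using assms(5)
  proof (induction rule: addspan.induct)
    case (add x x')
    hence "x \<in> \<A>" "x' \<in> \<A>" using X by (auto dest: addspan_closed)
    thus ?case using add 1[OF _ assms(6)] y assms(1) by (simp add: star_add distrib_right pos_fun_add)
  qed (use y in \<open>auto simp: pos_fun_zero[OF assms(1)]\<close>)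
qed

end

section \<open>Cuntz-Krieger families and their grading\<close>

locale ck_algebra = cstar_algebra A for A :: "'a cstar" (structure) +
  fixes G :: "('v, 'e) ultragraph" and S :: "'e \<Rightarrow> 'a" and P :: "'v set \<Rightarrow> 'a"
  assumes wf: "wf_ultragraph G" and family: "ck_family G A S P"
begin

section \<open>Consequences of the Cuntz-Krieger relations\<close>

abbreviation edge_set :: "'e set" ("\<E>") where "\<E> \<equiv> edges G"
abbreviation gen_vert_sets :: "'v set set" ("\<V>") where "\<V> \<equiv> gen_verts G"

lemma src_in_verts [simp]: "e \<in> \<E> \<Longrightarrow> src G e \<in> verts G"
  and rng_nonempty: "e \<in> \<E> \<Longrightarrow> rng G e \<noteq> {}"
  and rng_subset: "e \<in> \<E> \<Longrightarrow> rng G e \<subseteq> verts G"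
  using wf by (auto simp: wf_ultragraph_def)

lemma gen_verts_subset: "B \<in> \<V> \<Longrightarrow> B \<subseteq> verts G"
  by (induction rule: gen_verts.induct) (use rng_subset in auto)

lemma S_closed [simp, intro]: "e \<in> \<E> \<Longrightarrow> S e \<in> \<A>"
  using family by (simp add: ck_family_def is_partial_isometry_def)

lemma S_partial_isometry: "e \<in> \<E> \<Longrightarrow> S e \<otimes> star A (S e) \<otimes> S e = S e"
  using family by (simp add: ck_family_def is_partial_isometry_def)

lemma P_closed [simp, intro]: "B \<in> \<V> \<Longrightarrow> P B \<in> \<A>"
  using family by (simp add: ck_family_def is_projection_def)

lemma P_star [simp]: "B \<in> \<V> \<Longrightarrow> star A (P B) = P B"
  using family by (simp add: ck_family_def is_projection_def)

lemma P_empty [simp]: "P {} = \<zero>"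
  using family by (simp add: ck_family_def)

lemma P_mult [simp]: "\<lbrakk>B \<in> \<V>; C \<in> \<V>\<rbrakk> \<Longrightarrow> P B \<otimes> P C = P (B \<inter> C)"
  using family by (simp add: ck_family_def)

lemma P_union: "\<lbrakk>B \<in> \<V>; C \<in> \<V>\<rbrakk> \<Longrightarrow> P (B \<union> C) = (P B \<oplus> P C) \<ominus> P (B \<inter> C)"
  using family by (simp add: ck_family_def)

lemma SS_same [simp]: "e \<in> \<E> \<Longrightarrow> star A (S e) \<otimes> S e = P (rng G e)"
  using family by (simp add: ck_family_def)

declare gen_verts.intros [simp, intro]

lemma P_S_src: "e \<in> \<E> \<Longrightarrow> P {src G e} \<otimes> S e = S e"
proof -
  assume e: "e \<in> \<E>"
  have "P {src G e} \<otimes> (S e \<otimes> star A (S e)) = S e \<otimes> star A (S e)"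
    using family e by (simp add: ck_family_def proj_le_def)
  hence "P {src G e} \<otimes> (S e \<otimes> star A (S e)) \<otimes> S e = S e"
    using S_partial_isometry[OF e] by simp
  thus ?thesis using e S_partial_isometry[OF e] by (simp add: mult_assoc del: SS_same)
qed

lemma S_P_rng [simp]: "e \<in> \<E> \<Longrightarrow> S e \<otimes> P (rng G e) = S e"
  using S_partial_isometry[of e] by (simp add: mult_assoc)

lemma P_regular:
  "\<lbrakk>v \<in> verts G; finite (out_edges G {v}); out_edges G {v} \<noteq> {}\<rbrakk> \<Longrightarrow>
    P {v} = finsum A (\<lambda>e. S e \<otimes> star A (S e)) (out_edges G {v})"
  using family by (simp add: ck_family_def)

text \<open>The relation concerns range projections. Writing each factor u as u times its adjoint
  times u brings the product of the two range projections into the middle.\<close>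

lemma SS_diff [simp]:
  assumes e: "e \<in> \<E>" "f \<in> \<E>" "e \<noteq> f"
  shows "star A (S e) \<otimes> S f = \<zero>"
proof -
  have z: "(S e \<otimes> star A (S e)) \<otimes> (S f \<otimes> star A (S f)) = \<zero>"
    using family e unfolding ck_family_def by blast
  have *: "star A (S e) = star A (S e) \<otimes> S e \<otimes> star A (S e)" if "e \<in> \<E>" for e
    using arg_cong[OF S_partial_isometry[OF that], of "star A"] that
    by (simp add: star_mult mult_assoc del: SS_same)
  have "star A (S e) \<otimes> S f = (star A (S e) \<otimes> S e \<otimes> star A (S e)) \<otimes> (S f \<otimes> star A (S f) \<otimes> S f)"
    using *[OF e(1)] S_partial_isometry[OF e(2)] by simp
  also have "\<dots> = star A (S e) \<otimes> ((S e \<otimes> star A (S e)) \<otimes> (S f \<otimes> star A (S f))) \<otimes> S f"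
    using e by (simp add: mult_assoc del: SS_same)
  finally show ?thesis using e by (simp add: z)
qed

lemma P_S [simp]:
  assumes "e \<in> \<E>" "B \<in> \<V>"
  shows "P B \<otimes> S e = (if src G e \<in> B then S e else \<zero>)"
proof -
  have "P B \<otimes> S e = (P B \<otimes> P {src G e}) \<otimes> S e"
    using assms by (simp add: mult_assoc P_S_src del: P_mult)
  also have "P B \<otimes> P {src G e} = (if src G e \<in> B then P {src G e} else \<zero>)"
    using assms by simp
  finally show ?thesis using assms P_S_src by simp
qed

lemma SS_mult [simp]:
  assumes "e \<in> \<E>" "f \<in> \<E>" "y \<in> \<A>"
  shows "star A (S e) \<otimes> (S f \<otimes> y) = (if e = f then P (rng G e) \<otimes> y else \<zero>)"
  using assms by (simp flip: mult_assoc)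

lemma P_S_mult [simp]:
  assumes "e \<in> \<E>" "B \<in> \<V>" "y \<in> \<A>"
  shows "P B \<otimes> (S e \<otimes> y) = (if src G e \<in> B then S e \<otimes> y else \<zero>)"
  using assms by (simp flip: mult_assoc)

lemma P_P_mult [simp]:
  assumes "B \<in> \<V>" "C \<in> \<V>" "y \<in> \<A>"
  shows "P B \<otimes> (P C \<otimes> y) = P (B \<inter> C) \<otimes> y"
  using assms by (simp flip: mult_assoc)

lemma S_P_mult [simp]:
  assumes "e \<in> \<E>" "y \<in> \<A>"
  shows "S e \<otimes> (P (rng G e) \<otimes> y) = S e \<otimes> y"
  using assms by (simp flip: mult_assoc)

lemma nrm_P_le: "B \<in> \<V> \<Longrightarrow> nrm A (P B) \<le> 1"
proof -
  assume B: "B \<in> \<V>"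
  have "nrm A (P B) * nrm A (P B) = nrm A (P B) * 1"
    using cstar_identity[of "P B"] B by (simp add: power2_eq_square)
  thus ?thesis by (cases "nrm A (P B) = 0") auto
qed

lemma nrm_S_le: "e \<in> \<E> \<Longrightarrow> nrm A (S e) \<le> 1"
proof -
  assume e: "e \<in> \<E>"
  have "(nrm A (S e))\<^sup>2 \<le> 1\<^sup>2"
    using cstar_identity[of "S e"] e nrm_P_le[of "rng G e"] by simp
  thus ?thesis by (rule power2_le_imp_le) simp
qed

text \<open>\<open>A\<close> has no unit, so \<open>S\<^sub>\<alpha>\<close> for a possibly empty \<open>\<alpha>\<close> exists only as a left multiplication:
  \<open>lm \<alpha> x\<close> is \<open>S\<^sub>\<alpha> x\<close> and \<open>lms \<alpha> x\<close> is \<open>S\<^sub>\<alpha>\<^sup>* x\<close>.\<close>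

primrec lm :: "'e list \<Rightarrow> 'a \<Rightarrow> 'a" where
  "lm [] x = x"
| "lm (e # \<alpha>) x = S e \<otimes> lm \<alpha> x"

primrec lms :: "'e list \<Rightarrow> 'a \<Rightarrow> 'a" where
  "lms [] x = x"
| "lms (e # \<alpha>) x = lms \<alpha> (star A (S e) \<otimes> x)"

lemma lm_closed [simp]: "set \<alpha> \<subseteq> \<E> \<Longrightarrow> x \<in> \<A> \<Longrightarrow> lm \<alpha> x \<in> \<A>"
  by (induction \<alpha>) auto

lemma lms_closed [simp]: "set \<alpha> \<subseteq> \<E> \<Longrightarrow> x \<in> \<A> \<Longrightarrow> lms \<alpha> x \<in> \<A>"
  by (induction \<alpha> arbitrary: x) auto

lemma lm_append: "lm (\<alpha> @ \<beta>) x = lm \<alpha> (lm \<beta> x)"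
  by (induction \<alpha>) auto

lemma lm_mult:
  "\<lbrakk>set \<alpha> \<subseteq> \<E>; x \<in> \<A>; y \<in> \<A>\<rbrakk> \<Longrightarrow> lm \<alpha> x \<otimes> y = lm \<alpha> (x \<otimes> y)"
  by (induction \<alpha>) (auto simp: mult_assoc)

lemma lm_zero [simp]: "set \<alpha> \<subseteq> \<E> \<Longrightarrow> lm \<alpha> \<zero> = \<zero>"
  by (induction \<alpha>) auto

lemma lms_zero [simp]: "set \<alpha> \<subseteq> \<E> \<Longrightarrow> lms \<alpha> \<zero> = \<zero>"
  by (induction \<alpha>) auto

lemma star_lm_mult:
  "\<lbrakk>set \<alpha> \<subseteq> \<E>; x \<in> \<A>; y \<in> \<A>\<rbrakk> \<Longrightarrow> star A (lm \<alpha> x) \<otimes> y = star A x \<otimes> lms \<alpha> y"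
proof (induction \<alpha> arbitrary: y)
  case (Cons e \<alpha>)
  have "star A (lm (e # \<alpha>) x) \<otimes> y = star A (lm \<alpha> x) \<otimes> (star A (S e) \<otimes> y)"
    using Cons.prems by (simp add: star_mult mult_assoc)
  also have "\<dots> = star A x \<otimes> lms (e # \<alpha>) y"
    using Cons.prems by (subst Cons.IH) auto
  finally show ?case .
qed auto

text \<open>This is \<open>S\<^sub>\<alpha> P\<^sub>B S\<^sub>\<beta>\<^sup>*\<close>. The
  projection makes it an element of the algebra even when both words are empty. The words need not
  be paths; a word that is not a path gives zero.\<close>

definition mon :: "'e list \<Rightarrow> 'v set \<Rightarrow> 'e list \<Rightarrow> 'a" where
  "mon \<alpha> B \<beta> = lm \<alpha> (star A (lm \<beta> (P B)))"

lemma mon_closed [simp]: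
  "\<lbrakk>set \<alpha> \<subseteq> \<E>; B \<in> \<V>; set \<beta> \<subseteq> \<E>\<rbrakk> \<Longrightarrow> mon \<alpha> B \<beta> \<in> \<A>"
  by (simp add: mon_def)

lemma mon_Cons: "mon (e # \<alpha>) B \<beta> = S e \<otimes> mon \<alpha> B \<beta>"
  by (simp add: mon_def)

lemma mon_eq:
  assumes "set \<alpha> \<subseteq> \<E>" "B \<in> \<V>" "set \<beta> \<subseteq> \<E>"
  shows "mon \<alpha> B \<beta> = lm \<alpha> (P B) \<otimes> star A (lm \<beta> (P B))"
proof -
  have "star A (lm \<beta> (P B)) = star A (lm \<beta> (P B) \<otimes> P B)"
    using assms by (simp add: lm_mult)
  also have "\<dots> = P B \<otimes> star A (lm \<beta> (P B))"
    using assms by (simp add: star_mult)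
  finally have "mon \<alpha> B \<beta> = lm \<alpha> (P B \<otimes> star A (lm \<beta> (P B)))"
    unfolding mon_def by simp
  thus ?thesis using assms by (simp add: lm_mult)
qed

lemma star_mon:
  assumes "set \<alpha> \<subseteq> \<E>" "B \<in> \<V>" "set \<beta> \<subseteq> \<E>"
  shows "star A (mon \<alpha> B \<beta>) = mon \<beta> B \<alpha>"
  using assms by (simp add: mon_eq star_mult)

lemma mon_mult:
  assumes "set \<alpha> \<subseteq> \<E>" "B \<in> \<V>" "set \<beta> \<subseteq> \<E>" "y \<in> \<A>"
  shows "mon \<alpha> B \<beta> \<otimes> y = lm \<alpha> (P B \<otimes> lms \<beta> y)"
  using assms by (simp add: mon_def lm_mult star_lm_mult)

lemma P_mult_mon:
  assumes "set \<alpha> \<subseteq> \<E>" "B \<in> \<V>" "set \<beta> \<subseteq> \<E>" "C \<in> \<V>"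
  shows "P C \<otimes> mon \<alpha> B \<beta> =
    (case \<alpha> of [] \<Rightarrow> mon [] (B \<inter> C) \<beta> | e # _ \<Rightarrow> if src G e \<in> C then mon \<alpha> B \<beta> else \<zero>)"
proof (cases \<alpha>)
  case Nil
  have "P C \<otimes> star A (lm \<beta> (P B)) = star A (lm \<beta> (P B) \<otimes> P C)"
    using assms by (simp add: star_mult)
  thus ?thesis using assms Nil by (simp add: mon_def lm_mult)
next
  case (Cons e \<alpha>')
  thus ?thesis using assms by (simp add: mon_Cons)
qed

text \<open>If \<open>\<alpha>\<close> is empty, the new letter moves to the other word: the product
  is the adjoint of \<open>S\<^sub>\<beta> P\<^sub>B S\<^sub>e\<close>. There \<open>P B\<close> is
  absorbed or annihilates, and the initial projection of \<open>S e\<close> takes its place.\<close>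

lemma star_S_mult_mon:
  assumes "set \<alpha> \<subseteq> \<E>" "B \<in> \<V>" "set \<beta> \<subseteq> \<E>" "e \<in> \<E>"
  shows "star A (S e) \<otimes> mon \<alpha> B \<beta> =
    (case \<alpha> of [] \<Rightarrow> if src G e \<in> B then mon [] (rng G e) (\<beta> @ [e]) else \<zero>
     | f # \<alpha>' \<Rightarrow> if e = f then P (rng G e) \<otimes> mon \<alpha>' B \<beta> else \<zero>)"
proof (cases \<alpha>)
  case Nil
  have "star A (S e) \<otimes> star A (lm \<beta> (P B)) = star A (lm \<beta> (P B) \<otimes> S e)"
    using assms by (simp add: star_mult)
  thus ?thesis using assms Nil by (simp add: mon_def lm_mult lm_append)
next
  case (Cons f \<alpha>')
  thus ?thesis using assms by (simp add: mon_Cons)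
qed

section \<open>Grading by the difference of word lengths\<close>

definition monomials :: "int \<Rightarrow> 'a set" where
  "monomials d = {c \<odot> mon \<alpha> B \<beta> | c \<alpha> B \<beta>. set \<alpha> \<subseteq> \<E> \<and> B \<in> \<V> \<and>
     set \<beta> \<subseteq> \<E> \<and> int (length \<alpha>) - int (length \<beta>) = d}"

abbreviation Deg :: "int \<Rightarrow> 'a set" where "Deg d \<equiv> addspan (monomials d)"

lemma monomials_closed: "monomials d \<subseteq> \<A>"
  by (auto simp: monomials_def)

lemma Deg_closed: "x \<in> Deg d \<Longrightarrow> x \<in> \<A>"
  using addspan_closed monomials_closed by blast

lemma monomialsI: "\<lbrakk>set \<alpha> \<subseteq> \<E>; B \<in> \<V>; set \<beta> \<subseteq> \<E>;
    int (length \<alpha>) - int (length \<beta>) = d\<rbrakk> \<Longrightarrow> c \<odot> mon \<alpha> B \<beta> \<in> monomials d"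
  unfolding monomials_def by blast

lemma Deg_mon: "\<lbrakk>set \<alpha> \<subseteq> \<E>; B \<in> \<V>; set \<beta> \<subseteq> \<E>;
    int (length \<alpha>) - int (length \<beta>) = d\<rbrakk> \<Longrightarrow> mon \<alpha> B \<beta> \<in> Deg d"
  using addspan_base[OF monomialsI[of \<alpha> B \<beta> d 1] monomials_closed] by simp

lemma monomials_scale: "x \<in> monomials d \<Longrightarrow> c \<odot> x \<in> monomials d"
proof -
  assume "x \<in> monomials d"
  then obtain c' \<alpha> B \<beta> where "x = c' \<odot> mon \<alpha> B \<beta>" "set \<alpha> \<subseteq> \<E>" "B \<in> \<V>"
    "set \<beta> \<subseteq> \<E>" "int (length \<alpha>) - int (length \<beta>) = d" by (auto simp: monomials_def)
  thus ?thesis by (auto simp: scale_scale intro!: monomialsI)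
qed

lemma Deg_scale: "x \<in> Deg d \<Longrightarrow> c \<odot> x \<in> Deg d"
  by (rule addspan_scale[OF _ monomials_closed]) (auto intro: monomials_scale)

lemma Deg_zero [simp]: "\<zero> \<in> Deg d"
  by (rule addspan.zero)

lemma Deg_add: "x \<in> Deg d \<Longrightarrow> y \<in> Deg d \<Longrightarrow> x \<oplus> y \<in> Deg d"
  by (rule addspan_add[OF _ _ monomials_closed])

lemma Deg_mult_left:
  assumes x: "x \<in> Deg d" and u: "u \<in> \<A>"
    and mon: "\<And>\<alpha> B \<beta>. \<lbrakk>set \<alpha> \<subseteq> \<E>; B \<in> \<V>; set \<beta> \<subseteq> \<E>;
      int (length \<alpha>) - int (length \<beta>) = d\<rbrakk> \<Longrightarrow> u \<otimes> mon \<alpha> B \<beta> \<in> Deg d'"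
  shows "u \<otimes> x \<in> Deg d'"
proof (rule addspan_mult_left[OF x monomials_closed monomials_closed u])
  fix y assume "y \<in> monomials d"
  then obtain c \<alpha> B \<beta> where "y = c \<odot> mon \<alpha> B \<beta>" "set \<alpha> \<subseteq> \<E>" "B \<in> \<V>"
    "set \<beta> \<subseteq> \<E>" "int (length \<alpha>) - int (length \<beta>) = d" by (auto simp: monomials_def)
  thus "u \<otimes> y \<in> Deg d'" using u mon by (simp add: scale_mult_right Deg_scale)
qed

lemma Deg_S_mult: "x \<in> Deg d \<Longrightarrow> e \<in> \<E> \<Longrightarrow> S e \<otimes> x \<in> Deg (d + 1)"
  by (erule Deg_mult_left) (auto intro!: Deg_mon simp flip: mon_Cons)

lemma Deg_P_mult: "x \<in> Deg d \<Longrightarrow> C \<in> \<V> \<Longrightarrow> P C \<otimes> x \<in> Deg d"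
  by (erule Deg_mult_left) (auto simp: P_mult_mon split: list.split intro!: Deg_mon)

lemma Deg_star_S_mult: "x \<in> Deg d \<Longrightarrow> e \<in> \<E> \<Longrightarrow> star A (S e) \<otimes> x \<in> Deg (d - 1)"
  by (erule Deg_mult_left) (auto simp: star_S_mult_mon split: list.split intro!: Deg_mon Deg_P_mult)

lemma Deg_lm: "x \<in> Deg d \<Longrightarrow> set \<alpha> \<subseteq> \<E> \<Longrightarrow> lm \<alpha> x \<in> Deg (d + int (length \<alpha>))"
proof (induction \<alpha>)
  case (Cons e \<alpha>)
  thus ?case using Deg_S_mult[of "lm \<alpha> x" "d + int (length \<alpha>)" e] by (simp add: algebra_simps)
qed auto

lemma Deg_lms: "x \<in> Deg d \<Longrightarrow> set \<alpha> \<subseteq> \<E> \<Longrightarrow> lms \<alpha> x \<in> Deg (d - int (length \<alpha>))"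
proof (induction \<alpha> arbitrary: x d)
  case (Cons e \<alpha>)
  thus ?case using Cons.IH[OF Deg_star_S_mult[of x d e]] by (simp add: algebra_simps)
qed auto

text \<open>Multiplication by a monomial is a composition of \<open>lms\<close>, a projection and
  \<open>lm\<close>. Each of them shifts the degree by a fixed amount, so no comparison of
  overlapping words is needed.\<close>

lemma Deg_mult: "x \<in> Deg d \<Longrightarrow> y \<in> Deg d' \<Longrightarrow> x \<otimes> y \<in> Deg (d + d')"
proof (erule addspan_mult_right[OF _ monomials_closed monomials_closed], goal_cases)
  case (2 x)
  then obtain c \<alpha> B \<beta> where *: "x = c \<odot> mon \<alpha> B \<beta>" "set \<alpha> \<subseteq> \<E>" "B \<in> \<V>"
    "set \<beta> \<subseteq> \<E>" "int (length \<alpha>) - int (length \<beta>) = d" by (auto simp: monomials_def)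
  have "lm \<alpha> (P B \<otimes> lms \<beta> y) \<in> Deg (d' - int (length \<beta>) + int (length \<alpha>))"
    using * 2 by (intro Deg_lm Deg_P_mult Deg_lms)
  moreover have "d' - int (length \<beta>) + int (length \<alpha>) = d + d'" using * by simp
  ultimately show ?case using * Deg_closed[OF 2(1)]
    by (simp add: scale_mult_left mon_mult Deg_scale)
qed (auto intro: Deg_closed)

lemma Deg_star: "x \<in> Deg d \<Longrightarrow> star A x \<in> Deg (- d)"
proof (erule addspan_star[OF _ monomials_closed monomials_closed], goal_cases)
  case (1 x)
  then obtain c \<alpha> B \<beta> where *: "x = c \<odot> mon \<alpha> B \<beta>" "set \<alpha> \<subseteq> \<E>" "B \<in> \<V>"
    "set \<beta> \<subseteq> \<E>" "int (length \<alpha>) - int (length \<beta>) = d" by (auto simp: monomials_def)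
  thus ?case by (auto simp: star_scale star_mon intro!: Deg_scale Deg_mon)
qed

text \<open>The analogue of trigonometric polynomials of degree at most \<open>N\<close>: degrees
  are bounded, word lengths are not. Under products the bound is additive.\<close>

definition filt :: "nat \<Rightarrow> 'a set" where
  "filt N = addspan (\<Union>d\<in>{- int N..int N}. monomials d)"

lemma filt_sub: "(\<Union>d\<in>D. monomials d) \<subseteq> \<A>"
  using monomials_closed by auto

lemma filt_closed: "x \<in> filt N \<Longrightarrow> x \<in> \<A>"
  unfolding filt_def by (erule addspan_closed[OF _ filt_sub])

lemma Deg_filt: "x \<in> Deg d \<Longrightarrow> \<bar>d\<bar> \<le> int N \<Longrightarrow> x \<in> filt N"
  unfolding filt_def by (erule addspan_mono) (intro UN_upper, auto)

lemma filt_mult: "x \<in> filt M \<Longrightarrow> y \<in> filt N \<Longrightarrow> x \<otimes> y \<in> filt (M + N)"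
  unfolding filt_def
proof (erule (1) addspan_mult[OF _ _ filt_sub filt_sub filt_sub], goal_cases)
  case (1 x y)
  then obtain d d' where d: "x \<in> monomials d" "y \<in> monomials d'" "\<bar>d\<bar> \<le> int M" "\<bar>d'\<bar> \<le> int N" by auto
  hence "x \<otimes> y \<in> Deg (d + d')" by (intro Deg_mult addspan_base monomials_closed)
  from Deg_filt[OF this, of "M + N"] d show ?case by (simp add: filt_def)
qed

lemma filt_star: "x \<in> filt N \<Longrightarrow> star A x \<in> filt N"
  unfolding filt_def
proof (erule addspan_star[OF _ filt_sub filt_sub], goal_cases)
  case (1 x)
  then obtain d where d: "x \<in> monomials d" "\<bar>d\<bar> \<le> int N" by auto
  hence "star A x \<in> Deg (- d)" by (intro Deg_star addspan_base monomials_closed)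
  from Deg_filt[OF this, of N] d show ?case by (simp add: filt_def)
qed

lemma filt_mono: "x \<in> filt M \<Longrightarrow> M \<le> N \<Longrightarrow> x \<in> filt N"
  unfolding filt_def by (erule addspan_mono) force

lemma filt_decompose:
  assumes "x \<in> filt N"
  obtains b where "\<And>d. b d \<in> Deg d" "x = finsum A b {- int N..int N}"
proof -
  have "\<exists>b. (\<forall>d. b d \<in> Deg d) \<and> x = finsum A b {- int N..int N}"
    using assms unfolding filt_def
  proof (induction rule: addspan.induct)
    case zero
    show ?case by (intro exI[of _ "\<lambda>_. \<zero>"]) auto
  next
    case (add x y)
    from add.hyps(1) obtain d where d: "x \<in> monomials d" "d \<in> {- int N..int N}" by blast
    from add.IH obtain b where b: "\<And>d. b d \<in> Deg d" "y = finsum A b {- int N..int N}" by blast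
    have cl: "b \<in> I \<rightarrow> \<A>" for I using b Deg_closed by auto
    have x: "x \<in> \<A>" using d monomials_closed by auto
    let ?s = "\<lambda>d'. if d = d' then x else \<zero>"
    have "finsum A (\<lambda>d'. ?s d' \<oplus> b d') {- int N..int N} = x \<oplus> y"
      using d b cl x finsum_addf[of ?s "{- int N..int N}" b]
        finsum_singleton[of d "{- int N..int N}" "\<lambda>_. x"] by simp
    moreover have "?s d' \<in> Deg d'" for d'
      using d by (auto intro: addspan_base[OF _ monomials_closed])
    hence "?s d' \<oplus> b d' \<in> Deg d'" for d' using b by (intro Deg_add) auto
    ultimately show ?case using b by (intro exI[of _ "\<lambda>d'. ?s d' \<oplus> b d'"]) auto
  qed
  thus ?thesis using that by blast
qed

lemma filt_add: "x \<in> filt N \<Longrightarrow> y \<in> filt N \<Longrightarrow> x \<oplus> y \<in> filt N"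
  unfolding filt_def by (rule addspan_add[OF _ _ filt_sub])

lemma filt_scale: "x \<in> filt N \<Longrightarrow> c \<odot> x \<in> filt N"
  unfolding filt_def by (rule addspan_scale[OF _ filt_sub]) (auto intro: monomials_scale)

text \<open>The norm closure of the union of all \<open>filt N\<close> is a C*-subalgebra that
  contains the generators, hence everything.\<close>

lemma filt_dense:
  assumes gen: "generated_cstar A (S ` \<E> \<union> P ` \<V>) = \<A>"
    and x: "x \<in> \<A>" and "\<epsilon> > 0"
  obtains N y where "y \<in> filt N" "nrm A (x \<ominus> y) < \<epsilon>"
proof -
  define L where "L = (\<Union>N. filt N)"
  have L: "x \<in> L \<Longrightarrow> x \<in> \<A>" for x by (auto simp: L_def filt_closed)
  have L_add: "x \<oplus> y \<in> L" if "x \<in> L" "y \<in> L" for x y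
  proof -
    from that obtain M N where "x \<in> filt M" "y \<in> filt N" by (auto simp: L_def)
    hence "x \<oplus> y \<in> filt (max M N)" by (intro filt_add) (auto intro: filt_mono)
    thus ?thesis by (auto simp: L_def)
  qed
  define V where "V = {x \<in> \<A>. \<exists>Y. (\<forall>n. Y n \<in> L) \<and> tends Y x}"
  \<comment> \<open>Approximability within every \<epsilon> yields a sequence, by choosing an
    approximant for each 1/(n+1). This also gives closedness of \<open>V\<close> under
    limits.\<close>
  have Vc: "x \<in> V" if x: "x \<in> \<A>" and *: "\<And>\<epsilon>. \<epsilon> > 0 \<Longrightarrow> \<exists>y\<in>L. nrm A (y \<ominus> x) < \<epsilon>" for x
  proof -
    from *[of "1 / Suc n" for n] obtain Y where Y: "Y n \<in> L" "nrm A (Y n \<ominus> x) < 1 / Suc n" for n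
      by (metis of_nat_0_less_iff zero_less_Suc zero_less_divide_1_iff)
    have "tends Y x" unfolding tends_def
    proof (rule tendsto_sandwich[OF _ _ tendsto_const LIMSEQ_inverse_real_of_nat])
      show "\<forall>\<^sub>F n in sequentially. 0 \<le> nrm A (Y n \<ominus> x)"
        using Y x L by (intro always_eventually allI nrm_nonneg) auto
      show "\<forall>\<^sub>F n in sequentially. nrm A (Y n \<ominus> x) \<le> inverse (real (Suc n))"
        using Y by (intro always_eventually allI) (simp add: inverse_eq_divide less_imp_le)
    qed
    thus ?thesis using x Y unfolding V_def by blast
  qed
  have VI: "x \<in> V" if "\<And>n. Y n \<in> L" "tends Y x" "x \<in> \<A>" for Y x
    using that by (auto simp: V_def)
  have "S ` \<E> \<union> P ` \<V> \<subseteq> L"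
  proof -
    have "S e \<in> L" if "e \<in> \<E>" for e
      using Deg_filt[OF Deg_mon[of "[e]" "rng G e" "[]" 1], of 1] that
      by (auto simp: L_def mon_def)
    moreover have "P B \<in> L" if "B \<in> \<V>" for B
      using Deg_filt[OF Deg_mon[of "[]" B "[]" 0], of 0] that by (auto simp: L_def mon_def)
    ultimately show ?thesis by auto
  qed
  moreover have "L \<subseteq> V"
  proof
    fix y assume y: "y \<in> L"
    show "y \<in> V" using y L[OF y] by (intro Vc) (auto intro!: bexI[of _ y])
  qed
  moreover have "cstar_subalgebra A V"
    unfolding cstar_subalgebra_def
  proof (intro conjI ballI allI impI)
    show "V \<subseteq> \<A>" by (auto simp: V_def)
    have "\<zero> \<in> L" using Deg_filt[of \<zero> 0 0] by (auto simp: L_def)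
    thus "\<zero> \<in> V" using \<open>L \<subseteq> V\<close> by auto
  next
    fix x y assume "x \<in> V" "y \<in> V"
    then obtain X Y where XY: "x \<in> \<A>" "y \<in> \<A>" "\<And>n. X n \<in> L" "\<And>n. Y n \<in> L"
      "tends X x" "tends Y y" unfolding V_def by blast
    show "x \<oplus> y \<in> V"
      by (rule VI[OF L_add[OF XY(3,4)] tends_add[OF XY(5,6) L[OF XY(3)] XY(1) L[OF XY(4)] XY(2)]
            a_closed[OF XY(1,2)]])
    have "X n \<otimes> Y n \<in> L" for n
      using XY(3,4)[of n] filt_mult unfolding L_def by blast
    thus "x \<otimes> y \<in> V"
      by (rule VI[OF _ tends_mult[OF XY(5,6) L[OF XY(3)] XY(1) L[OF XY(4)] XY(2)]
            mult_closed[OF XY(1,2)]])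
  next
    fix c x assume "x \<in> V"
    then obtain X where X: "x \<in> \<A>" "\<And>n. X n \<in> L" "tends X x" unfolding V_def by blast
    have "c \<odot> X n \<in> L" for n using X(2)[of n] filt_scale unfolding L_def by blast
    thus "c \<odot> x \<in> V"
      by (rule VI[OF _ tends_scale[OF X(3) L[OF X(2)] X(1)] scale_closed[OF X(1)]])
  next
    fix x assume "x \<in> V"
    then obtain X where X: "x \<in> \<A>" "\<And>n. X n \<in> L" "tends X x" unfolding V_def by blast
    have "star A (X n) \<in> L" for n using X(2)[of n] filt_star unfolding L_def by blast
    thus "star A x \<in> V"
      by (rule VI[OF _ tends_star[OF X(3) L[OF X(2)] X(1)] star_closed[OF X(1)]])
  next
    fix X x assume X: "\<forall>n. X n \<in> V" "x \<in> \<A>" "(\<lambda>n. nrm A (X n \<ominus> x)) \<longlonglongrightarrow> 0"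
    show "x \<in> V"
    proof (rule Vc)
      fix \<epsilon> :: real assume e: "\<epsilon> > 0"
      from order_tendstoD(2)[OF X(3), of "\<epsilon>/2"] e obtain n where n: "nrm A (X n \<ominus> x) < \<epsilon> / 2"
        by (auto simp: eventually_sequentially)
      from X(1) obtain Y where Y: "X n \<in> \<A>" "\<And>k. Y k \<in> L" "tends Y (X n)"
        unfolding V_def by blast
      from order_tendstoD(2)[OF Y(3)[unfolded tends_def], of "\<epsilon>/2"] e
      obtain k where k: "nrm A (Y k \<ominus> X n) < \<epsilon> / 2" by (auto simp: eventually_sequentially)
      have "nrm A (Y k \<ominus> x) < \<epsilon>"
        using nrm_minus_triangle[of "Y k" "X n" x] n k Y(1) X(2) L[OF Y(2)[of k]] by simp
      thus "\<exists>y\<in>L. nrm A (y \<ominus> x) < \<epsilon>" using Y by blast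
    qed (use X in auto)
  qed
  ultimately have "generated_cstar A (S ` \<E> \<union> P ` \<V>) \<subseteq> V"
    unfolding generated_cstar_def by blast
  with gen x have "x \<in> V" by auto
  then obtain Y where Y: "\<And>k. Y k \<in> L" "tends Y x" unfolding V_def by blast
  from order_tendstoD(2)[OF Y(2)[unfolded tends_def], of \<epsilon>] \<open>\<epsilon> > 0\<close>
  obtain k where k: "nrm A (Y k \<ominus> x) < \<epsilon>" by (auto simp: eventually_sequentially)
  have "nrm A (x \<ominus> Y k) < \<epsilon>" using k nrm_minus_commute[of x "Y k"] x L[OF Y(1)] by simp
  with Y(1)[of k] that show ?thesis by (auto simp: L_def)
qed

text \<open>The algebraic form of "s has its range below the projection of v". All projections of
  the family then act on \<open>s\<close> as the scalar 0 or 1.\<close>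

definition base :: "'v \<Rightarrow> 'a \<Rightarrow> bool" where
  "base v s \<longleftrightarrow> v \<in> verts G \<and> s \<in> \<A> \<and>
     (\<forall>B\<in>\<V>. P B \<otimes> s = (if v \<in> B then s else \<zero>))"

text \<open>Cancel equal letters from the front. That \<open>\<delta>\<close> is strictly shorter
  matters: after each cancellation a letter of \<open>\<eta>\<close> remains, and it either absorbs
  the projection left behind or is annihilated by it.\<close>

lemma star_lm_mult_lm:
  assumes "set \<delta> \<subseteq> \<E>" "set \<eta> \<subseteq> \<E>" "x \<in> \<A>" "y \<in> \<A>"
    "length \<delta> < length \<eta>"
  shows "star A (lm \<delta> x) \<otimes> lm \<eta> y = \<zero> \<or>
    take (length \<delta>) \<eta> = \<delta> \<and>
    star A (lm \<delta> x) \<otimes> lm \<eta> y = star A x \<otimes> lm (drop (length \<delta>) \<eta>) y"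
  using assms
proof (induction \<delta> arbitrary: \<eta>)
  case (Cons e \<delta>)
  then obtain f \<eta>' where \<eta>: "\<eta> = f # \<eta>'" by (cases \<eta>) auto
  with Cons.prems obtain g \<eta>'' where \<eta>': "\<eta>' = g # \<eta>''" by (cases \<eta>') auto
  have eq: "star A (lm (e # \<delta>) x) \<otimes> lm \<eta> y = star A (lm \<delta> x) \<otimes> (star A (S e) \<otimes> (S f \<otimes> lm \<eta>' y))"
    using Cons.prems \<eta> by (simp add: star_mult mult_assoc)
  show ?case
  proof (cases "e = f \<and> src G g \<in> rng G e")
    case True
    hence "e = f" "src G g \<in> rng G f" by auto
    hence "star A (lm (e # \<delta>) x) \<otimes> lm \<eta> y = star A (lm \<delta> x) \<otimes> lm \<eta>' y"
      unfolding eq using Cons.prems \<eta> \<eta>' by simp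
    with Cons.IH[of \<eta>'] Cons.prems \<eta> True show ?thesis by auto
  next
    case False
    hence "star A (lm (e # \<delta>) x) \<otimes> lm \<eta> y = \<zero>"
      unfolding eq using Cons.prems \<eta> \<eta>' by auto
    thus ?thesis by simp
  qed
qed auto

lemma add_minus_self: "\<lbrakk>b \<in> \<A>; z \<in> \<A>\<rbrakk> \<Longrightarrow> (b \<oplus> z) \<ominus> b = z"
  by (simp add: minus_eq a_comm[of b z] a_assoc r_neg)

text \<open>\<open>U - V\<close> is the disjoint union of its parts inside and outside
  \<open>B\<close>. As \<open>gen_verts\<close> is not closed under complements, each part is again
  presented as a difference of two members.\<close>

lemma P_difference_split:
  assumes gv: "W \<in> \<V>" "U \<in> \<V>" "V \<in> \<V>" "B \<in> \<V>" and "V \<subseteq> U"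
  shows "P (W \<inter> U) \<ominus> P (W \<inter> V) =
    (P (W \<inter> (U \<inter> B)) \<ominus> P (W \<inter> (V \<inter> B))) \<oplus> (P (W \<inter> U) \<ominus> P (W \<inter> (V \<union> U \<inter> B)))"
proof -
  let ?e = "P (W \<inter> (V \<union> U \<inter> B))"
  have "W \<inter> (V \<union> U \<inter> B) = W \<inter> V \<union> W \<inter> (U \<inter> B)" "(W \<inter> V) \<inter> (W \<inter> (U \<inter> B)) = W \<inter> (V \<inter> B)"
    using \<open>V \<subseteq> U\<close> by auto
  hence "?e = P (W \<inter> V) \<oplus> (P (W \<inter> (U \<inter> B)) \<ominus> P (W \<inter> (V \<inter> B)))"
    using gv P_union[of "W \<inter> V" "W \<inter> (U \<inter> B)"] by (simp add: minus_eq a_assoc)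
  hence "?e \<ominus> P (W \<inter> V) = P (W \<inter> (U \<inter> B)) \<ominus> P (W \<inter> (V \<inter> B))"
    using gv by (simp add: add_minus_self)
  moreover have "P (W \<inter> U) \<ominus> P (W \<inter> V) = (P (W \<inter> U) \<ominus> ?e) \<oplus> (?e \<ominus> P (W \<inter> V))"
    using gv by (intro minus_trans) auto
  ultimately show ?thesis using gv by (simp add: a_comm)
qed

text \<open>Splitting \<open>U - V\<close> along one further set at a time reduces the estimate to sets on which the
  coefficient function is constant; no atoms of the Boolean algebra need to be named.\<close>

lemma diagonal_bound_aux:
  fixes L :: "'a \<Rightarrow> 'a"
  assumes L [simp]: "\<And>x. x \<in> \<A> \<Longrightarrow> L x \<in> \<A>"
    and L_add: "\<And>x y. x \<in> \<A> \<Longrightarrow> y \<in> \<A> \<Longrightarrow> L (x \<oplus> y) = L x \<oplus> L y"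
    and L_scale: "\<And>c x. x \<in> \<A> \<Longrightarrow> L (c \<odot> x) = c \<odot> L x"
    and L0: "\<And>U V. \<lbrakk>U \<in> \<V>; V \<in> \<V>; V \<subseteq> U; (U - V) \<inter> T = {}\<rbrakk> \<Longrightarrow> L (P U \<ominus> P V) = \<zero>"
    and "finite BB" "BB \<subseteq> \<V>" "U \<in> \<V>" "V \<in> \<V>" "V \<subseteq> U"
  shows "\<exists>C\<ge>0. \<forall>c0 c t. 0 \<le> t \<longrightarrow>
      (\<forall>v\<in>T \<inter> (U - V). cmod (c0 + (\<Sum>B\<in>{B\<in>BB. v \<in> B}. c B)) \<le> t) \<longrightarrow>
      nrm A (L (c0 \<odot> (P U \<ominus> P V) \<oplus> finsum A (\<lambda>B. c B \<odot> (P (B \<inter> U) \<ominus> P (B \<inter> V))) BB)) \<le> C * t"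
  using assms(5-)
proof (induction BB arbitrary: U V)
  case empty
  show ?case
  proof (intro exI[of _ "nrm A (L (P U \<ominus> P V))"] conjI allI impI)
    fix c0 :: complex and c :: "'v set \<Rightarrow> complex" and t :: real
    assume t: "0 \<le> t" "\<forall>v\<in>T \<inter> (U - V). cmod (c0 + (\<Sum>B\<in>{B\<in>{}. v \<in> B}. c B)) \<le> t"
    have "cmod c0 * nrm A (L (P U \<ominus> P V)) \<le> t * nrm A (L (P U \<ominus> P V))"
    \<comment> \<open>If \<open>U - V\<close> misses \<open>T\<close>, the hypothesis says nothing
      about \<open>c0\<close>; then \<open>L\<close> annihilates the projection instead.\<close>
    proof (cases "(U - V) \<inter> T = {}")
      case True
      thus ?thesis using empty L0 by simp
    next
      case False
      hence "cmod c0 \<le> t" using t by auto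
      thus ?thesis using empty by (intro mult_right_mono nrm_nonneg L) auto
    qed
    thus "nrm A (L (c0 \<odot> (P U \<ominus> P V) \<oplus> finsum A (\<lambda>B. c B \<odot> (P (B \<inter> U) \<ominus> P (B \<inter> V))) {})) \<le>
        nrm A (L (P U \<ominus> P V)) * t"
      using empty by (simp add: L_scale nrm_scale mult.commute)
  qed (use empty in auto)
next
  case (insert B0 BB)
  have gv [simp]: "U \<in> \<V>" "V \<in> \<V>" "B0 \<in> \<V>" "\<And>B. B \<in> BB \<Longrightarrow> B \<in> \<V>"
    using insert by auto
  define V' where "V' = V \<union> U \<inter> B0"
  have [simp]: "V' \<in> \<V>" by (simp add: V'_def)
  have sub: "BB \<subseteq> \<V>" "V \<inter> B0 \<subseteq> U \<inter> B0" "V' \<subseteq> U"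
    using insert.prems by (auto simp: V'_def)
  have "U \<inter> B0 \<in> \<V>" "V \<inter> B0 \<in> \<V>" by auto
  from insert.IH[OF sub(1) this sub(2)] obtain C1 where C1: "C1 \<ge> 0"
    "\<And>c0 c t. \<lbrakk>0 \<le> t; \<forall>v\<in>T \<inter> (U \<inter> B0 - V \<inter> B0). cmod (c0 + (\<Sum>B\<in>{B\<in>BB. v \<in> B}. c B)) \<le> t\<rbrakk> \<Longrightarrow>
      nrm A (L (c0 \<odot> (P (U \<inter> B0) \<ominus> P (V \<inter> B0)) \<oplus>
        finsum A (\<lambda>B. c B \<odot> (P (B \<inter> (U \<inter> B0)) \<ominus> P (B \<inter> (V \<inter> B0)))) BB)) \<le> C1 * t"
    by blast
  from insert.IH[OF sub(1) gv(1) _ sub(3)] obtain C2 where C2: "C2 \<ge> 0"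
    "\<And>c0 c t. \<lbrakk>0 \<le> t; \<forall>v\<in>T \<inter> (U - V'). cmod (c0 + (\<Sum>B\<in>{B\<in>BB. v \<in> B}. c B)) \<le> t\<rbrakk> \<Longrightarrow>
      nrm A (L (c0 \<odot> (P U \<ominus> P V') \<oplus> finsum A (\<lambda>B. c B \<odot> (P (B \<inter> U) \<ominus> P (B \<inter> V'))) BB)) \<le> C2 * t"
    by auto
  show ?case
  proof (intro exI[of _ "C1 + C2"] conjI allI impI)
    fix c0 :: complex and c :: "'v set \<Rightarrow> complex" and t :: real
    assume t: "0 \<le> t"
      "\<forall>v\<in>T \<inter> (U - V). cmod (c0 + (\<Sum>B\<in>{B\<in>insert B0 BB. v \<in> B}. c B)) \<le> t"
    let ?a = "\<lambda>B. c B \<odot> (P (B \<inter> (U \<inter> B0)) \<ominus> P (B \<inter> (V \<inter> B0)))"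
    let ?b = "\<lambda>B. c B \<odot> (P (B \<inter> U) \<ominus> P (B \<inter> V'))"
    let ?g = "\<lambda>B. c B \<odot> (P (B \<inter> U) \<ominus> P (B \<inter> V))"
    let ?e1 = "P (U \<inter> B0) \<ominus> P (V \<inter> B0)" and ?e2 = "P U \<ominus> P V'"
    \<comment> \<open>Inside \<open>B0\<close> its coefficient joins the constant term; outside
      \<open>B0\<close> it disappears. So \<open>c0\<close> collects the coefficients of the sets
      already known to contain the piece.\<close>
    let ?x1 = "(c0 + c B0) \<odot> ?e1 \<oplus> finsum A ?a BB"
    let ?x2 = "c0 \<odot> ?e2 \<oplus> finsum A ?b BB"
    have cl: "?a \<in> BB \<rightarrow> \<A>" "?b \<in> BB \<rightarrow> \<A>" "?g \<in> BB \<rightarrow> \<A>" by auto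
    hence [simp]: "finsum A ?a BB \<in> \<A>" "finsum A ?b BB \<in> \<A>" "finsum A ?g BB \<in> \<A>"
      by (auto intro: finsum_closed)
    have "P U \<ominus> P V = ?e1 \<oplus> ?e2"
    proof -
      have "U \<inter> U = U" "U \<inter> V = V" "U \<inter> (U \<inter> B0) = U \<inter> B0" "U \<inter> (V \<inter> B0) = V \<inter> B0"
        "U \<inter> (V \<union> U \<inter> B0) = V \<union> U \<inter> B0" using \<open>V \<subseteq> U\<close> by auto
      thus ?thesis using P_difference_split[OF gv(1) gv(1-3) \<open>V \<subseteq> U\<close>] unfolding V'_def by simp
    qed
    moreover have "?g B0 = c B0 \<odot> ?e1"
      by (simp add: Int_commute)
    moreover have "finsum A ?g BB = finsum A ?a BB \<oplus> finsum A ?b BB"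
    proof -
      have "finsum A ?g BB = finsum A (\<lambda>B. ?a B \<oplus> ?b B) BB"
        using cl P_difference_split[OF _ gv(1-3) \<open>V \<subseteq> U\<close>]
        by (intro finsum_cong') (auto simp: V'_def simp flip: scale_add_right)
      also have "\<dots> = finsum A ?a BB \<oplus> finsum A ?b BB" using cl by (intro finsum_addf)
      finally show ?thesis .
    qed
    ultimately have "c0 \<odot> (P U \<ominus> P V) \<oplus> finsum A ?g (insert B0 BB) = ?x1 \<oplus> ?x2"
      using insert(1,2) cl
      by (simp add: finsum_insert scale_add_left scale_add_right a_ac)
    hence "nrm A (L (c0 \<odot> (P U \<ominus> P V) \<oplus> finsum A ?g (insert B0 BB))) \<le> nrm A (L ?x1) + nrm A (L ?x2)"
      by (simp add: L_add nrm_triangle)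
    also have "\<dots> \<le> C1 * t + C2 * t"
    proof (intro add_mono C1(2) C2(2) t ballI)
      fix v assume v: "v \<in> T \<inter> (U \<inter> B0 - V \<inter> B0)"
      hence "{B\<in>insert B0 BB. v \<in> B} = insert B0 {B\<in>BB. v \<in> B}" by auto
      hence eq: "(\<Sum>B\<in>{B\<in>insert B0 BB. v \<in> B}. c B) = c B0 + (\<Sum>B\<in>{B\<in>BB. v \<in> B}. c B)"
        using insert by simp
      have "cmod (c0 + (\<Sum>B\<in>{B\<in>insert B0 BB. v \<in> B}. c B)) \<le> t" using t(2) v by blast
      thus "cmod (c0 + c B0 + (\<Sum>B\<in>{B\<in>BB. v \<in> B}. c B)) \<le> t"
        unfolding eq by (simp only: add.assoc)
    next
      fix v assume v: "v \<in> T \<inter> (U - V')"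
      hence eq: "{B\<in>insert B0 BB. v \<in> B} = {B\<in>BB. v \<in> B}" by (auto simp: V'_def)
      have "cmod (c0 + (\<Sum>B\<in>{B\<in>insert B0 BB. v \<in> B}. c B)) \<le> t"
        using t(2) v by (auto simp: V'_def simp del: insert_iff)
      thus "cmod (c0 + (\<Sum>B\<in>{B\<in>BB. v \<in> B}. c B)) \<le> t" unfolding eq .
    qed
    finally show "nrm A (L (c0 \<odot> (P U \<ominus> P V) \<oplus> finsum A ?g (insert B0 BB))) \<le> (C1 + C2) * t"
      by (simp add: algebra_simps)
  qed (use C1 C2 in simp)
qed

lemma gen_verts_Union: "finite X \<Longrightarrow> X \<subseteq> \<V> \<Longrightarrow> \<Union>X \<in> \<V>"
  by (induction X rule: finite_induct) auto

text \<open>\<open>L\<close> will be the identity with all vertices as \<open>T\<close>, or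
  \<open>Rm\<close> with the singular vertices as \<open>T\<close>. The constant precedes the
  coefficients, so that one constant serves all powers of an element.\<close>

lemma diagonal_bound:
  fixes L :: "'a \<Rightarrow> 'a"
  assumes "\<And>x. x \<in> \<A> \<Longrightarrow> L x \<in> \<A>"
    and "\<And>x y. x \<in> \<A> \<Longrightarrow> y \<in> \<A> \<Longrightarrow> L (x \<oplus> y) = L x \<oplus> L y"
    and "\<And>c x. x \<in> \<A> \<Longrightarrow> L (c \<odot> x) = c \<odot> L x"
    and "\<And>U V. \<lbrakk>U \<in> \<V>; V \<in> \<V>; V \<subseteq> U; (U - V) \<inter> T = {}\<rbrakk> \<Longrightarrow> L (P U \<ominus> P V) = \<zero>"
    and BB: "finite BB" "BB \<subseteq> \<V>"
  shows "\<exists>C\<ge>0. \<forall>c t. 0 \<le> t \<longrightarrow> (\<forall>v\<in>T. cmod (\<Sum>B\<in>{B\<in>BB. v \<in> B}. c B) \<le> t) \<longrightarrow>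
      nrm A (L (finsum A (\<lambda>B. c B \<odot> P B) BB)) \<le> C * t"
proof -
  let ?U = "\<Union>BB"
  from diagonal_bound_aux[of L T BB ?U "{}", OF assms gen_verts_Union[OF BB] gen_verts.empty empty_subsetI]
  obtain C where C: "C \<ge> 0" "\<forall>c0 c t. 0 \<le> t \<longrightarrow>
      (\<forall>v\<in>T \<inter> (?U - {}). cmod (c0 + (\<Sum>B\<in>{B\<in>BB. v \<in> B}. c B)) \<le> t) \<longrightarrow>
      nrm A (L (c0 \<odot> (P ?U \<ominus> P {}) \<oplus> finsum A (\<lambda>B. c B \<odot> (P (B \<inter> ?U) \<ominus> P (B \<inter> {}))) BB)) \<le> C * t"
    by blast
  show ?thesis
  proof (intro exI[of _ C] conjI allI impI C(1))
    fix c :: "'v set \<Rightarrow> complex" and t :: real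
    assume t: "0 \<le> t" "\<forall>v\<in>T. cmod (\<Sum>B\<in>{B\<in>BB. v \<in> B}. c B) \<le> t"
    have m0: "x \<ominus> \<zero> = x" if "x \<in> \<A>" for x using that by (simp add: minus_scale)
    have "finsum A (\<lambda>B. c B \<odot> (P (B \<inter> ?U) \<ominus> P (B \<inter> {}))) BB = finsum A (\<lambda>B. c B \<odot> P B) BB"
    proof (intro finsum_cong' refl funcsetI)
      fix B assume B: "B \<in> BB"
      hence "B \<inter> ?U = B" by auto
      thus "c B \<odot> (P (B \<inter> ?U) \<ominus> P (B \<inter> {})) = c B \<odot> P B" using B BB by (simp add: m0 subset_iff)
    qed (use BB in auto)
    moreover have "finsum A (\<lambda>B. c B \<odot> P B) BB \<in> \<A>"
      using BB by (intro finsum_closed) auto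
    ultimately show "nrm A (L (finsum A (\<lambda>B. c B \<odot> P B) BB)) \<le> C * t"
      using C(2)[rule_format, of t 0 c] t gen_verts_Union[OF BB] by simp
  qed
qed

definition orth :: "('a \<Rightarrow> complex) \<Rightarrow> 'a \<Rightarrow> nat \<Rightarrow> bool" where
  "orth \<tau> s N \<longleftrightarrow> (\<forall>\<mu>. set \<mu> \<subseteq> \<E> \<longrightarrow> \<mu> \<noteq> [] \<longrightarrow> length \<mu> \<le> N \<longrightarrow> \<tau> (star A s \<otimes> lm \<mu> s) = 0)"

text \<open>At a nonsingular vertex the fourth Cuntz-Krieger relation expresses the vertex
  projection through edges of \<open>E\<close>. At a singular one something remains outside the
  ranges of \<open>E\<close>: the vertex is a sink or emits an edge not in \<open>E\<close>.\<close>

definition singular :: "'e set \<Rightarrow> 'v \<Rightarrow> bool" where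
  "singular E v \<longleftrightarrow> \<not> (out_edges G {v} \<noteq> {} \<and> out_edges G {v} \<subseteq> E)"

lemma lincomb_base:
  assumes b: "base v s" and BB: "finite BB" "BB \<subseteq> \<V>"
  shows "finsum A (\<lambda>B. c B \<odot> P B) BB \<otimes> s = (\<Sum>B\<in>{B\<in>BB. v \<in> B}. c B) \<odot> s"
proof -
  have s: "s \<in> \<A>" using b by (simp add: base_def)
  have "finsum A (\<lambda>B. c B \<odot> P B) BB \<otimes> s = finsum A (\<lambda>B. (c B \<odot> P B) \<otimes> s) BB"
    using s BB by (intro finsum_mult) auto
  also have "\<dots> = finsum A (\<lambda>B. (if v \<in> B then c B else 0) \<odot> s) BB"
    using s BB b by (intro finsum_cong') (auto simp: scale_mult_left base_def subset_iff)
  also have "\<dots> = (\<Sum>B\<in>{B\<in>BB. v \<in> B}. c B) \<odot> s"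
    using s BB by (simp add: finsum_scale_left sum.inter_filter)
  finally show ?thesis .
qed

section \<open>Finitely many edges, sets and lengths per element\<close>

definition bounded_monomials :: "'e set \<Rightarrow> 'v set set \<Rightarrow> nat \<Rightarrow> int \<Rightarrow> 'a set" where
  "bounded_monomials E BB N d = {c \<odot> mon \<alpha> B \<beta> | c \<alpha> B \<beta>. set \<alpha> \<subseteq> E \<and> set \<beta> \<subseteq> E \<and> B \<in> BB \<and>
     length \<alpha> \<le> N \<and> length \<beta> \<le> N \<and> int (length \<alpha>) - int (length \<beta>) = d}"

lemma bounded_monomials_mono:
  "\<lbrakk>E \<subseteq> E'; BB \<subseteq> BB'; N \<le> N'\<rbrakk> \<Longrightarrow> bounded_monomials E BB N d \<subseteq> bounded_monomials E' BB' N' d"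
proof
  fix x assume le: "E \<subseteq> E'" "BB \<subseteq> BB'" "N \<le> N'" and "x \<in> bounded_monomials E BB N d"
  then obtain c \<alpha> B \<beta> where "x = c \<odot> mon \<alpha> B \<beta>" "set \<alpha> \<subseteq> E" "set \<beta> \<subseteq> E" "B \<in> BB"
    "length \<alpha> \<le> N" "length \<beta> \<le> N" "int (length \<alpha>) - int (length \<beta>) = d"
    unfolding bounded_monomials_def by blast
  thus "x \<in> bounded_monomials E' BB' N' d"
    unfolding bounded_monomials_def using le
    by (intro CollectI exI[of _ c] exI[of _ \<alpha>] exI[of _ B] exI[of _ \<beta>]) auto
qed

lemma addspan_monomials_bounded:
  assumes "x \<in> addspan (\<Union>d\<in>D. monomials d)"
  obtains E BB N where "finite E" "E \<subseteq> \<E>" "finite BB" "BB \<subseteq> \<V>"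
    "x \<in> addspan (\<Union>d\<in>D. bounded_monomials E BB N d)"
proof -
  have "\<exists>E BB N. finite E \<and> E \<subseteq> \<E> \<and> finite BB \<and> BB \<subseteq> \<V> \<and>
    x \<in> addspan (\<Union>d\<in>D. bounded_monomials E BB N d)"
    using assms
  proof (induction rule: addspan.induct)
    case zero
    thus ?case by (intro exI[of _ "{}"] exI[of _ 0]) (auto intro: addspan.zero)
  next
    case (add x y)
    from add.IH obtain E BB N where *: "finite E" "E \<subseteq> \<E>" "finite BB" "BB \<subseteq> \<V>"
      "y \<in> addspan (\<Union>d\<in>D. bounded_monomials E BB N d)" by blast
    from add.hyps(1) obtain d where d: "d \<in> D" "x \<in> monomials d" by blast
    then obtain c \<alpha> B \<beta> where x: "x = c \<odot> mon \<alpha> B \<beta>" "set \<alpha> \<subseteq> \<E>" "B \<in> \<V>"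
      "set \<beta> \<subseteq> \<E>" "int (length \<alpha>) - int (length \<beta>) = d" by (auto simp: monomials_def)
    define E' where "E' = E \<union> set \<alpha> \<union> set \<beta>"
    define BB' where "BB' = insert B BB"
    define N' where "N' = N + length \<alpha> + length \<beta>"
    have y': "y \<in> addspan (\<Union>d\<in>D. bounded_monomials E' BB' N' d)"
      by (rule addspan_mono[OF *(5)], intro UN_mono order_refl bounded_monomials_mono)
        (auto simp: E'_def BB'_def N'_def)
    have x': "x \<in> bounded_monomials E' BB' N' d"
      unfolding bounded_monomials_def using x
      by (intro CollectI exI[of _ c] exI[of _ \<alpha>] exI[of _ B] exI[of _ \<beta>])
        (auto simp: E'_def BB'_def N'_def)
    have "x \<oplus> y \<in> addspan (\<Union>d\<in>D. bounded_monomials E' BB' N' d)"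
      by (rule addspan.add[OF _ y']) (rule UN_I[OF d(1)], rule x')
    moreover have "finite E'" "E' \<subseteq> \<E>" "finite BB'" "BB' \<subseteq> \<V>"
      using *(1-4) x(2-4) by (simp_all add: E'_def BB'_def)
    ultimately show ?case
      by (intro exI[of _ E'] exI[of _ BB'] exI[of _ N'] conjI)
  qed
  thus ?thesis using that by blast
qed

end

section \<open>Finite stages of the core\<close>

text \<open>Products of monomials over \<open>E0\<close> and \<open>BB\<close> produce intersections
  of sets and, from \<open>star A (S e) \<otimes> S e\<close>, ranges of edges. The closure
  conditions on \<open>BB\<close> keep both inside the stage.\<close>

locale finite_stage = ck_algebra A G S P
  for A :: "'a cstar" (structure) and G :: "('v, 'e) ultragraph" and S P +
  fixes E0 :: "'e set" and BB :: "'v set set"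
  assumes finite_E0: "finite E0" and E0: "E0 \<subseteq> \<E>"
    and finite_BB: "finite BB" and BB: "BB \<subseteq> \<V>"
    and BB_inter: "\<lbrakk>B \<in> BB; C \<in> BB\<rbrakk> \<Longrightarrow> B \<inter> C \<in> BB"
    and BB_rng: "e \<in> E0 \<Longrightarrow> rng G e \<in> BB"
begin

lemma E0D [simp]: "e \<in> E0 \<Longrightarrow> e \<in> \<E>" using E0 by auto
lemma BBD [simp]: "B \<in> BB \<Longrightarrow> B \<in> \<V>" using BB by auto

section \<open>The finite-dimensional degree-zero spaces \<open>F K\<close>\<close>

definition diag :: "'a set" where "diag = {c \<odot> P B | c B. B \<in> BB}"

definition conj_set :: "'a set \<Rightarrow> 'a set" where
  "conj_set X = {S e \<otimes> (x \<otimes> star A (S f)) | e f x. e \<in> E0 \<and> f \<in> E0 \<and> x \<in> X}"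

text \<open>The span of all \<open>S\<^sub>\<alpha> P\<^sub>B S\<^sub>\<beta>\<^sup>*\<close> over
  \<open>E0\<close> and \<open>BB\<close> with words of equal length at most \<open>K\<close>.
  Building it from the outermost letters inwards lets products and compressions be handled by
  induction on \<open>K\<close>.\<close>

primrec F :: "nat \<Rightarrow> 'a set" where
  "F 0 = addspan diag"
| "F (Suc K) = addspan (diag \<union> conj_set (F K))"

lemma diag_closed: "diag \<subseteq> \<A>" by (auto simp: diag_def)

lemma conj_set_closed: "X \<subseteq> \<A> \<Longrightarrow> conj_set X \<subseteq> \<A>"
  by (auto simp: conj_set_def subset_iff)

lemma F_closed: "F K \<subseteq> \<A>"
proof (induction K)
  case (Suc K)
  thus ?case using diag_closed conj_set_closed[OF Suc] by (auto dest: addspan_closed)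
qed (use diag_closed in \<open>auto dest: addspan_closed\<close>)

lemma F_closed' [simp]: "x \<in> F K \<Longrightarrow> x \<in> \<A>" using F_closed by auto

lemma F_gen_closed: "diag \<union> conj_set (F K) \<subseteq> \<A>"
  using diag_closed conj_set_closed[OF F_closed] by auto

lemma F_diag: "x \<in> diag \<Longrightarrow> x \<in> F K"
  by (cases K) (auto intro: addspan_base[OF _ diag_closed] addspan_base[OF _ F_gen_closed])

lemma F_P: "B \<in> BB \<Longrightarrow> c \<odot> P B \<in> F K"
  by (rule F_diag) (auto simp: diag_def)

lemma F_conj: "\<lbrakk>x \<in> F K; e \<in> E0; f \<in> E0\<rbrakk> \<Longrightarrow> S e \<otimes> (x \<otimes> star A (S f)) \<in> F (Suc K)"
  unfolding F.simps by (rule addspan_base[OF _ F_gen_closed]) (auto simp: conj_set_def)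

lemma F_add: "x \<in> F K \<Longrightarrow> y \<in> F K \<Longrightarrow> x \<oplus> y \<in> F K"
  by (cases K) (auto intro: addspan_add[OF _ _ diag_closed] addspan_add[OF _ _ F_gen_closed])

lemma F_zero [simp]: "\<zero> \<in> F K"
  by (cases K) (auto intro: addspan.zero)

lemma F_induct [consumes 1, case_names zero add diag conj]:
  assumes "x \<in> F K" "Q \<zero>" "\<And>x y. \<lbrakk>x \<in> F K; y \<in> F K; Q x; Q y\<rbrakk> \<Longrightarrow> Q (x \<oplus> y)"
    and "\<And>c B. B \<in> BB \<Longrightarrow> Q (c \<odot> P B)"
    and "\<And>K' e f x. \<lbrakk>K = Suc K'; e \<in> E0; f \<in> E0; x \<in> F K'\<rbrakk> \<Longrightarrow> Q (S e \<otimes> (x \<otimes> star A (S f)))"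
  shows "Q x"
proof (cases K)
  case 0
  have "x \<in> addspan diag" using assms(1) 0 by simp
  thus ?thesis
  proof (induction rule: addspan.induct)
    case (add x y)
    have "Q x" using add assms(4) by (auto simp: diag_def)
    moreover have "x \<in> F K" "y \<in> F K" using add 0 by (auto intro: addspan_base[OF _ diag_closed])
    ultimately show ?case using add assms(3) by blast
  qed (rule assms(2))
next
  case (Suc K')
  have "x \<in> addspan (diag \<union> conj_set (F K'))" using assms(1) Suc by simp
  thus ?thesis
  proof (induction rule: addspan.induct)
    case (add x y)
    have "Q x" using add(1) assms(4) assms(5)[OF Suc] unfolding diag_def conj_set_def by blast
    moreover have "x \<in> F K" "y \<in> F K" using add Suc by (auto intro: addspan_base[OF _ F_gen_closed])
    ultimately show ?case using add assms(3) by blast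
  qed (rule assms(2))
qed

lemma F_scale: "x \<in> F K \<Longrightarrow> c \<odot> x \<in> F K"
proof (induction K arbitrary: x)
  case 0
  thus ?case
  proof (induction rule: F_induct)
    case (diag c' B) thus ?case by (simp add: scale_scale F_P del: F.simps)
  qed (auto simp: scale_add_right F_add simp del: F.simps)
next
  case (Suc K)
  from Suc.prems show ?case
  proof (induction rule: F_induct)
    case (diag c' B) thus ?case by (simp add: scale_scale F_P del: F.simps)
  next
    case (conj K' e f x)
    hence "c \<odot> (S e \<otimes> (x \<otimes> star A (S f))) = S e \<otimes> ((c \<odot> x) \<otimes> star A (S f))"
      by (simp add: scale_mult_left scale_mult_right)
    thus ?case using conj Suc.IH by (auto intro: F_conj simp del: F.simps)
  qed (auto simp: scale_add_right F_add simp del: F.simps)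
qed

lemma F_P_mult: "x \<in> F K \<Longrightarrow> B \<in> BB \<Longrightarrow> P B \<otimes> x \<in> F K"
proof (induction rule: F_induct)
  case (conj K' e f x)
  thus ?case by (auto intro: F_conj simp del: F.simps)
qed (auto simp: distrib_left F_add scale_mult_right BB_inter intro!: F_P simp del: F.simps)

lemma F_star: "x \<in> F K \<Longrightarrow> star A x \<in> F K"
proof (induction K arbitrary: x)
  case 0
  thus ?case
    by (induction rule: F_induct) (auto simp: star_add star_scale F_add F_P simp del: F.simps)
next
  case (Suc K)
  from Suc.prems show ?case
  proof (induction rule: F_induct)
    case (conj K' e f x)
    hence "star A (S e \<otimes> (x \<otimes> star A (S f))) = S f \<otimes> (star A x \<otimes> star A (S e))"
      by (simp add: star_mult mult_assoc)
    thus ?case using conj Suc.IH by (auto intro: F_conj simp del: F.simps)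
  qed (auto simp: star_add star_scale F_add F_P simp del: F.simps)
qed

lemma F_mult_P: "x \<in> F K \<Longrightarrow> B \<in> BB \<Longrightarrow> x \<otimes> P B \<in> F K"
  using F_star[OF F_P_mult[OF F_star]] by (simp add: star_mult)

lemma F_mult: "x \<in> F K \<Longrightarrow> y \<in> F K \<Longrightarrow> x \<otimes> y \<in> F K"
proof (induction K arbitrary: x y)
  case 0
  from 0(1) show ?case
    by (induction rule: F_induct)
      (use 0(2) in \<open>auto simp: distrib_right F_add scale_mult_left F_scale F_P_mult simp del: F.simps\<close>)
next
  case (Suc K)
  from Suc.prems(1) show ?case
  proof (induction rule: F_induct)
    case (conj K' e f x)
    hence x: "x \<in> F K" "e \<in> E0" "f \<in> E0" by auto
    from Suc.prems(2) show ?case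
    proof (induction rule: F_induct)
      case (add y z)
      thus ?case using x by (simp add: distrib_left F_add del: F.simps)
    next
      case (diag c B)
      have "S e \<otimes> (x \<otimes> star A (S f)) \<otimes> P B = S e \<otimes> (x \<otimes> star A (P B \<otimes> S f))"
        using x diag by (simp add: star_mult mult_assoc del: P_S)
      hence "S e \<otimes> (x \<otimes> star A (S f)) \<otimes> P B \<in> F (Suc K)"
        using x diag by (simp add: F_conj del: F.simps)
      thus ?case using x diag by (simp add: scale_mult_right F_scale del: F.simps)
    next
      case (conj K' e' f' y)
      hence y: "y \<in> F K" "e' \<in> E0" "f' \<in> E0" by auto
      show ?case
      proof (cases "f = e'")
        case True
        have "S e \<otimes> (x \<otimes> star A (S f)) \<otimes> (S e' \<otimes> (y \<otimes> star A (S f'))) =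
            S e \<otimes> ((x \<otimes> (P (rng G f) \<otimes> y)) \<otimes> star A (S f'))"
          using x y True by (simp add: mult_assoc)
        moreover have "x \<otimes> (P (rng G f) \<otimes> y) \<in> F K"
          using x y by (intro Suc.IH F_P_mult BB_rng)
        ultimately show ?thesis using x y F_conj by metis
      qed (use x y in \<open>simp add: mult_assoc del: F.simps\<close>)
    qed (use x in \<open>simp del: F.simps\<close>)
  qed (use Suc.prems(2) in \<open>auto simp: distrib_right F_add scale_mult_left F_scale F_P_mult simp del: F.simps\<close>)
qed

lemma F_mon:
  assumes "set \<alpha> \<subseteq> E0" "set \<beta> \<subseteq> E0" "B \<in> BB" "length \<alpha> = length \<beta>" "length \<alpha> \<le> K"
  shows "mon \<alpha> B \<beta> \<in> F K"
  using assms
proof (induction \<alpha> arbitrary: \<beta> K)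
  case Nil
  thus ?case using F_P[of B 1 K] by (simp add: mon_def)
next
  case (Cons e \<alpha>)
  then obtain f \<beta>' K' where *: "\<beta> = f # \<beta>'" "K = Suc K'" by (cases \<beta>; cases K) auto
  have cl: "set \<alpha> \<subseteq> \<E>" "set \<beta>' \<subseteq> \<E>" "f \<in> \<E>" "B \<in> \<V>"
    using Cons.prems * E0 by auto
  have "mon (e # \<alpha>) B \<beta> = S e \<otimes> (mon \<alpha> B \<beta>' \<otimes> star A (S f))"
    using cl * by (simp add: mon_def lm_mult star_mult)
  moreover have "mon \<alpha> B \<beta>' \<in> F K'" using Cons * by auto
  ultimately show ?case using Cons.prems * by (auto intro: F_conj simp del: F.simps)
qed

text \<open>This lowers the level. A diagonal term contributes only when \<open>e = f\<close>, and
  then a multiple of \<open>P (rng G e)\<close> or zero; a conjugated term returns its middle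
  factor, cut down by range projections, or zero.\<close>

lemma F_compress:
  assumes "x \<in> F (Suc K)" "e \<in> E0" "f \<in> E0"
  shows "star A (S e) \<otimes> (x \<otimes> S f) \<in> F K"
  using assms(1)
proof (induction rule: F_induct)
  case (add x y)
  thus ?case using assms by (simp add: distrib_left distrib_right F_add del: F.simps)
next
  case (diag c B)
  have "star A (S e) \<otimes> S f \<in> F K" using F_P[OF BB_rng, of e 1 K] assms(2,3)
    by (cases "e = f") (auto simp del: F.simps)
  thus ?case using assms diag by (auto simp: scale_mult_left scale_mult_right F_scale simp del: F.simps)
next
  case (conj K' e' f' x)
  hence x: "x \<in> F K" "e' \<in> E0" "f' \<in> E0" by auto
  show ?case
  proof (cases "e = e' \<and> f = f'")
    case True
    have "star A (S e) \<otimes> (S e' \<otimes> (x \<otimes> star A (S f')) \<otimes> S f) = P (rng G e) \<otimes> (x \<otimes> P (rng G f))"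
      using x assms True by (simp add: mult_assoc)
    thus ?thesis using x assms by (auto intro: F_P_mult F_mult_P BB_rng simp del: F.simps)
  qed (use x assms in \<open>auto simp: mult_assoc simp del: F.simps\<close>)
qed (use assms in \<open>simp del: F.simps\<close>)

section \<open>The projection onto the ranges of the chosen edges\<close>

definition pE :: 'a where "pE = finsum A (\<lambda>e. S e \<otimes> star A (S e)) E0"

lemma pE_closed [simp]: "pE \<in> \<A>"
  unfolding pE_def by (intro finsum_closed) auto

lemma pE_star [simp]: "star A pE = pE"
  unfolding pE_def by (subst star_finsum) (auto simp: star_mult intro!: finsum_cong')

lemma finsum_single:
  "\<lbrakk>i \<in> I; finite I; x \<in> \<A>\<rbrakk> \<Longrightarrow> finsum A (\<lambda>j. if i = j then x else \<zero>) I = x"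
  using finsum_singleton[of i I "\<lambda>_. x"] by simp

lemma pE_S [simp]: "e \<in> E0 \<Longrightarrow> pE \<otimes> S e = S e"
proof -
  assume e: "e \<in> E0"
  have "pE \<otimes> S e = finsum A (\<lambda>f. (S f \<otimes> star A (S f)) \<otimes> S e) E0"
    unfolding pE_def using e by (intro finsum_mult) auto
  also have "\<dots> = finsum A (\<lambda>f. if e = f then S e else \<zero>) E0"
    using e by (intro finsum_cong') (auto simp: mult_assoc)
  also have "\<dots> = S e" using e finite_E0 by (intro finsum_single) auto
  finally show ?thesis .
qed

lemma star_S_pE [simp]: "e \<in> E0 \<Longrightarrow> star A (S e) \<otimes> pE = star A (S e)"
  using star_mult[of pE "S e"] by simp

lemma P_SS:
  assumes "e \<in> \<E>" "B \<in> \<V>"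
  shows "(S e \<otimes> star A (S e)) \<otimes> P B = (if src G e \<in> B then S e \<otimes> star A (S e) else \<zero>)"
proof -
  have "(S e \<otimes> star A (S e)) \<otimes> P B = S e \<otimes> star A (P B \<otimes> S e)"
    using assms by (simp add: mult_assoc star_mult del: P_S)
  thus ?thesis using assms by simp
qed

lemma P_pE:
  assumes "B \<in> \<V>"
  shows "P B \<otimes> pE = finsum A (\<lambda>e. if src G e \<in> B then S e \<otimes> star A (S e) else \<zero>) E0"
    and "pE \<otimes> P B = P B \<otimes> pE"
proof -
  have "P B \<otimes> pE = finsum A (\<lambda>e. P B \<otimes> (S e \<otimes> star A (S e))) E0"
    unfolding pE_def using assms by (intro mult_finsum) auto
  also have "\<dots> = finsum A (\<lambda>e. if src G e \<in> B then S e \<otimes> star A (S e) else \<zero>) E0"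
    using assms by (intro finsum_cong') auto
  finally show 1: "P B \<otimes> pE = finsum A (\<lambda>e. if src G e \<in> B then S e \<otimes> star A (S e) else \<zero>) E0" .
  have "pE \<otimes> P B = finsum A (\<lambda>e. (S e \<otimes> star A (S e)) \<otimes> P B) E0"
    unfolding pE_def using assms by (intro finsum_mult) auto
  also have "\<dots> = P B \<otimes> pE"
    unfolding 1 using assms P_SS by (intro finsum_cong') auto
  finally show "pE \<otimes> P B = P B \<otimes> pE" .
qed

lemma pE_pE [simp]: "pE \<otimes> pE = pE"
proof -
  have "pE \<otimes> pE = finsum A (\<lambda>e. pE \<otimes> (S e \<otimes> star A (S e))) E0"
    by (subst (2) pE_def, subst mult_finsum) auto
  also have "\<dots> = pE" unfolding pE_def[symmetric]
    by (subst (2) pE_def) (intro finsum_cong', auto simp flip: mult_assoc)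
  finally show ?thesis .
qed

text \<open>Right multiplication by 1 - \<open>pE\<close>, written without a unit.\<close>

definition Rm :: "'a \<Rightarrow> 'a" where "Rm y = y \<ominus> y \<otimes> pE"

lemma Rm_closed [simp]: "y \<in> \<A> \<Longrightarrow> Rm y \<in> \<A>" by (simp add: Rm_def)

lemma Rm_add: "x \<in> \<A> \<Longrightarrow> y \<in> \<A> \<Longrightarrow> Rm (x \<oplus> y) = Rm x \<oplus> Rm y"
  by (simp add: Rm_def distrib_right add_minus_add)

lemma Rm_scale: "x \<in> \<A> \<Longrightarrow> Rm (c \<odot> x) = c \<odot> Rm x"
  by (simp add: Rm_def scale_mult_left scale_minus)

definition lincomb :: "('v set \<Rightarrow> complex) \<Rightarrow> 'a" where
  "lincomb c = finsum A (\<lambda>B. c B \<odot> P B) BB"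

lemma lincomb_closed [simp]: "lincomb c \<in> \<A>"
  unfolding lincomb_def by (intro finsum_closed) auto

lemma lincomb_add: "lincomb c \<oplus> lincomb c' = lincomb (\<lambda>B. c B + c' B)"
proof -
  have "lincomb (\<lambda>B. c B + c' B) = finsum A (\<lambda>B. c B \<odot> P B \<oplus> c' B \<odot> P B) BB"
    unfolding lincomb_def by (intro finsum_cong') (auto simp: scale_add_left)
  also have "\<dots> = lincomb c \<oplus> lincomb c'"
    unfolding lincomb_def by (intro finsum_addf) auto
  finally show ?thesis by simp
qed

lemma lincomb_single: "B \<in> BB \<Longrightarrow> lincomb (\<lambda>C. if B = C then c else 0) = c \<odot> P B"
proof -
  assume B: "B \<in> BB"
  have "lincomb (\<lambda>C. if B = C then c else 0) = finsum A (\<lambda>C. if B = C then c \<odot> P B else \<zero>) BB"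
    unfolding lincomb_def using B by (intro finsum_cong') auto
  also have "\<dots> = c \<odot> P B" using B finite_BB by (intro finsum_single) auto
  finally show ?thesis .
qed

lemma lincomb_zero: "lincomb (\<lambda>C. 0) = \<zero>"
  unfolding lincomb_def by (subst finsum_zero[symmetric, of BB], intro finsum_cong') auto

lemma F_0_lincomb: "x \<in> F 0 \<Longrightarrow> \<exists>c. x = lincomb c"
proof (induction rule: F_induct)
  case zero show ?case using lincomb_zero by metis
next
  case (add x y) thus ?case using lincomb_add by metis
next
  case (diag c B) thus ?case using lincomb_single by metis
qed auto

text \<open>The projections \<open>P B\<close> commute with \<open>pE\<close>, and the conjugated
  terms live entirely under \<open>pE\<close>. So outside \<open>pE\<close> only a diagonal
  combination survives, while the corner under \<open>pE\<close> is determined by the compressions,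
  which lie in \<open>F K\<close>.\<close>

lemma F_Suc_decompose: "x \<in> F (Suc K) \<Longrightarrow> \<exists>c. x = Rm (lincomb c) \<oplus> pE \<otimes> (x \<otimes> pE)"
proof (induction rule: F_induct)
  case zero
  show ?case by (rule exI[of _ "\<lambda>_. 0"]) (simp add: lincomb_zero Rm_def)
next
  case (add x y)
  then obtain c c' where c: "x = Rm (lincomb c) \<oplus> pE \<otimes> (x \<otimes> pE)" "y = Rm (lincomb c') \<oplus> pE \<otimes> (y \<otimes> pE)"
    by blast
  have xy: "x \<in> \<A>" "y \<in> \<A>" using add by (auto simp del: F.simps)
  have "x \<oplus> y = (Rm (lincomb c) \<oplus> pE \<otimes> (x \<otimes> pE)) \<oplus> (Rm (lincomb c') \<oplus> pE \<otimes> (y \<otimes> pE))"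
    using c by simp
  also have "\<dots> = Rm (lincomb (\<lambda>B. c B + c' B)) \<oplus> pE \<otimes> ((x \<oplus> y) \<otimes> pE)"
    using xy by (simp add: lincomb_add[symmetric] Rm_add distrib_left distrib_right a_ac)
  finally show ?case by blast
next
  case (diag c B)
  have "pE \<otimes> ((c \<odot> P B) \<otimes> pE) = c \<odot> P B \<otimes> pE"
    using diag P_pE(2)[of B] by (simp add: scale_mult_left scale_mult_right mult_assoc flip: mult_assoc[of pE "P B" pE])
  hence "c \<odot> P B = Rm (lincomb (\<lambda>C. if B = C then c else 0)) \<oplus> pE \<otimes> ((c \<odot> P B) \<otimes> pE)"
    using diag by (simp add: lincomb_single Rm_def minus_eq a_assoc l_neg scale_mult_left)
  thus ?case by blast
next
  case (conj K' e f x)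
  have "pE \<otimes> ((S e \<otimes> (x \<otimes> star A (S f))) \<otimes> pE) = S e \<otimes> (x \<otimes> star A (S f))"
    using conj by (simp add: mult_assoc) (simp flip: mult_assoc)
  hence "S e \<otimes> (x \<otimes> star A (S f)) =
      Rm (lincomb (\<lambda>_. 0)) \<oplus> pE \<otimes> ((S e \<otimes> (x \<otimes> star A (S f))) \<otimes> pE)"
    using conj by (simp add: lincomb_zero Rm_def)
  thus ?case by blast
qed

text \<open>The corner is the sum over \<open>e\<close> and \<open>f\<close> of the compressions
  conjugated back by \<open>S e\<close> and \<open>S f\<close>, which have norm at most 1. The crude
  triangle inequality suffices, as constants are removed later.\<close>

lemma nrm_conj_pE_le:
  assumes "x \<in> \<A>" and le: "\<And>e f. \<lbrakk>e \<in> E0; f \<in> E0\<rbrakk> \<Longrightarrow> nrm A (star A (S e) \<otimes> (x \<otimes> S f)) \<le> t"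
    and "0 \<le> t"
  shows "nrm A (pE \<otimes> (x \<otimes> pE)) \<le> (real (card E0))\<^sup>2 * t"
proof -
  have [simp]: "x \<in> \<A>" by fact
  let ?q = "\<lambda>f. S f \<otimes> star A (S f)"
  have "x \<otimes> pE = finsum A (\<lambda>f. x \<otimes> ?q f) E0"
    unfolding pE_def by (intro mult_finsum) auto
  hence "pE \<otimes> (x \<otimes> pE) = finsum A (\<lambda>f. pE \<otimes> (x \<otimes> ?q f)) E0"
    by (simp add: mult_finsum)
  also have "nrm A \<dots> \<le> (\<Sum>f\<in>E0. nrm A (pE \<otimes> (x \<otimes> ?q f)))"
    by (intro nrm_finsum) auto
  also have "\<dots> \<le> (\<Sum>f\<in>E0. real (card E0) * t)"
  proof (intro sum_mono)
    fix f assume f: "f \<in> E0"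
    have "pE \<otimes> (x \<otimes> ?q f) =
        finsum A (\<lambda>e. ?q e \<otimes> (x \<otimes> ?q f)) E0"
      unfolding pE_def using f by (intro finsum_mult) auto
    also have "nrm A \<dots> \<le> (\<Sum>e\<in>E0. nrm A (?q e \<otimes> (x \<otimes> ?q f)))"
      using f by (intro nrm_finsum) auto
    also have "\<dots> \<le> (\<Sum>e\<in>E0. t)"
    proof (intro sum_mono)
      fix e assume e: "e \<in> E0"
      let ?y = "star A (S e) \<otimes> (x \<otimes> S f)"
      have y: "?y \<in> \<A>" using e f by simp
      have "?q e \<otimes> (x \<otimes> ?q f) = S e \<otimes> (?y \<otimes> star A (S f))"
        using e f by (simp add: mult_assoc)
      also have "nrm A \<dots> \<le> nrm A (S e) * nrm A (?y \<otimes> star A (S f))"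
        using e f by (intro nrm_mult) auto
      also have "\<dots> \<le> nrm A (S e) * (nrm A ?y * nrm A (star A (S f)))"
        using e f y by (intro mult_left_mono nrm_mult nrm_nonneg) auto
      also have "\<dots> \<le> 1 * (t * 1)"
        using e f y le[OF e f] nrm_S_le[of e] nrm_S_le[of f] \<open>0 \<le> t\<close>
        by (intro mult_mono mult_nonneg_nonneg) auto
      finally show "nrm A (?q e \<otimes> (x \<otimes> ?q f)) \<le> t" by simp
    qed
    finally show "nrm A (pE \<otimes> (x \<otimes> ?q f)) \<le> real (card E0) * t" by simp
  qed
  finally show ?thesis by (simp add: power2_eq_square)
qed

text \<open>Such an \<open>s\<close> lies under 1 - \<open>pE\<close>: it is invisible to words over
  \<open>E0\<close>.\<close>

definition kills :: "'a \<Rightarrow> bool" where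
  "kills s \<longleftrightarrow> (\<forall>f\<in>E0. star A (S f) \<otimes> s = \<zero>)"

text \<open>Applied to the vector \<open>w\<close> of a state, the span \<open>V s k\<close> becomes
  a finite-dimensional test space: the vectors of \<pi>(s) w moved along words of length
  \<open>k\<close>.\<close>

definition Vgen :: "'a \<Rightarrow> nat \<Rightarrow> 'a set" where
  "Vgen s k = {c \<odot> lm \<mu> s | c \<mu>. set \<mu> \<subseteq> E0 \<and> length \<mu> = k}"

abbreviation V :: "'a \<Rightarrow> nat \<Rightarrow> 'a set" where "V s k \<equiv> addspan (Vgen s k)"

lemma lm_closed' [simp]: "set \<mu> \<subseteq> E0 \<Longrightarrow> x \<in> \<A> \<Longrightarrow> lm \<mu> x \<in> \<A>"
  using E0 by (intro lm_closed) auto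

lemma Vgen_closed: "s \<in> \<A> \<Longrightarrow> Vgen s k \<subseteq> \<A>"
  by (auto simp: Vgen_def)

lemma Vgen_scale: "x \<in> Vgen s k \<Longrightarrow> s \<in> \<A> \<Longrightarrow> c \<odot> x \<in> Vgen s k"
proof -
  assume s: "s \<in> \<A>" and "x \<in> Vgen s k"
  then obtain c' \<mu> where "x = c' \<odot> lm \<mu> s" "set \<mu> \<subseteq> E0" "length \<mu> = k" by (auto simp: Vgen_def)
  moreover from this have "c \<odot> x = (c * c') \<odot> lm \<mu> s" using s by (simp add: scale_scale)
  ultimately show ?thesis unfolding Vgen_def by blast
qed

lemma V_closed: "z \<in> V s k \<Longrightarrow> s \<in> \<A> \<Longrightarrow> z \<in> \<A>"
  using addspan_closed Vgen_closed by blast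

lemma V_lm: "\<lbrakk>set \<mu> \<subseteq> E0; length \<mu> = k; s \<in> \<A>\<rbrakk> \<Longrightarrow> c \<odot> lm \<mu> s \<in> V s k"
  by (rule addspan_base[OF _ Vgen_closed]) (auto simp: Vgen_def)

lemma V_P_mult:
  assumes "base v s" "z \<in> V s k" "B \<in> \<V>"
  shows "P B \<otimes> z \<in> V s k"
proof -
  have s: "s \<in> \<A>" using assms(1) by (simp add: base_def)
  show ?thesis
  proof (rule addspan_mult_left[OF assms(2) Vgen_closed[OF s] Vgen_closed[OF s]])
    fix x assume "x \<in> Vgen s k"
    then obtain c \<mu> where x: "x = c \<odot> lm \<mu> s" "set \<mu> \<subseteq> E0" "length \<mu> = k" by (auto simp: Vgen_def)
    have "P B \<otimes> lm \<mu> s \<in> {\<zero>, lm \<mu> s}"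
      using x assms E0 by (cases \<mu>) (auto simp: base_def)
    thus "P B \<otimes> x \<in> V s k" using x s assms(3) V_lm[OF x(2,3) s, of c]
      by (auto simp: scale_mult_right addspan.zero)
  qed (use assms in auto)
qed

lemma V_S_mult:
  assumes "s \<in> \<A>" "z \<in> V s k" "e \<in> E0"
  shows "S e \<otimes> z \<in> V s (Suc k)"
proof (rule addspan_mult_left[OF assms(2) Vgen_closed[OF assms(1)] Vgen_closed[OF assms(1)]])
  fix x assume "x \<in> Vgen s k"
  then obtain c \<mu> where x: "x = c \<odot> lm \<mu> s" "set \<mu> \<subseteq> E0" "length \<mu> = k" by (auto simp: Vgen_def)
  hence "c \<odot> lm (e # \<mu>) s \<in> V s (Suc k)" using assms by (intro V_lm) auto
  thus "S e \<otimes> x \<in> V s (Suc k)" using x assms by (simp add: scale_mult_right)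
qed (use assms in auto)

lemma V_star_S_mult:
  assumes b: "base v s" and z: "z \<in> V s (Suc k)" and f: "f \<in> E0"
  shows "star A (S f) \<otimes> z \<in> V s k"
proof -
  have s: "s \<in> \<A>" using b by (simp add: base_def)
  show ?thesis
  proof (rule addspan_mult_left[OF z Vgen_closed[OF s] Vgen_closed[OF s]])
    fix x assume "x \<in> Vgen s (Suc k)"
    then obtain c \<mu> where x: "x = c \<odot> lm \<mu> s" "set \<mu> \<subseteq> E0" "length \<mu> = Suc k" by (auto simp: Vgen_def)
    then obtain e \<mu>' where \<mu>: "\<mu> = e # \<mu>'" by (cases \<mu>) auto
    have "star A (S f) \<otimes> x = (if f = e then P (rng G f) \<otimes> (c \<odot> lm \<mu>' s) else \<zero>)"
      using x \<mu> s f by (simp add: scale_mult_right)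
    moreover have "P (rng G f) \<otimes> (c \<odot> lm \<mu>' s) \<in> V s k"
      using x \<mu> s f by (intro V_P_mult[OF b] V_lm) auto
    ultimately show "star A (S f) \<otimes> x \<in> V s k" by (auto simp: addspan.zero split: if_splits)
  qed (use f in auto)
qed

lemma V_star_S_mult_0:
  assumes "kills s" and s: "s \<in> \<A>" and z: "z \<in> V s 0" and f: "f \<in> E0"
  shows "star A (S f) \<otimes> z = \<zero>"
  using z
proof (induction rule: addspan.induct)
  case (add x y)
  hence y: "y \<in> \<A>" using V_closed s by blast
  from add obtain c where "x = c \<odot> s" by (auto simp: Vgen_def)
  thus ?case using add y s f \<open>kills s\<close> by (simp add: distrib_left scale_mult_right kills_def)
qed (use f in simp)

text \<open>A term of \<open>F K\<close> removes at most \<open>K\<close> letters and puts as many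
  back. If \<open>K \<le> k\<close> there are enough letters to remove; otherwise removal reaches
  \<open>s\<close>, which is killed.\<close>

lemma F_V:
  assumes b: "base v s"
  shows "\<lbrakk>x \<in> F K; z \<in> V s k; K \<le> k \<or> kills s\<rbrakk> \<Longrightarrow> x \<otimes> z \<in> V s k"
proof (induction K arbitrary: x z k)
  have s: "s \<in> \<A>" using b by (simp add: base_def)
  have sc: "c \<odot> z \<in> V s k" if "z \<in> V s k" for c z k
    using that by (rule addspan_scale[OF _ Vgen_closed[OF s]]) (rule Vgen_scale[OF _ s])
  have ad: "y \<oplus> z \<in> V s k" if "y \<in> V s k" "z \<in> V s k" for y z k
    using that by (rule addspan_add[OF _ _ Vgen_closed[OF s]])
  {
    case 0
    have "z \<in> \<A>" using 0 V_closed s by blast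
    from 0(1) this 0(2) show ?case
      by (induction rule: F_induct)
        (auto simp: distrib_right scale_mult_left addspan.zero intro!: sc ad V_P_mult[OF b] simp del: F.simps)
  next
    case (Suc K)
    have z: "z \<in> \<A>" using Suc V_closed s by blast
    from Suc.prems(1) show ?case
    proof (induction rule: F_induct)
      case (add x y)
      thus ?case using z by (simp add: distrib_right ad del: F.simps)
    next
      case (diag c B)
      thus ?case using z Suc.prems by (simp add: scale_mult_left sc V_P_mult[OF b])
    next
      case (conj K' e f x)
      hence x: "x \<in> F K" "e \<in> E0" "f \<in> E0" by auto
      have eq: "(S e \<otimes> (x \<otimes> star A (S f))) \<otimes> z = S e \<otimes> (x \<otimes> (star A (S f) \<otimes> z))"
        using x z by (simp add: mult_assoc)
      show ?case
      proof (cases k)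
        case 0
        hence "star A (S f) \<otimes> z = \<zero>" using Suc.prems x s by (intro V_star_S_mult_0) auto
        thus ?thesis unfolding eq using x by (simp add: addspan.zero)
      next
        case (Suc k')
        hence "star A (S f) \<otimes> z \<in> V s k'" using Suc.prems x by (intro V_star_S_mult[OF b]) auto
        moreover have "K \<le> k' \<or> kills s" using Suc.prems Suc by auto
        ultimately have "x \<otimes> (star A (S f) \<otimes> z) \<in> V s k'" by (rule Suc.IH[OF x(1)])
        thus ?thesis unfolding eq Suc using x s by (intro V_S_mult)
      qed
    qed (use z in \<open>auto simp: addspan.zero\<close>)
  }
qed

text \<open>Cancelling the shorter word against the longer one leaves zero or
  \<open>star A s\<close> times a nonempty word of length at most \<open>N\<close> applied to
  \<open>s\<close>. Either hypothesis on \<open>s\<close> makes this vanish under \<tau>.\<close>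

lemma V_orthogonal_less:
  assumes \<tau>: "pos_fun \<tau>" and s: "s \<in> \<A>" and "orth \<tau> s N \<or> kills s"
    and "i < j" "j \<le> N" "y \<in> V s i" "z \<in> V s j"
  shows "\<tau> (star A y \<otimes> z) = 0"
proof (rule addspan_orthogonal[OF \<tau> Vgen_closed[OF s] Vgen_closed[OF s] _ assms(6,7)])
  fix x y assume "x \<in> Vgen s i" "y \<in> Vgen s j"
  then obtain c \<delta> c' \<eta> where x: "x = c \<odot> lm \<delta> s" "set \<delta> \<subseteq> E0" "length \<delta> = i"
    and y: "y = c' \<odot> lm \<eta> s" "set \<eta> \<subseteq> E0" "length \<eta> = j" by (auto simp: Vgen_def)
  have sub: "set \<delta> \<subseteq> \<E>" "set \<eta> \<subseteq> \<E>" using x y E0 by auto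
  let ?\<eta> = "drop i \<eta>"
  have \<eta>: "set ?\<eta> \<subseteq> E0" "?\<eta> \<noteq> []" "length ?\<eta> \<le> N"
    using y assms(4,5) set_drop_subset[of i \<eta>] by auto
  have "\<tau> (star A s \<otimes> lm ?\<eta> s) = 0"
  proof (cases "kills s")
    case True
    obtain e \<eta>' where e: "?\<eta> = e # \<eta>'" using \<eta>(2) by (cases ?\<eta>) auto
    have mem: "e \<in> E0" "lm \<eta>' s \<in> \<A>" using \<eta> s unfolding e by auto
    have "star A s \<otimes> S e = star A (star A (S e) \<otimes> s)" using mem s by (simp add: star_mult)
    also have "\<dots> = \<zero>" using mem True by (simp add: kills_def)
    finally have "star A s \<otimes> lm ?\<eta> s = \<zero>" unfolding e using mem s by (simp flip: mult_assoc)
    thus ?thesis using \<tau> by (simp add: pos_fun_zero)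
  next
    case False
    thus ?thesis using assms(3) \<eta> E0 by (auto simp: orth_def)
  qed
  with star_lm_mult_lm[OF sub s s] x(3) y(3) \<open>i < j\<close>
  have "\<tau> (star A (lm \<delta> s) \<otimes> lm \<eta> s) = 0" using \<tau> by (auto simp: pos_fun_zero)
  thus "\<tau> (star A x \<otimes> y) = 0"
    using x y s by (simp add: star_scale scale_mult_left scale_mult_right pos_fun_scale[OF \<tau>])
qed

lemma V_orthogonal:
  assumes \<tau>: "pos_fun \<tau>" and s: "s \<in> \<A>" and "orth \<tau> s N \<or> kills s"
    and "i \<noteq> j" "i \<le> N" "j \<le> N" "y \<in> V s i" "z \<in> V s j"
  shows "\<tau> (star A y \<otimes> z) = 0"
proof (cases "i < j")
  case True
  thus ?thesis using assms by (intro V_orthogonal_less[of \<tau> s N i j])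
next
  case False
  hence "\<tau> (star A z \<otimes> y) = 0" using assms by (intro V_orthogonal_less[of \<tau> s N j i]) auto
  moreover have "star A (star A z \<otimes> y) = star A y \<otimes> z"
    using assms V_closed by (simp add: star_mult)
  ultimately show ?thesis
    using pos_fun_star[OF \<tau>, of "star A z \<otimes> y"] assms V_closed[OF _ s] by auto
qed

lemma V_lms:
  assumes b: "base v s"
  shows "\<lbrakk>z \<in> V s k; set \<alpha> \<subseteq> E0; length \<alpha> \<le> k\<rbrakk> \<Longrightarrow> lms \<alpha> z \<in> V s (k - length \<alpha>)"
proof (induction \<alpha> arbitrary: z k)
  case (Cons f \<alpha>)
  then obtain k' where k: "k = Suc k'" by (cases k) auto
  with Cons have "star A (S f) \<otimes> z \<in> V s k'" by (intro V_star_S_mult[OF b]) auto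
  from Cons.IH[OF this] Cons.prems k show ?case by simp
qed auto

lemma V_lms_kills:
  assumes b: "base v s" and "kills s"
  shows "\<lbrakk>z \<in> V s k; set \<alpha> \<subseteq> E0; length \<alpha> > k\<rbrakk> \<Longrightarrow> lms \<alpha> z = \<zero>"
proof (induction \<alpha> arbitrary: z k)
  case (Cons f \<alpha>)
  have s: "s \<in> \<A>" using b by (simp add: base_def)
  show ?case
  proof (cases k)
    case 0
    hence "star A (S f) \<otimes> z = \<zero>" using Cons.prems s assms by (intro V_star_S_mult_0) auto
    thus ?thesis using Cons.prems E0 lms_zero[of \<alpha>] by auto
  next
    case (Suc k')
    with Cons have "star A (S f) \<otimes> z \<in> V s k'" by (intro V_star_S_mult[OF b]) auto
    from Cons.IH[OF this] Cons.prems Suc show ?thesis by simp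
  qed
qed auto

definition offdiag :: "nat \<Rightarrow> 'a set" where
  "offdiag N = {c \<odot> mon \<alpha> B \<beta> | c \<alpha> B \<beta>. set \<alpha> \<subseteq> E0 \<and> set \<beta> \<subseteq> E0 \<and> B \<in> \<V> \<and>
     length \<alpha> \<le> N \<and> length \<beta> \<le> N \<and> length \<alpha> \<noteq> length \<beta>}"

lemma offdiag_closed: "offdiag N \<subseteq> \<A>"
  using E0 by (fastforce simp: offdiag_def)

text \<open>Moving the left word across gives an inner product of vectors at the levels
  \<open>k - length \<alpha>\<close> and \<open>k - length \<beta>\<close>, which differ. If a word
  is longer than \<open>k\<close>, then \<open>k < N\<close> and \<open>s\<close> is killed, so that
  the corresponding factor is zero.\<close>

lemma offdiag_vanishes:
  assumes \<tau>: "pos_fun \<tau>" and b: "base v s" and ok: "(k = N \<and> orth \<tau> s N) \<or> (k < N \<and> kills s)"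
    and o: "o' \<in> addspan (offdiag N)" and y: "y \<in> V s k" and z: "z \<in> V s k"
  shows "\<tau> (star A y \<otimes> (o' \<otimes> z)) = 0"
proof -
  have s: "s \<in> \<A>" using b by (simp add: base_def)
  have yz: "y \<in> \<A>" "z \<in> \<A>" using y z V_closed s by auto
  show ?thesis using o
  proof (induction rule: addspan.induct)
    case zero
    thus ?case using yz \<tau> by (simp add: pos_fun_zero)
  next
    case (add x x')
    have x': "x' \<in> \<A>" using add offdiag_closed by (auto dest: addspan_closed)
    from add obtain c \<alpha> B \<beta> where x: "x = c \<odot> mon \<alpha> B \<beta>" "set \<alpha> \<subseteq> E0" "set \<beta> \<subseteq> E0" "B \<in> \<V>"
      "length \<alpha> \<le> N" "length \<beta> \<le> N" "length \<alpha> \<noteq> length \<beta>" by (auto simp: offdiag_def)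
    have sub: "set \<alpha> \<subseteq> \<E>" "set \<beta> \<subseteq> \<E>" using x E0 by auto
    let ?w = "P B \<otimes> lms \<beta> z"
    have w: "?w \<in> \<A>" using x sub yz by simp
    have "star A y \<otimes> (mon \<alpha> B \<beta> \<otimes> z) = star A y \<otimes> lm \<alpha> ?w"
      using x sub yz by (simp add: mon_mult)
    also have "\<dots> = star A (star A (lm \<alpha> ?w) \<otimes> y)" using sub w yz by (simp add: star_mult)
    also have "\<dots> = star A (lms \<alpha> y) \<otimes> ?w" using sub w yz by (simp add: star_lm_mult star_mult)
    finally have eq: "star A y \<otimes> (mon \<alpha> B \<beta> \<otimes> z) = star A (lms \<alpha> y) \<otimes> ?w" .
    have "\<tau> (star A (lms \<alpha> y) \<otimes> ?w) = 0"
    proof (cases "length \<alpha> \<le> k \<and> length \<beta> \<le> k")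
      case True
      have "lms \<alpha> y \<in> V s (k - length \<alpha>)" using x y True by (intro V_lms[OF b]) auto
      moreover have "?w \<in> V s (k - length \<beta>)" using x z True by (intro V_P_mult[OF b] V_lms[OF b]) auto
      moreover have "k - length \<alpha> \<noteq> k - length \<beta>" "k - length \<alpha> \<le> N" "k - length \<beta> \<le> N"
        using True x ok by auto
      moreover have "orth \<tau> s N \<or> kills s" using ok by auto
      ultimately show ?thesis by (intro V_orthogonal[OF \<tau> s])
    next
      case False
      hence "kills s" using ok x by auto
      moreover have "length \<alpha> > k \<or> length \<beta> > k" using False by auto
      ultimately have "lms \<alpha> y = \<zero> \<or> lms \<beta> z = \<zero>"
        using V_lms_kills[OF b _ y] V_lms_kills[OF b _ z] x by auto
      thus ?thesis using w x sub yz \<tau> by (auto simp: pos_fun_zero)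
    qed
    hence "\<tau> (star A y \<otimes> (x \<otimes> z)) = 0"
      using x sub yz eq by (simp add: scale_mult_left scale_mult_right pos_fun_scale[OF \<tau>])
    moreover have "x \<in> \<A>" using x sub by simp
    ultimately show ?case
      using add x' yz by (simp add: distrib_left distrib_right pos_fun_add[OF \<tau>])
  qed
qed

text \<open>By the fourth Cuntz-Krieger relation the projection of such a vertex is a sum of range
  projections of edges in \<open>E0\<close>, so it lies under \<open>pE\<close>.\<close>

lemma Rm_P_regular:
  assumes w: "w \<in> verts G" "\<not> singular E0 w"
  shows "Rm (P {w}) = \<zero>"
proof -
  have out: "out_edges G {w} \<noteq> {}" "out_edges G {w} \<subseteq> E0" using w by (auto simp: singular_def)
  hence fin: "finite (out_edges G {w})" using finite_E0 by (auto intro: finite_subset)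
  have "P {w} = finsum A (\<lambda>e. S e \<otimes> star A (S e)) (out_edges G {w})"
    using w out fin by (intro P_regular)
  also have "\<dots> = finsum A (\<lambda>e. if src G e \<in> {w} then S e \<otimes> star A (S e) else \<zero>) E0"
    using finite_E0 out
    by (intro add.finprod_mono_neutral_cong_left[unfolded finsum_def[symmetric]])
      (auto simp: out_edges_def)
  also have "\<dots> = P {w} \<otimes> pE" using w P_pE(1)[of "{w}"] by simp
  finally show ?thesis using w by (simp add: Rm_def)
qed

lemma Rm_zero [simp]: "Rm \<zero> = \<zero>" by (simp add: Rm_def)

lemma Rm_minus: "x \<in> \<A> \<Longrightarrow> y \<in> \<A> \<Longrightarrow> Rm (x \<ominus> y) = Rm x \<ominus> Rm y"
  by (simp add: minus_scale Rm_add Rm_scale)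

text \<open>Every nonsingular vertex is the source of an edge in \<open>E0\<close>, so
  \<open>U - C\<close> is finite. Its vertices can be added to \<open>C\<close> one at a time, and
  none of them changes the value of \<open>Rm\<close>.\<close>

lemma Rm_difference:
  assumes U: "U \<in> \<V>" and C: "C \<in> \<V>" and "C \<subseteq> U"
    and reg: "\<And>v. v \<in> U - C \<Longrightarrow> \<not> singular E0 v"
  shows "Rm (P U \<ominus> P C) = \<zero>"
proof -
  have "U - C \<subseteq> src G ` E0"
  proof
    fix v assume "v \<in> U - C"
    from reg[OF this] obtain e where "e \<in> out_edges G {v}" "e \<in> E0" by (auto simp: singular_def)
    thus "v \<in> src G ` E0" by (auto simp: out_edges_def)
  qed
  hence fin: "finite (U - C)" using finite_E0 by (auto intro: finite_subset)
  have "C \<union> W \<in> \<V> \<and> Rm (P (C \<union> W)) = Rm (P C)" if "finite W" "W \<subseteq> U - C" for W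
    using that
  proof (induction W)
    case (insert w W)
    have w: "w \<in> verts G" "\<not> singular E0 w" using insert gen_verts_subset[OF U] reg by auto
    have gv: "C \<union> W \<in> \<V>" using insert by auto
    have "P (C \<union> insert w W) = P ((C \<union> W) \<union> {w})" by simp
    also have "\<dots> = P (C \<union> W) \<oplus> P {w}"
    proof -
      have "(C \<union> W) \<inter> {w} = {}" using insert by auto
      thus ?thesis using P_union[OF gv gen_verts.vertex[OF w(1)]] gv w by (simp add: minus_scale)
    qed
    finally have "Rm (P (C \<union> insert w W)) = Rm (P (C \<union> W))"
      using gv w by (simp add: Rm_add Rm_P_regular)
    moreover have "C \<union> insert w W \<in> \<V>"
      using gen_verts.union[OF gv gen_verts.vertex[OF w(1)]] by simp
    ultimately show ?case using insert by auto
  qed (use C in auto)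
  from this[OF fin] have "Rm (P U) = Rm (P C)" using \<open>C \<subseteq> U\<close> by (simp add: Un_absorb1)
  thus ?thesis using U C by (simp add: Rm_minus)
qed

text \<open>The spaces \<open>V s k\<close> with \<open>k < K\<close> see the summands at singular vertices below the top level of
  \<open>F K\<close>, those with \<open>k = K\<close> the top level.\<close>

definition block_bounded :: "('a \<Rightarrow> complex) set \<Rightarrow> nat \<Rightarrow> nat \<Rightarrow> 'a \<Rightarrow> real \<Rightarrow> bool" where
  "block_bounded \<Omega> N K x c \<longleftrightarrow>
     (\<forall>\<tau>\<in>\<Omega>. \<forall>v s k. base v s \<longrightarrow> (k < K \<and> kills s) \<or> (k = K \<and> orth \<tau> s N) \<longrightarrow>
        (\<forall>z\<in>V s k. sq \<tau> (x \<otimes> z) \<le> c\<^sup>2 * sq \<tau> z))"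

lemma block_boundedD:
  "\<lbrakk>block_bounded \<Omega> N K x c; \<tau> \<in> \<Omega>; base v s; (k < K \<and> kills s) \<or> (k = K \<and> orth \<tau> s N); z \<in> V s k\<rbrakk>
    \<Longrightarrow> sq \<tau> (x \<otimes> z) \<le> c\<^sup>2 * sq \<tau> z"
  by (auto simp: block_bounded_def)

section \<open>Norm estimate on a finite stage\<close>

lemma cmod_le_of_sq:
  assumes "pos_fun \<tau>" "s \<in> \<A>" "sq \<tau> s \<noteq> 0" "sq \<tau> (g \<odot> s) \<le> c\<^sup>2 * sq \<tau> s" "0 \<le> c"
  shows "cmod g \<le> c"
proof -
  have "sq \<tau> s > 0" using sq_nonneg[of \<tau> s] assms by simp
  hence "(cmod g)\<^sup>2 \<le> c\<^sup>2" using assms by (simp add: sq_scale)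
  thus ?thesis using assms(5) by (rule power2_le_imp_le)
qed

lemma V_0_base: "s \<in> \<A> \<Longrightarrow> s \<in> V s 0"
  using V_lm[of "[]" 0 s 1] by simp

text \<open>Induction on \<open>K\<close> along \<open>F_Suc_decompose\<close>. The diagonal part
  outside \<open>pE\<close> is tested at singular vertices on killed vectors, the compressions
  inherit the block bound at level \<open>K\<close>, and at level 0 the scalar at every vertex is
  tested with \<open>exB\<close>. The constant is chosen before \<open>x\<close> and
  \<open>c\<close>.\<close>

lemma norm_bound:
  assumes \<Omega>: "\<And>\<tau>. \<tau> \<in> \<Omega> \<Longrightarrow> pos_fun \<tau>"
    and exA: "\<And>v. \<lbrakk>v \<in> verts G; singular E0 v\<rbrakk> \<Longrightarrow> \<exists>\<tau>\<in>\<Omega>. \<exists>s. base v s \<and> kills s \<and> sq \<tau> s \<noteq> 0"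
    and exB: "\<And>v. v \<in> verts G \<Longrightarrow> \<exists>\<tau>\<in>\<Omega>. \<exists>s. base v s \<and> orth \<tau> s N \<and> sq \<tau> s \<noteq> 0"
  shows "\<exists>C\<ge>0. \<forall>x\<in>F K. \<forall>c\<ge>0. block_bounded \<Omega> N K x c \<longrightarrow> nrm A x \<le> C * c"
proof (induction K)
  case 0
  have "P U \<ominus> P C' = \<zero>"
    if "U \<in> \<V>" "C' \<in> \<V>" "C' \<subseteq> U" "(U - C') \<inter> verts G = {}" for U C'
  proof -
    have "U = C'" using gen_verts_subset[of U] that by blast
    thus ?thesis using that by simp
  qed
  hence "\<exists>C\<ge>0. \<forall>c t. 0 \<le> t \<longrightarrow> (\<forall>v\<in>verts G. cmod (\<Sum>B\<in>{B\<in>BB. v \<in> B}. c B) \<le> t) \<longrightarrow>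
      nrm A (finsum A (\<lambda>B. c B \<odot> P B) BB) \<le> C * t"
    by (intro diagonal_bound[of "\<lambda>x. x" "verts G" BB] finite_BB BB refl)
  then obtain C where C: "C \<ge> 0"
    "\<And>c t. \<lbrakk>0 \<le> t; \<forall>v\<in>verts G. cmod (\<Sum>B\<in>{B\<in>BB. v \<in> B}. c B) \<le> t\<rbrakk> \<Longrightarrow>
      nrm A (finsum A (\<lambda>B. c B \<odot> P B) BB) \<le> C * t" by blast
  show ?case
  proof (intro exI[of _ C] conjI ballI allI impI C(1))
    fix x c assume x: "x \<in> F 0" and c: "0 \<le> c" and bb: "block_bounded \<Omega> N 0 x c"
    from F_0_lincomb[OF x] obtain g where g: "x = lincomb g" by blast
    show "nrm A x \<le> C * c" unfolding g lincomb_def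
    proof (rule C(2)[OF c], rule ballI)
      fix v assume "v \<in> verts G"
      with exB obtain \<tau> s where *: "\<tau> \<in> \<Omega>" "base v s" "orth \<tau> s N" "sq \<tau> s \<noteq> 0" by blast
      hence s: "s \<in> \<A>" by (simp add: base_def)
      have "sq \<tau> (x \<otimes> s) \<le> c\<^sup>2 * sq \<tau> s"
        using block_boundedD[OF bb *(1,2), of 0 s] * V_0_base[OF s] by simp
      thus "cmod (\<Sum>B\<in>{B\<in>BB. v \<in> B}. g B) \<le> c"
        using * s c \<Omega> unfolding g lincomb_def lincomb_base[OF *(2) finite_BB BB]
        by (intro cmod_le_of_sq[of \<tau> s])
    qed
  qed
next
  case (Suc K)
  let ?T = "{v \<in> verts G. singular E0 v}"
  have "Rm (P U \<ominus> P C') = \<zero>"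
    if "U \<in> \<V>" "C' \<in> \<V>" "C' \<subseteq> U" "(U - C') \<inter> ?T = {}" for U C'
    using that gen_verts_subset[of U] by (intro Rm_difference) auto
  hence "\<exists>C\<ge>0. \<forall>c t. 0 \<le> t \<longrightarrow> (\<forall>v\<in>?T. cmod (\<Sum>B\<in>{B\<in>BB. v \<in> B}. c B) \<le> t) \<longrightarrow>
      nrm A (Rm (finsum A (\<lambda>B. c B \<odot> P B) BB)) \<le> C * t"
    by (intro diagonal_bound[of Rm ?T BB] finite_BB BB Rm_closed Rm_add Rm_scale)
  then obtain C1 where C1: "C1 \<ge> 0"
    "\<And>c t. \<lbrakk>0 \<le> t; \<forall>v\<in>?T. cmod (\<Sum>B\<in>{B\<in>BB. v \<in> B}. c B) \<le> t\<rbrakk> \<Longrightarrow>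
      nrm A (Rm (finsum A (\<lambda>B. c B \<odot> P B) BB)) \<le> C1 * t" by blast
  from Suc.IH obtain C2 where C2: "C2 \<ge> 0"
    "\<And>x c. \<lbrakk>x \<in> F K; 0 \<le> c; block_bounded \<Omega> N K x c\<rbrakk> \<Longrightarrow> nrm A x \<le> C2 * c" by blast
  show ?case
  proof (intro exI[of _ "C1 + (real (card E0))\<^sup>2 * C2"] conjI ballI allI impI)
    fix x c assume x: "x \<in> F (Suc K)" and c: "0 \<le> c" and bb: "block_bounded \<Omega> N (Suc K) x c"
    have xc [simp]: "x \<in> \<A>" using x by (rule F_closed')
    from F_Suc_decompose[OF x] obtain g where g: "x = Rm (lincomb g) \<oplus> pE \<otimes> (x \<otimes> pE)" by blast
    have 1: "nrm A (Rm (lincomb g)) \<le> C1 * c" unfolding lincomb_def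
    proof (rule C1(2)[OF c], rule ballI)
      fix v assume "v \<in> ?T"
      with exA obtain \<tau> s where *: "\<tau> \<in> \<Omega>" "base v s" "kills s" "sq \<tau> s \<noteq> 0" by blast
      hence s [simp]: "s \<in> \<A>" by (simp add: base_def)
      have "pE \<otimes> s = finsum A (\<lambda>e. (S e \<otimes> star A (S e)) \<otimes> s) E0"
        unfolding pE_def by (intro finsum_mult) auto
      also have "\<dots> = finsum A (\<lambda>e. \<zero>) E0"
        using *(3) by (intro finsum_cong') (auto simp: mult_assoc kills_def)
      finally have pEs: "pE \<otimes> s = \<zero>" by (simp add: finsum_zero)
      \<comment> \<open>Both occurrences of \<open>pE\<close> vanish on a killed \<open>s\<close>.
        What remains of \<open>x\<close> is its scalar at the vertex \<open>v\<close>.\<close>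
      have "x \<otimes> s = Rm (lincomb g) \<otimes> s \<oplus> (pE \<otimes> (x \<otimes> pE)) \<otimes> s"
        by (subst g) (simp add: distrib_right)
      also have "\<dots> = lincomb g \<otimes> s"
        by (simp add: mult_assoc pEs Rm_def mult_minus_left minus_zero_right)
      also have "\<dots> = (\<Sum>B\<in>{B\<in>BB. v \<in> B}. g B) \<odot> s"
        unfolding lincomb_def by (rule lincomb_base[OF *(2) finite_BB BB])
      finally have eq: "x \<otimes> s = (\<Sum>B\<in>{B\<in>BB. v \<in> B}. g B) \<odot> s" .
      have "sq \<tau> (x \<otimes> s) \<le> c\<^sup>2 * sq \<tau> s"
        using block_boundedD[OF bb *(1,2), of 0 s] * V_0_base[OF s] by simp
      thus "cmod (\<Sum>B\<in>{B\<in>BB. v \<in> B}. g B) \<le> c"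
        using * s c \<Omega> unfolding eq by (intro cmod_le_of_sq[of \<tau> s])
    qed
    have 2: "nrm A (pE \<otimes> (x \<otimes> pE)) \<le> (real (card E0))\<^sup>2 * (C2 * c)"
    proof (rule nrm_conj_pE_le)
      fix e f assume ef: "e \<in> E0" "f \<in> E0"
      let ?x = "star A (S e) \<otimes> (x \<otimes> S f)"
      show "nrm A ?x \<le> C2 * c"
      proof (rule C2(2)[OF F_compress[OF x ef] c])
        show "block_bounded \<Omega> N K ?x c"
          unfolding block_bounded_def
        proof (intro ballI allI impI)
          fix \<tau> v s k z
          assume *: "\<tau> \<in> \<Omega>" "base v s" "(k < K \<and> kills s) \<or> (k = K \<and> orth \<tau> s N)" "z \<in> V s k"
          have s: "s \<in> \<A>" using *(2) by (simp add: base_def)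
          have z [simp]: "z \<in> \<A>" using * s V_closed by blast
          \<comment> \<open>\<open>S f\<close> raises \<open>k\<close> and the stage together, so
            both alternatives of the test condition carry over with the same
            \<open>s\<close>.\<close>
          have Sz: "S f \<otimes> z \<in> V s (Suc k)" using * s ef by (intro V_S_mult)
          have \<tau>: "pos_fun \<tau>" using * \<Omega> by blast
          have contr: "sq \<tau> (u \<otimes> y) \<le> sq \<tau> y"
            if "u \<in> \<A>" "nrm A u \<le> 1" "y \<in> \<A>" for u y
          proof -
            have "(nrm A u)\<^sup>2 * sq \<tau> y \<le> 1 * sq \<tau> y"
              using that sq_nonneg[OF \<tau>] by (intro mult_right_mono) (auto simp: power_le_one)
            thus ?thesis using sq_mult_le[OF \<tau>, of u y] that by simp
          qed
          have "sq \<tau> (?x \<otimes> z) = sq \<tau> (star A (S e) \<otimes> (x \<otimes> (S f \<otimes> z)))"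
            using ef by (simp add: mult_assoc)
          also have "\<dots> \<le> sq \<tau> (x \<otimes> (S f \<otimes> z))"
            using ef nrm_S_le[of e] by (intro contr) auto
          also have "\<dots> \<le> c\<^sup>2 * sq \<tau> (S f \<otimes> z)"
            using *(3) by (intro block_boundedD[OF bb *(1,2) _ Sz]) auto
          also have "\<dots> \<le> c\<^sup>2 * sq \<tau> z"
            using ef nrm_S_le[of f] by (intro mult_left_mono contr) auto
          finally show "sq \<tau> (?x \<otimes> z) \<le> c\<^sup>2 * sq \<tau> z" .
        qed
      qed
    qed (use C2 c in auto)
    have "nrm A x \<le> nrm A (Rm (lincomb g)) + nrm A (pE \<otimes> (x \<otimes> pE))"
      by (subst g, rule nrm_triangle) auto
    with 1 2 show "nrm A x \<le> (C1 + (real (card E0))\<^sup>2 * C2) * c"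
      by (simp add: algebra_simps)
  qed (use C1 C2 in auto)
qed

text \<open>On the subspaces \<open>V s k\<close> the off-diagonal part \<open>o'\<close> is invisible, so \<open>r\<close> bounds \<open>h\<close>
  there; the constant of \<open>norm_bound\<close> disappears upon taking high powers of \<open>h\<^sup>* h\<close>.\<close>

lemma nrm_diagonal_le:
  assumes \<Omega>: "\<And>\<tau>. \<tau> \<in> \<Omega> \<Longrightarrow> pos_fun \<tau>"
    and exA: "\<And>v. \<lbrakk>v \<in> verts G; singular E0 v\<rbrakk> \<Longrightarrow> \<exists>\<tau>\<in>\<Omega>. \<exists>s. base v s \<and> kills s \<and> sq \<tau> s \<noteq> 0"
    and exB: "\<And>v. v \<in> verts G \<Longrightarrow> \<exists>\<tau>\<in>\<Omega>. \<exists>s. base v s \<and> orth \<tau> s N \<and> sq \<tau> s \<noteq> 0"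
    and h: "h \<in> F N" and o': "o' \<in> addspan (offdiag N)" and r: "0 \<le> r"
    and dom: "\<And>\<tau> z. \<lbrakk>\<tau> \<in> \<Omega>; z \<in> \<A>\<rbrakk> \<Longrightarrow> sq \<tau> ((h \<oplus> o') \<otimes> z) \<le> r\<^sup>2 * sq \<tau> z"
  shows "nrm A h \<le> r"
proof -
  have hc [simp]: "h \<in> \<A>" using h by simp
  have oc [simp]: "o' \<in> \<A>" using addspan_closed[OF o' offdiag_closed] .
  define x where "x = star A h \<otimes> h"
  have x: "x \<in> F N" unfolding x_def by (intro F_mult F_star h)
  have xc [simp]: "x \<in> \<A>" and sa: "star A x = x" by (simp_all add: x_def star_mult)
  \<comment> \<open>On the test spaces \<open>h\<close> is bounded by \<open>r\<close> and
    \<open>star A h\<close> by its full norm. Cancelling one factor \<open>nrm A h\<close> at the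
    end gives the claim.\<close>
  define \<rho> where "\<rho> = nrm A h * r"
  have \<rho>: "0 \<le> \<rho>" using r by (simp add: \<rho>_def)
  have sqF: "square_iter x n \<in> F N" for n
    by (induction n) (use x F_mult in auto)
  have blk: "sq \<tau> (square_iter x n \<otimes> z) \<le> (\<rho> ^ (2 ^ n))\<^sup>2 * sq \<tau> z"
    if *: "\<tau> \<in> \<Omega>" "base v s" "(k < N \<and> kills s) \<or> (k = N \<and> orth \<tau> s N)" "z \<in> V s k" for \<tau> v s k n z
    using *(4)
  proof (induction n arbitrary: z)
    have \<tau>: "pos_fun \<tau>" using * \<Omega> by blast
    have s: "s \<in> \<A>" using *(2) by (simp add: base_def)
    have kN: "N \<le> k \<or> kills s" using *(3) by auto
    {
      case 0
      have z [simp]: "z \<in> \<A>" using 0 s V_closed by blast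
      have hz: "h \<otimes> z \<in> V s k" by (rule F_V[OF *(2) h 0 kN])
      \<comment> \<open>Since \<open>h z\<close> is orthogonal to \<open>o' z\<close>, the squared
        length of \<open>h z\<close> is its inner product with \<open>(h + o') z\<close>;
        Cauchy-Schwarz then bounds it.\<close>
      have "\<tau> (star A (h \<otimes> z) \<otimes> (o' \<otimes> z)) = 0"
        using *(3) by (intro offdiag_vanishes[OF \<tau> *(2) _ o' hz 0]) auto
      hence "\<tau> (star A (h \<otimes> z) \<otimes> ((h \<oplus> o') \<otimes> z)) = \<tau> (star A (h \<otimes> z) \<otimes> (h \<otimes> z))"
        by (simp add: distrib_left distrib_right pos_fun_add[OF \<tau>])
      hence "(sq \<tau> (h \<otimes> z))\<^sup>2 \<le> sq \<tau> (h \<otimes> z) * sq \<tau> ((h \<oplus> o') \<otimes> z)"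
        using Cauchy_Schwarz[OF \<tau>, of "h \<otimes> z" "(h \<oplus> o') \<otimes> z"] of_real_sq[OF \<tau>, of "h \<otimes> z"] by simp
      also have "\<dots> \<le> sq \<tau> (h \<otimes> z) * (r\<^sup>2 * sq \<tau> z)"
        using * sq_nonneg[OF \<tau>] by (intro mult_left_mono dom) auto
      finally have "sq \<tau> (h \<otimes> z) * sq \<tau> (h \<otimes> z) \<le> sq \<tau> (h \<otimes> z) * (r\<^sup>2 * sq \<tau> z)"
        by (simp add: power2_eq_square)
      hence hz: "sq \<tau> (h \<otimes> z) \<le> r\<^sup>2 * sq \<tau> z"
        using sq_nonneg[OF \<tau>, of "h \<otimes> z"] sq_nonneg[OF \<tau>, of z]
        by (cases "sq \<tau> (h \<otimes> z) = 0") auto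
      have "sq \<tau> (x \<otimes> z) \<le> (nrm A h)\<^sup>2 * sq \<tau> (h \<otimes> z)"
        using sq_mult_le[OF \<tau>, of "star A h" "h \<otimes> z"] by (simp add: x_def mult_assoc)
      also have "\<dots> \<le> (nrm A h)\<^sup>2 * (r\<^sup>2 * sq \<tau> z)" by (intro mult_left_mono hz) auto
      finally show ?case by (simp add: \<rho>_def power_mult_distrib mult.assoc)
    next
      case (Suc n)
      have z [simp]: "z \<in> \<A>" using Suc s V_closed by blast
      have "square_iter x n \<otimes> z \<in> V s k" by (rule F_V[OF *(2) sqF Suc.prems kN])
      from Suc.IH[OF this]
      have "sq \<tau> (square_iter x (Suc n) \<otimes> z) \<le> (\<rho> ^ (2 ^ n))\<^sup>2 * sq \<tau> (square_iter x n \<otimes> z)"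
        by (simp add: mult_assoc)
      also have "\<dots> \<le> (\<rho> ^ (2 ^ n))\<^sup>2 * ((\<rho> ^ (2 ^ n))\<^sup>2 * sq \<tau> z)"
        by (intro mult_left_mono Suc.IH[OF Suc.prems]) auto
      also have "\<dots> = (\<rho> ^ (2 ^ Suc n))\<^sup>2 * sq \<tau> z"
        by (simp add: power2_eq_square power_add mult_2 mult.assoc)
      finally show ?case .
    }
  qed
  from norm_bound[OF \<Omega> exA exB, of N] obtain C where C: "C \<ge> 0"
    "\<And>x c. \<lbrakk>x \<in> F N; 0 \<le> c; block_bounded \<Omega> N N x c\<rbrakk> \<Longrightarrow> nrm A x \<le> C * c" by blast
  have "nrm A x \<le> \<rho>"
  proof (rule nrm_le_of_square_iter[OF xc sa \<rho>, of 0 C])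
    fix n
    have "block_bounded \<Omega> N N (square_iter x n) (\<rho> ^ (2 ^ n))"
      unfolding block_bounded_def using blk by blast
    thus "nrm A (square_iter x n) \<le> (0 * 2 ^ n + C) * \<rho> ^ (2 ^ n)"
      using C(2)[OF sqF] \<rho> by simp
  qed
  hence "nrm A h * nrm A h \<le> nrm A h * r"
    by (simp add: x_def \<rho>_def cstar_identity power2_eq_square)
  thus ?thesis using nrm_nonneg[OF hc] r by (cases "nrm A h = 0") auto
qed

end

section \<open>Cycles and their exits\<close>

lemma ug_path_successively:
  "ug_path G \<alpha> \<longleftrightarrow> \<alpha> \<noteq> [] \<and> set \<alpha> \<subseteq> edges G \<and> successively (\<lambda>e f. src G f \<in> rng G e) \<alpha>"
  by (auto simp: ug_path_def successively_conv_nth)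

text \<open>Cyclic indexing treats the closing condition like the condition on consecutive
  edges.\<close>

lemma ug_cycle_nth:
  assumes "ug_cycle G \<alpha>" "i < length \<alpha>"
  shows "src G (\<alpha> ! (Suc i mod length \<alpha>)) \<in> rng G (\<alpha> ! i)"
proof (cases "Suc i < length \<alpha>")
  case True
  thus ?thesis using assms by (auto simp: ug_cycle_def ug_path_def)
next
  case False
  hence i: "Suc i = length \<alpha>" using assms by simp
  hence "\<alpha> \<noteq> []" "length \<alpha> - 1 = i" by auto
  with i have "Suc i = length \<alpha>" "last \<alpha> = \<alpha> ! i" "hd \<alpha> = \<alpha> ! 0"
    by (simp_all add: last_conv_nth hd_conv_nth)
  thus ?thesis using assms by (auto simp: ug_cycle_def)
qed

text \<open>Take a shortest cycle with the given initial source. If an edge occurred twice, the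
  piece between the two occurrences could be cut out without changing the first or last
  edge.\<close>

lemma simple_cycle_exists:
  assumes "ug_cycle G \<mu>"
  obtains \<alpha> where "ug_simple_cycle G \<alpha>" "src G (hd \<alpha>) = src G (hd \<mu>)"
proof -
  let ?Q = "\<lambda>\<alpha>. ug_cycle G \<alpha> \<and> src G (hd \<alpha>) = src G (hd \<mu>)"
  obtain \<alpha> where \<alpha>: "?Q \<alpha>" "\<And>\<beta>. ?Q \<beta> \<Longrightarrow> length \<alpha> \<le> length \<beta>"
    using ex_has_least_nat[of ?Q \<mu> length] assms by blast
  have "distinct \<alpha>"
  proof (rule ccontr)
    assume "\<not> distinct \<alpha>"
    then obtain xs y ys zs where \<alpha>_eq: "\<alpha> = xs @ [y] @ ys @ [y] @ zs"
      using not_distinct_decomp by blast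
    have "hd (xs @ [y] @ zs) = hd \<alpha>" "last (xs @ [y] @ zs) = last \<alpha>"
      by (auto simp: \<alpha>_eq hd_append)
    hence "?Q (xs @ [y] @ zs)"
      using \<alpha>(1) unfolding ug_cycle_def ug_path_successively
      by (auto simp: \<alpha>_eq successively_append_iff successively_Cons)
    from \<alpha>(2)[OF this] show False by (simp add: \<alpha>_eq)
  qed
  with \<alpha>(1) that show ?thesis by (auto simp: ug_simple_cycle_def)
qed

lemma length_iterate_path: "length (iterate_path n \<alpha>) = n * length \<alpha>"
  by (induction n) (auto simp: iterate_path_def)

lemma nth_iterate_path: "i < n * length \<alpha> \<Longrightarrow> iterate_path n \<alpha> ! i = \<alpha> ! (i mod length \<alpha>)"
proof (induction n arbitrary: i)
  case (Suc n)
  thus ?case by (cases "i < length \<alpha>") (auto simp: iterate_path_def nth_append le_mod_geq)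
qed auto

lemma no_exit_out_edges:
  assumes "\<not> has_exits G \<alpha>" "i < length \<alpha>"
  shows "out_edges G (rng G (\<alpha> ! i)) = {\<alpha> ! (Suc i mod length \<alpha>)}"
proof (cases "Suc i < length \<alpha>")
  case True
  thus ?thesis using assms by (auto simp: has_exits_def)
next
  case False
  hence i: "length \<alpha> = Suc i" using assms by simp
  hence "\<alpha> \<noteq> []" "length \<alpha> - 1 = i" by auto
  hence "last \<alpha> = \<alpha> ! i" "hd \<alpha> = \<alpha> ! 0"
    by (simp_all add: last_conv_nth hd_conv_nth)
  thus ?thesis using assms i by (simp add: has_exits_def)
qed

text \<open>Without exits every edge of \<alpha> has exactly one successor, so \<mu> has no choice
  but to run around \<alpha>.\<close>

lemma no_exit_cycle_iterate:
  assumes \<alpha>: "ug_simple_cycle G \<alpha>" "\<not> has_exits G \<alpha>"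
    and \<mu>: "ug_cycle G \<mu>" "src G (hd \<mu>) = src G (hd \<alpha>)"
  obtains n where "n > 0" "\<mu> = iterate_path n \<alpha>"
proof -
  let ?k = "length \<alpha>"
  have k: "?k > 0" "\<mu> \<noteq> []" "\<alpha> \<noteq> []" and dist: "distinct \<alpha>" and cyc: "ug_cycle G \<alpha>"
    using \<alpha> \<mu> by (auto simp: ug_simple_cycle_def ug_cycle_def ug_path_def)
  have edge: "\<mu> ! i \<in> edges G" if "i < length \<mu>" for i
    using \<mu> that nth_mem[OF that] by (auto simp: ug_cycle_def ug_path_def)
  have nth: "\<mu> ! i = \<alpha> ! (i mod ?k)" if "i < length \<mu>" for i
    using that
  proof (induction i)
    case 0
    \<comment> \<open>The first edge of \<mu> also follows the last edge of \<alpha>, because both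
      cycles start at the same vertex.\<close>
    have "src G (\<mu> ! 0) \<in> rng G (\<alpha> ! (?k - 1))"
      using ug_cycle_nth[OF cyc, of "?k - 1"] k \<mu>(2) by (simp add: hd_conv_nth)
    hence "\<mu> ! 0 \<in> out_edges G (rng G (\<alpha> ! (?k - 1)))"
      using edge[of 0] 0 by (simp add: out_edges_def)
    thus ?case using no_exit_out_edges[OF \<alpha>(2), of "?k - 1"] k by simp
  next
    case (Suc i)
    have "src G (\<mu> ! Suc i) \<in> rng G (\<mu> ! i)"
      using \<mu> Suc.prems by (auto simp: ug_cycle_def ug_path_def)
    hence "\<mu> ! Suc i \<in> out_edges G (rng G (\<alpha> ! (i mod ?k)))"
      using Suc edge[of "Suc i"] by (simp add: out_edges_def)
    thus ?case using no_exit_out_edges[OF \<alpha>(2), of "i mod ?k"] k by (simp add: mod_Suc_eq)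
  qed
  let ?l = "length \<mu> - 1"
  have l: "?l < length \<mu>" using k by simp
  have "src G (\<alpha> ! 0) \<in> rng G (\<alpha> ! (?l mod ?k))"
    using \<mu> k nth[OF l] by (auto simp: ug_cycle_def hd_conv_nth last_conv_nth)
  moreover have "\<alpha> ! 0 \<in> edges G"
    using cyc k nth_mem[of 0 \<alpha>] by (auto simp: ug_cycle_def ug_path_def)
  ultimately have "\<alpha> ! 0 \<in> out_edges G (rng G (\<alpha> ! (?l mod ?k)))"
    by (simp add: out_edges_def)
  hence "\<alpha> ! 0 = \<alpha> ! (Suc (?l mod ?k) mod ?k)"
    using no_exit_out_edges[OF \<alpha>(2), of "?l mod ?k"] k by simp
  \<comment> \<open>As \<alpha> is simple, equal edges have equal indices. So \<mu> can only close
    up after whole turns.\<close>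
  hence "Suc (?l mod ?k) mod ?k = 0"
    using dist k nth_eq_iff_index_eq[OF dist, of 0 "Suc (?l mod ?k) mod ?k"] by simp
  hence "length \<mu> mod ?k = 0" using k by (simp add: mod_Suc_eq)
  then obtain n where n: "length \<mu> = n * ?k" by (auto simp: mod_eq_0_iff_dvd dvd_def mult.commute)
  have "\<mu> = iterate_path n \<alpha>"
    by (rule nth_equalityI) (auto simp: n length_iterate_path nth nth_iterate_path)
  moreover have "n > 0" using n k by (cases n) auto
  ultimately show ?thesis using that by blast
qed

section \<open>Sufficiently many states separate points\<close>

context ck_algebra
begin

text \<open>Along a path each range projection absorbs the next partial isometry, so all letters
  cancel and only the projection at the end survives.\<close>

lemma path_star_lm_lm:
  "\<lbrakk>ug_path G \<delta>; B \<in> \<V>; B \<subseteq> rng G (last \<delta>)\<rbrakk> \<Longrightarrow> star A (lm \<delta> (P B)) \<otimes> lm \<delta> (P B) = P B"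
proof (induction \<delta>)
  case (Cons e \<delta>)
  have e: "e \<in> \<E>" "set \<delta> \<subseteq> \<E>" using Cons by (auto simp: ug_path_def)
  have eq: "star A (lm (e # \<delta>) (P B)) \<otimes> lm (e # \<delta>) (P B) =
      star A (lm \<delta> (P B)) \<otimes> (P (rng G e) \<otimes> lm \<delta> (P B))"
    using e Cons.prems by (simp add: star_mult mult_assoc)
  show ?case
  proof (cases \<delta>)
    case Nil
    moreover have "B \<inter> (rng G e \<inter> B) = B" using Cons.prems Nil by auto
    ultimately show ?thesis unfolding eq using e Cons.prems by simp
  next
    case (Cons f \<delta>')
    have "src G f \<in> rng G e" and p: "ug_path G \<delta>"
      using Cons.prems(1) Cons by (auto simp: ug_path_successively)
    hence "P (rng G e) \<otimes> lm \<delta> (P B) = lm \<delta> (P B)" using Cons e Cons.prems by simp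
    thus ?thesis unfolding eq using Cons.IH[OF p] Cons.prems Cons by simp
  qed
qed (auto simp: ug_path_def)

text \<open>Inserting \<open>P (rng G e)\<close> behind each \<open>S e\<close> shows that one
  inadmissible transition annihilates the product.\<close>

lemma lm_nonzero_path:
  "\<lbrakk>set \<mu> \<subseteq> \<E>; \<mu> \<noteq> []; B \<in> \<V>; lm \<mu> (P B) \<noteq> \<zero>\<rbrakk> \<Longrightarrow>
    ug_path G \<mu> \<and> rng G (last \<mu>) \<inter> B \<noteq> {}"
proof (induction \<mu>)
  case (Cons e \<mu>)
  have e: "e \<in> \<E>" "set \<mu> \<subseteq> \<E>" using Cons by auto
  have Se: "S e \<otimes> y = S e \<otimes> (P (rng G e) \<otimes> y)" if "y \<in> \<A>" for y using e that by simp
  show ?case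
  proof (cases \<mu>)
    case Nil
    have "rng G e \<inter> B \<noteq> {}"
    proof
      assume "rng G e \<inter> B = {}"
      hence "S e \<otimes> P B = \<zero>" using Se[of "P B"] e Cons.prems by simp
      thus False using Cons.prems Nil by simp
    qed
    thus ?thesis using Nil e by (auto simp: ug_path_successively)
  next
    case (Cons f \<mu>')
    have y: "lm \<mu> (P B) \<in> \<A>" using e Cons.prems by simp
    hence "lm \<mu> (P B) \<noteq> \<zero>" using Cons.prems e by auto
    hence *: "ug_path G \<mu> \<and> rng G (last \<mu>) \<inter> B \<noteq> {}" using Cons.IH Cons.prems e Cons by auto
    have "src G f \<in> rng G e"
    proof (rule ccontr)
      assume "src G f \<notin> rng G e"
      hence "P (rng G e) \<otimes> lm \<mu> (P B) = \<zero>" using Cons e Cons.prems by simp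
      hence "lm (e # \<mu>) (P B) = \<zero>" using Se[OF y] e by simp
      thus False using Cons.prems by simp
    qed
    thus ?thesis using * Cons e by (auto simp: ug_path_successively)
  qed
qed auto

lemma base_lm:
  "\<lbrakk>set \<delta> \<subseteq> \<E>; \<delta> \<noteq> []; x \<in> \<A>\<rbrakk> \<Longrightarrow> base (src G (hd \<delta>)) (lm \<delta> x)"
  by (cases \<delta>) (auto simp: base_def)

lemma base_P: "v \<in> verts G \<Longrightarrow> base v (P {v})"
  by (auto simp: base_def)

lemma sq_nonzero: "pos_fun \<tau> \<Longrightarrow> s \<in> \<A> \<Longrightarrow> sq \<tau> s \<noteq> 0 \<longleftrightarrow> \<tau> (star A s \<otimes> s) \<noteq> 0"
  by (simp add: of_real_sq)

end

text \<open>The interface between algebra and measure theory. \<open>nondegenerate\<close> will come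
  from the positive measure of the sets \<open>D B\<close>, \<open>cycle_state\<close> from the sets
  \<open>E\<close> of the hypothesis.\<close>

locale ck_states = ck_algebra A G S P
  for A :: "'a cstar" (structure) and G :: "('v, 'e) ultragraph" and S P +
  fixes \<Omega> :: "('a \<Rightarrow> complex) set"
  assumes gen: "generated_cstar A (S ` \<E> \<union> P ` \<V>) = \<A>"
    and \<Omega>: "\<tau> \<in> \<Omega> \<Longrightarrow> pos_fun \<tau>"
    and nondegenerate: "\<lbrakk>B \<in> \<V>; B \<noteq> {}\<rbrakk> \<Longrightarrow> \<exists>\<tau>\<in>\<Omega>. \<tau> (P B) \<noteq> 0"
    and cycle_state: "\<lbrakk>ug_simple_cycle G \<alpha>; \<not> has_exits G \<alpha>; finite F; \<forall>n\<in>F. n > 0\<rbrakk> \<Longrightarrow>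
      \<exists>\<tau>\<in>\<Omega>. \<tau> (P {src G (hd \<alpha>)}) \<noteq> 0 \<and>
        (\<forall>n\<in>F. \<tau> (lm (iterate_path n \<alpha>) (P {src G (hd \<alpha>)})) = 0)"
begin

section \<open>Test vectors at every vertex\<close>

lemma state_for_isometry:
  assumes "s \<in> \<A>" "star A s \<otimes> s = P B" "B \<in> \<V>" "B \<noteq> {}"
  shows "\<exists>\<tau>\<in>\<Omega>. sq \<tau> s \<noteq> 0"
  using nondegenerate[OF assms(3,4)] assms \<Omega> sq_nonzero by metis

text \<open>For a sink take the vertex projection. Otherwise take \<open>S e\<close> for an edge
  \<open>e\<close> outside \<open>E\<close>: its range is orthogonal to all ranges from
  \<open>E\<close>.\<close>

lemma singular_state:
  assumes "v \<in> verts G" "E \<subseteq> \<E>" "singular E v"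
  shows "\<exists>\<tau>\<in>\<Omega>. \<exists>s. base v s \<and> (\<forall>f\<in>E. star A (S f) \<otimes> s = \<zero>) \<and> sq \<tau> s \<noteq> 0"
proof (cases "out_edges G {v} = {}")
  case True
  have "star A (S f) \<otimes> P {v} = \<zero>" if "f \<in> E" for f
  proof -
    have f: "f \<in> \<E>" "src G f \<noteq> v" using that assms True by (auto simp: out_edges_def)
    have "star A (S f) \<otimes> P {v} = star A (P {v} \<otimes> S f)" using f assms by (simp add: star_mult del: P_S)
    thus ?thesis using f assms by simp
  qed
  moreover have "\<exists>\<tau>\<in>\<Omega>. sq \<tau> (P {v}) \<noteq> 0"
    using assms by (intro state_for_isometry) auto
  ultimately show ?thesis using base_P[OF assms(1)] by blast
next
  case False
  then obtain e where e: "e \<in> \<E>" "src G e = v" "e \<notin> E"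
    using assms by (auto simp: singular_def out_edges_def)
  have "base v (S e)" using e by (auto simp: base_def)
  moreover have "star A (S f) \<otimes> S e = \<zero>" if "f \<in> E" for f
  proof -
    have "f \<in> \<E>" "f \<noteq> e" using that e assms by auto
    thus ?thesis using e by simp
  qed
  moreover have "\<exists>\<tau>\<in>\<Omega>. sq \<tau> (S e) \<noteq> 0"
    using e rng_nonempty by (intro state_for_isometry) auto
  ultimately show ?thesis by blast
qed

text \<open>Unless \<open>\<delta>\<close> is a prefix of \<open>\<mu> @ \<delta>\<close>, that is,
  unless the length of \<mu> is a period of \<delta>, the product vanishes by itself. Only the
  periodic case is left to the hypothesis.\<close>

lemma lm_path_orth:
  assumes \<tau>: "pos_fun \<tau>" and \<delta>: "set \<delta> \<subseteq> \<E>" and x: "x \<in> \<A>"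
    and "\<And>\<mu>. \<lbrakk>set \<mu> \<subseteq> \<E>; \<mu> \<noteq> []; length \<mu> \<le> N; take (length \<delta>) (\<mu> @ \<delta>) = \<delta>\<rbrakk> \<Longrightarrow>
      star A x \<otimes> lm (drop (length \<delta>) (\<mu> @ \<delta>)) x = \<zero>"
  shows "orth \<tau> (lm \<delta> x) N"
  unfolding orth_def
proof (intro allI impI)
  fix \<mu> assume \<mu>: "set \<mu> \<subseteq> \<E>" "\<mu> \<noteq> []" "length \<mu> \<le> N"
  have "star A (lm \<delta> x) \<otimes> lm (\<mu> @ \<delta>) x = \<zero>"
    using star_lm_mult_lm[of \<delta> "\<mu> @ \<delta>" x x] assms(4)[OF \<mu>] \<mu> \<delta> x by auto
  thus "\<tau> (star A (lm \<delta> x) \<otimes> lm \<mu> (lm \<delta> x)) = 0" using \<tau> by (simp add: lm_append pos_fun_zero)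
qed

text \<open>An exit of a simple cycle gives a path from \<open>v\<close> that has no period of length at most \<open>N\<close>:
  go around the cycle often enough and leave it through the exit.\<close>

lemma aperiodic_path:
  assumes \<alpha>: "ug_simple_cycle G \<alpha>" and i: "i < length \<alpha>"
    and g: "g \<in> out_edges G (rng G (\<alpha> ! i))" "g \<noteq> \<alpha> ! (Suc i mod length \<alpha>)"
  obtains x where "ug_path G x" "hd x = hd \<alpha>"
    "\<And>\<mu>. \<lbrakk>\<mu> \<noteq> []; length \<mu> \<le> N\<rbrakk> \<Longrightarrow> take (length x) (\<mu> @ x) \<noteq> x"
proof -
  let ?k = "length \<alpha>"
  \<comment> \<open>\<open>Suc N\<close> full turns make \<open>L\<close> exceed \<open>N\<close>;
    the extra \<open>Suc i\<close> edges end the walk at \<open>\<alpha> ! i\<close>, from which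
    \<open>g\<close> departs.\<close>
  define L where "L = Suc N * ?k + Suc i"
  have cyc: "ug_cycle G \<alpha>" and dist: "distinct \<alpha>" and k: "?k > 0" "\<alpha> \<noteq> []"
    using \<alpha> i by (auto simp: ug_simple_cycle_def)
  have "Suc N \<le> Suc N * ?k" using k by (cases \<alpha>) auto
  hence L: "L > N" unfolding L_def by linarith
  have Lk: "L mod ?k = Suc i mod ?k" unfolding L_def by (metis mod_mult_self3)
  have Lk': "(L - 1) mod ?k = i" using i unfolding L_def by (metis diff_Suc_1 add_Suc_right mod_less mod_mult_self3)
  define x where "x = map (\<lambda>t. \<alpha> ! (t mod ?k)) [0..<L] @ [g]"
  have lx: "length x = Suc L" by (simp add: x_def)
  have x1: "x ! t = \<alpha> ! (t mod ?k)" if "t < L" for t using that by (simp add: x_def nth_append)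
  have x2: "x ! L = g" by (simp add: x_def nth_append)
  have "ug_path G x" unfolding ug_path_def
  proof (intro conjI allI impI)
    show "set x \<subseteq> \<E>"
      using g cyc k by (auto simp: x_def out_edges_def ug_cycle_def ug_path_def)
    fix t assume t: "Suc t < length x"
    show "src G (x ! Suc t) \<in> rng G (x ! t)"
    proof (cases "Suc t < L")
      case True
      thus ?thesis using ug_cycle_nth[OF cyc, of "t mod ?k"] k x1 by (simp add: mod_Suc_eq)
    next
      case False
      hence "Suc t = L" "t < L" using t lx by auto
      thus ?thesis using x1[of t] x2 Lk' g by (auto simp: out_edges_def)
    qed
  qed (simp add: x_def)
  moreover have "hd x = hd \<alpha>"
    using L k lx x1[of 0] by (metis gr_zeroI hd_conv_nth length_0_conv mod_0 not_less_zero Zero_not_Suc)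
  moreover have "take (length x) (\<mu> @ x) \<noteq> x" if "\<mu> \<noteq> []" "length \<mu> \<le> N" for \<mu>
  proof
    assume eq: "take (length x) (\<mu> @ x) = x"
    let ?j = "length \<mu>"
    have per: "x ! (t + ?j) = x ! t" if "t + ?j < length x" for t
    proof -
      have "x ! (t + ?j) = take (length x) (\<mu> @ x) ! (t + ?j)" by (subst eq) (rule refl)
      also have "\<dots> = (\<mu> @ x) ! (t + ?j)" using that by (rule nth_take)
      also have "\<dots> = x ! t" by (simp add: nth_append)
      finally show ?thesis .
    qed
    have j: "?j < L" using that L by simp
    \<comment> \<open>Comparing the positions 0 and \<open>?j\<close> forces the shift to be a
      multiple of the cycle length. Such a shift then identifies \<open>g\<close> with the cycle
      edge that it avoids.\<close>
    have "\<alpha> ! (?j mod ?k) = \<alpha> ! 0" using per[of 0] j x1[of ?j] x1[of 0] lx by simp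
    hence j0: "?j mod ?k = 0" using nth_eq_iff_index_eq[OF dist, of "?j mod ?k" 0] k by simp
    have "x ! L = x ! (L - ?j)" using per[of "L - ?j"] j lx by simp
    moreover have "L - ?j < L" using that j by simp
    ultimately have "g = \<alpha> ! ((L - ?j) mod ?k)" using x1 x2 by simp
    also have "(L - ?j) mod ?k = L mod ?k"
      using j0 j by (metis le_add_diff_inverse2 less_imp_le mod_add_right_eq add_0_right)
    finally show False using g Lk by simp
  qed
  ultimately show ?thesis using that by blast
qed

text \<open>Four cases. No cycle at \<open>v\<close>: no word leads back. A simple cycle without
  exits: \<open>cycle_state\<close> applies. An exit through an edge: an aperiodic path. A sink in
  some range: walk to the sink and stop, since no word continues from there.\<close>

lemma orthogonal_state:
  assumes v: "v \<in> verts G"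
  shows "\<exists>\<tau>\<in>\<Omega>. \<exists>s. base v s \<and> orth \<tau> s N \<and> sq \<tau> s \<noteq> 0"
proof (cases "\<exists>\<mu>. ug_cycle G \<mu> \<and> src G (hd \<mu>) = v")
  case no_cycle: False
  obtain \<tau> where \<tau>: "\<tau> \<in> \<Omega>" "sq \<tau> (P {v}) \<noteq> 0"
    using state_for_isometry[of "P {v}" "{v}"] v by auto
  have "P {v} \<otimes> lm \<mu> (P {v}) = \<zero>" if \<mu>: "set \<mu> \<subseteq> \<E>" "\<mu> \<noteq> []" for \<mu>
  proof (rule ccontr)
    assume nz: "P {v} \<otimes> lm \<mu> (P {v}) \<noteq> \<zero>"
    hence "lm \<mu> (P {v}) \<noteq> \<zero>" using v by auto
    with lm_nonzero_path[of \<mu> "{v}"] \<mu> v have p: "ug_path G \<mu>" "v \<in> rng G (last \<mu>)" by auto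
    moreover have "src G (hd \<mu>) = v" using nz \<mu> v by (cases \<mu>) (auto split: if_splits)
    ultimately show False using no_cycle by (auto simp: ug_cycle_def)
  qed
  hence "orth \<tau> (P {v}) N" using v \<Omega>[OF \<tau>(1)] by (auto simp: orth_def pos_fun_zero)
  thus ?thesis using \<tau> base_P[OF v] by blast
next
  case True
  then obtain \<alpha> where \<alpha>: "ug_simple_cycle G \<alpha>" "src G (hd \<alpha>) = v"
    using simple_cycle_exists by metis
  hence cyc: "ug_cycle G \<alpha>" and \<alpha>_path: "ug_path G \<alpha>" "\<alpha> \<noteq> []" "set \<alpha> \<subseteq> \<E>"
    by (auto simp: ug_simple_cycle_def ug_cycle_def ug_path_def)
  show ?thesis
  proof (cases "has_exits G \<alpha>")
    case False
    \<comment> \<open>A closed path at \<open>v\<close> of length at most \<open>N\<close> consists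
      of n copies of \<alpha> with n between 1 and \<open>N\<close>, so these finitely many
      conditions suffice.\<close>
    obtain \<tau> where \<tau>: "\<tau> \<in> \<Omega>" "\<tau> (P {v}) \<noteq> 0" "\<And>n. n \<in> {1..N} \<Longrightarrow> \<tau> (lm (iterate_path n \<alpha>) (P {v})) = 0"
      using cycle_state[OF \<alpha>(1) False, of "{1..N}"] \<alpha>(2) by auto
    have "\<tau> (P {v} \<otimes> lm \<mu> (P {v})) = 0"
      if \<mu>: "set \<mu> \<subseteq> \<E>" "\<mu> \<noteq> []" "length \<mu> \<le> N" for \<mu>
    proof (cases "P {v} \<otimes> lm \<mu> (P {v}) = \<zero>")
      case True
      thus ?thesis using \<Omega>[OF \<tau>(1)] by (simp add: pos_fun_zero)
    next
      case nz: False
      hence "lm \<mu> (P {v}) \<noteq> \<zero>" using v by auto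
      with lm_nonzero_path[of \<mu> "{v}"] \<mu> v have p: "ug_path G \<mu>" "v \<in> rng G (last \<mu>)" by auto
      have src: "src G (hd \<mu>) = v" using nz \<mu> v by (cases \<mu>) (auto split: if_splits)
      hence "ug_cycle G \<mu>" using p by (auto simp: ug_cycle_def)
      then obtain n where n: "n > 0" "\<mu> = iterate_path n \<alpha>"
        using no_exit_cycle_iterate[OF \<alpha>(1) False] src \<alpha>(2) by metis
      have "n \<le> n * length \<alpha>" using \<alpha>_path(2) by (cases \<alpha>) auto
      also have "\<dots> \<le> N" using n(2) \<mu>(3) by (simp add: length_iterate_path)
      finally have "n \<in> {1..N}" using n(1) by simp
      moreover have "P {v} \<otimes> lm \<mu> (P {v}) = lm \<mu> (P {v})"
        using src \<mu> v by (cases \<mu>) auto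
      ultimately show ?thesis using \<tau>(3) n by simp
    qed
    hence "orth \<tau> (P {v}) N" using v by (auto simp: orth_def)
    moreover have "sq \<tau> (P {v}) \<noteq> 0" using \<tau> v \<Omega> sq_nonzero[of \<tau> "P {v}"] by simp
    ultimately show ?thesis using \<tau> base_P[OF v] by blast
  next
    case True
    have "(\<exists>i<length \<alpha>. out_edges G (rng G (\<alpha> ! i)) \<noteq> {\<alpha> ! (Suc i mod length \<alpha>)}) \<or>
        (\<exists>i<length \<alpha>. \<exists>w\<in>rng G (\<alpha> ! i). out_edges G {w} = {})"
    proof -
      have l: "last \<alpha> = \<alpha> ! (length \<alpha> - 1)" "hd \<alpha> = \<alpha> ! (Suc (length \<alpha> - 1) mod length \<alpha>)"
        "length \<alpha> - 1 < length \<alpha>"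
        using \<alpha>_path by (auto simp: last_conv_nth hd_conv_nth)
      from True consider i where "Suc i < length \<alpha>" "out_edges G (rng G (\<alpha> ! i)) \<noteq> {\<alpha> ! Suc i}"
        | "out_edges G (rng G (last \<alpha>)) \<noteq> {hd \<alpha>}"
        | "\<exists>i<length \<alpha>. \<exists>w\<in>rng G (\<alpha> ! i). out_edges G {w} = {}"
        unfolding has_exits_def by blast
      thus ?thesis
      proof cases
        case (1 i)
        thus ?thesis by (intro disjI1 exI[of _ i]) auto
      next
        case 2
        thus ?thesis using l by (intro disjI1 exI[of _ "length \<alpha> - 1"]) auto
      qed auto
    qed
    thus ?thesis
    proof (elim disjE exE conjE bexE)
      fix i assume i: "i < length \<alpha>" and ne: "out_edges G (rng G (\<alpha> ! i)) \<noteq> {\<alpha> ! (Suc i mod length \<alpha>)}"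
      have "Suc i mod length \<alpha> < length \<alpha>" using i by (intro mod_less_divisor) linarith
      hence "\<alpha> ! (Suc i mod length \<alpha>) \<in> \<E>" using \<alpha>_path nth_mem by blast
      hence "\<alpha> ! (Suc i mod length \<alpha>) \<in> out_edges G (rng G (\<alpha> ! i))"
        using ug_cycle_nth[OF cyc i] by (simp add: out_edges_def)
      with ne obtain g where g: "g \<in> out_edges G (rng G (\<alpha> ! i))" "g \<noteq> \<alpha> ! (Suc i mod length \<alpha>)" by blast
      from aperiodic_path[OF \<alpha>(1) i g, of N] obtain x where x: "ug_path G x" "hd x = hd \<alpha>"
        "\<And>\<mu>. \<lbrakk>\<mu> \<noteq> []; length \<mu> \<le> N\<rbrakk> \<Longrightarrow> take (length x) (\<mu> @ x) \<noteq> x" by metis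
      have x': "x \<noteq> []" "set x \<subseteq> \<E>" "last x \<in> \<E>" using x(1) by (auto simp: ug_path_def)
      let ?s = "lm x (P (rng G (last x)))"
      have "star A ?s \<otimes> ?s = P (rng G (last x))" using x' by (intro path_star_lm_lm x(1)) auto
      then obtain \<tau> where \<tau>: "\<tau> \<in> \<Omega>" "sq \<tau> ?s \<noteq> 0"
        using state_for_isometry[of ?s "rng G (last x)"] x' rng_nonempty by auto
      moreover have "orth \<tau> ?s N" using x x' by (intro lm_path_orth \<Omega>[OF \<tau>(1)]) auto
      moreover have "base v ?s" using base_lm[of x] x x' \<alpha>(2) by auto
      ultimately show ?thesis by blast
    next
      fix i w assume i: "i < length \<alpha>" and w: "w \<in> rng G (\<alpha> ! i)" "out_edges G {w} = {}"
      let ?\<delta> = "take (Suc i) \<alpha>"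
      have \<delta>: "?\<delta> \<noteq> []" "set ?\<delta> \<subseteq> \<E>" "last ?\<delta> = \<alpha> ! i" "hd ?\<delta> = hd \<alpha>"
        using \<alpha>_path i set_take_subset[of "Suc i" \<alpha>] by (auto simp: take_Suc_conv_app_nth hd_append hd_conv_nth)
      have p: "ug_path G ?\<delta>" using \<alpha>_path(1) \<delta>(1,2) by (auto simp: ug_path_def)
      have "\<alpha> ! i \<in> \<E>" using \<alpha>_path i nth_mem by blast
      hence wv: "w \<in> verts G" using w rng_subset by blast
      let ?s = "lm ?\<delta> (P {w})"
      have "star A ?s \<otimes> ?s = P {w}" using wv w \<delta> by (intro path_star_lm_lm p) auto
      then obtain \<tau> where \<tau>: "\<tau> \<in> \<Omega>" "sq \<tau> ?s \<noteq> 0"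
        using state_for_isometry[of ?s "{w}"] \<delta> wv by auto
      moreover have "orth \<tau> ?s N"
      proof (rule lm_path_orth[OF \<Omega>[OF \<tau>(1)] \<delta>(2)])
        fix \<mu> assume \<mu>: "set \<mu> \<subseteq> \<E>" "\<mu> \<noteq> []"
        \<comment> \<open>What remains of \<open>\<mu> @ ?\<delta>\<close> is as long as \<mu>,
          hence nonempty. Its first edge does not start at the sink \<open>w\<close>, so
          \<open>P {w}\<close> annihilates it.\<close>
        let ?d = "drop (length ?\<delta>) (\<mu> @ ?\<delta>)"
        have "length ?d = length \<mu>" by simp
        hence d: "?d \<noteq> []" "set ?d \<subseteq> \<E>"
          using \<mu> \<delta>(2) set_drop_subset[of "length ?\<delta>" "\<mu> @ ?\<delta>"] by (metis length_0_conv, auto)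
        then obtain e d' where e: "?d = e # d'" by (cases ?d) auto
        have e': "e \<in> \<E>" "set d' \<subseteq> \<E>" using d(2) unfolding e by auto
        hence "src G e \<noteq> w" using w by (auto simp: out_edges_def)
        thus "star A (P {w}) \<otimes> lm ?d (P {w}) = \<zero>" unfolding e using e' wv by simp
      qed (use wv in auto)
      moreover have "base v ?s" using base_lm[of ?\<delta>] \<delta> \<alpha>(2) wv by auto
      ultimately show ?thesis by blast
    qed
  qed
qed

text \<open>For vector states this bounds \<pi>(b) by \<open>r\<close> on all vectors \<pi>(z) w. It
  replaces the operator norm in the estimates.\<close>

definition dominated :: "'a \<Rightarrow> real \<Rightarrow> bool" where
  "dominated b r \<longleftrightarrow> (\<forall>\<tau>\<in>\<Omega>. \<forall>z\<in>\<A>. sq \<tau> (b \<otimes> z) \<le> r\<^sup>2 * sq \<tau> z)"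

lemma dominated_mult:
  assumes "b \<in> \<A>" "c \<in> \<A>" "dominated b r" "dominated c t"
  shows "dominated (b \<otimes> c) (r * t)"
  unfolding dominated_def
proof (intro ballI)
  fix \<tau> z assume \<tau>: "\<tau> \<in> \<Omega>" and z: "z \<in> \<A>"
  have "sq \<tau> ((b \<otimes> c) \<otimes> z) \<le> r\<^sup>2 * sq \<tau> (c \<otimes> z)"
    using assms \<tau> z by (simp add: mult_assoc dominated_def)
  also have "\<dots> \<le> r\<^sup>2 * (t\<^sup>2 * sq \<tau> z)"
    using assms \<tau> z by (intro mult_left_mono) (auto simp: dominated_def)
  finally show "sq \<tau> ((b \<otimes> c) \<otimes> z) \<le> (r * t)\<^sup>2 * sq \<tau> z" by (simp add: power_mult_distrib mult.assoc)
qed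

lemma dominated_nrm: "b \<in> \<A> \<Longrightarrow> dominated b (nrm A b)"
  using sq_mult_le \<Omega> by (auto simp: dominated_def)

lemma nrm_degree_0_le:
  assumes h: "h \<in> Deg 0" and o': "o' \<in> addspan (\<Union>d\<in>-{0}. monomials d)"
    and r: "0 \<le> r" and dom: "dominated (h \<oplus> o') r"
  shows "nrm A h \<le> r"
proof -
  obtain E1 B1 N1 where 1: "finite E1" "E1 \<subseteq> \<E>" "finite B1" "B1 \<subseteq> \<V>"
    "h \<in> addspan (\<Union>d\<in>{0}. bounded_monomials E1 B1 N1 d)"
    using addspan_monomials_bounded[of h "{0}"] h by auto
  obtain E2 B2 N2 where 2: "finite E2" "E2 \<subseteq> \<E>" "finite B2" "B2 \<subseteq> \<V>"
    "o' \<in> addspan (\<Union>d\<in>-{0}. bounded_monomials E2 B2 N2 d)"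
    using addspan_monomials_bounded[OF o'] by metis
  define E where "E = E1 \<union> E2"
  \<comment> \<open>Only the sets of \<open>h\<close> are collected, because \<open>offdiag\<close>
    admits every member of \<open>gen_verts\<close>. The edges of \<open>o'\<close> are included,
    and all ranges with them.\<close>
  define B0 where "B0 = B1 \<union> rng G ` E"
  define BB where "BB = Inter ` (Pow B0 - {{}})"
  define N where "N = max N1 N2"
  have E: "finite E" "E \<subseteq> \<E>" using 1 2 by (auto simp: E_def)
  have B0: "finite B0" "B0 \<subseteq> \<V>" using 1 E by (auto simp: B0_def)
  have BB0: "B0 \<subseteq> BB" by (auto simp: BB_def intro!: image_eqI[of _ _ "{_}"])
  have Int: "finite T \<Longrightarrow> T \<noteq> {} \<Longrightarrow> T \<subseteq> \<V> \<Longrightarrow> \<Inter>T \<in> \<V>" for T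
    by (induction T rule: finite_ne_induct) auto
  interpret fs: finite_stage A G S P E BB
  proof
    show "finite E" "E \<subseteq> \<E>" by fact+
    show "finite BB" using B0 by (simp add: BB_def)
    show "BB \<subseteq> \<V>"
    proof
      fix B assume "B \<in> BB"
      then obtain T where "B = \<Inter>T" "T \<subseteq> B0" "T \<noteq> {}" by (auto simp: BB_def)
      thus "B \<in> \<V>" using B0 by (auto intro!: Int dest: finite_subset)
    qed
    show "B \<inter> C \<in> BB" if "B \<in> BB" "C \<in> BB" for B C
    proof -
      from that obtain T U where "B = \<Inter>T" "C = \<Inter>U" "T \<subseteq> B0" "T \<noteq> {}" "U \<subseteq> B0" by (auto simp: BB_def)
      hence "B \<inter> C = \<Inter>(T \<union> U)" "T \<union> U \<in> Pow B0 - {{}}" by auto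
      thus ?thesis unfolding BB_def by blast
    qed
    show "rng G e \<in> BB" if "e \<in> E" for e using that BB0 by (auto simp: B0_def)
  qed
  have hF: "h \<in> fs.F N" using 1(5)
  proof (induction rule: addspan.induct)
    case (add x y)
    from add(1) obtain c \<alpha> B \<beta> where x: "x = c \<odot> mon \<alpha> B \<beta>" "set \<alpha> \<subseteq> E1" "set \<beta> \<subseteq> E1" "B \<in> B1"
      "length \<alpha> \<le> N1" "length \<alpha> = length \<beta>" by (auto simp: bounded_monomials_def)
    have "mon \<alpha> B \<beta> \<in> fs.F N" using x BB0 by (intro fs.F_mon) (auto simp: E_def B0_def N_def)
    thus ?case using add x by (auto intro: fs.F_add fs.F_scale)
  qed simp
  have oF: "o' \<in> addspan (fs.offdiag N)"
  proof (rule addspan_mono[OF 2(5)], rule subsetI)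
    fix x assume "x \<in> (\<Union>d\<in>-{0}. bounded_monomials E2 B2 N2 d)"
    then obtain d where d: "d \<noteq> 0" "x \<in> bounded_monomials E2 B2 N2 d" by auto
    then obtain c \<alpha> B \<beta> where x: "x = c \<odot> mon \<alpha> B \<beta>" "set \<alpha> \<subseteq> E2" "set \<beta> \<subseteq> E2" "B \<in> B2"
      "length \<alpha> \<le> N2" "length \<beta> \<le> N2" "int (length \<alpha>) - int (length \<beta>) = d"
      unfolding bounded_monomials_def by blast
    thus "x \<in> fs.offdiag N" unfolding fs.offdiag_def using 2 d(1)
      by (intro CollectI exI[of _ c] exI[of _ \<alpha>] exI[of _ B] exI[of _ \<beta>]) (auto simp: E_def N_def)
  qed
  show ?thesis
  proof (rule fs.nrm_diagonal_le[OF \<Omega> _ _ hF oF r])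
    show "\<exists>\<tau>\<in>\<Omega>. \<exists>s. base v s \<and> fs.kills s \<and> sq \<tau> s \<noteq> 0" if "v \<in> verts G" "singular E v" for v
      using singular_state[OF that(1) E(2) that(2)] by (simp add: fs.kills_def)
  qed (use dom orthogonal_state in \<open>auto simp: dominated_def\<close>)
qed

text \<open>After multiplication by \<open>star A (b n)\<close> the summand \<open>b d\<close> has
  degree d - n, so the chosen component becomes the degree-zero part. With \<open>r = 0\<close> the
  bound shows that components are unique.\<close>

lemma nrm_component_le:
  assumes b: "\<And>d. b d \<in> Deg d" and n: "n \<in> {- int N..int N}" and r: "0 \<le> r"
    and dom: "dominated (finsum A b {- int N..int N}) r"
  shows "nrm A (b n) \<le> r"
proof -
  let ?I = "{- int N..int N}" and ?x = "finsum A b {- int N..int N}"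
  have bc [simp]: "b d \<in> \<A>" for d using b Deg_closed by blast
  have xc [simp]: "?x \<in> \<A>" by (intro finsum_closed) auto
  let ?c = "\<lambda>d. star A (b n) \<otimes> b d"
  have cD: "?c d \<in> Deg (- n + d)" for d by (intro Deg_mult Deg_star b)
  define o' where "o' = finsum A ?c (?I - {n})"
  have eq: "star A (b n) \<otimes> ?x = ?c n \<oplus> o'"
  proof -
    have "star A (b n) \<otimes> ?x = finsum A ?c (insert n (?I - {n}))"
      using n by (simp add: mult_finsum insert_absorb)
    also have "\<dots> = ?c n \<oplus> o'" unfolding o'_def by (intro finsum_insert) auto
    finally show ?thesis .
  qed
  let ?X = "\<Union>d\<in>-{0}. monomials d"
  have X: "?X \<subseteq> \<A>" using monomials_closed by auto
  have "finsum A ?c J \<in> addspan ?X" if "finite J" "n \<notin> J" for J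
    using that
  proof (induction J)
    case (insert d J)
    have "?c \<in> J \<rightarrow> \<A>" by auto
    moreover have "?c d \<in> addspan ?X"
      using insert by (intro addspan_mono[OF cD] UN_upper) auto
    ultimately show ?case using insert by (simp add: finsum_insert addspan_add[OF _ _ X])
  qed (auto intro: addspan.zero)
  hence o': "o' \<in> addspan ?X" by (simp add: o'_def)
  have "dominated (star A (b n) \<otimes> ?x) (nrm A (b n) * r)"
    using dominated_nrm[of "star A (b n)"] dom by (intro dominated_mult) auto
  hence "nrm A (?c n) \<le> nrm A (b n) * r"
    using cD[of n] o' r unfolding eq by (intro nrm_degree_0_le[OF _ o']) auto
  hence "nrm A (b n) * nrm A (b n) \<le> nrm A (b n) * r"
    by (simp add: cstar_identity power2_eq_square)
  thus ?thesis using nrm_nonneg[OF bc, of n] r by (cases "nrm A (b n) = 0") auto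
qed

lemma nrm_filt_le:
  assumes b: "b \<in> filt N" and r: "0 \<le> r" and dom: "dominated b r"
  shows "nrm A b \<le> (2 * real N + 1) * r"
proof -
  from b obtain c where c: "\<And>d. c d \<in> Deg d" "b = finsum A c {- int N..int N}"
    using filt_decompose[OF b] by metis
  have "nrm A b \<le> (\<Sum>d\<in>{- int N..int N}. nrm A (c d))"
    unfolding c(2) using c(1) Deg_closed by (intro nrm_finsum) blast
  also have "\<dots> \<le> (\<Sum>d\<in>{- int N..int N}. r)"
    using c dom r by (intro sum_mono nrm_component_le) auto
  finally show ?thesis by (simp add: add.commute)
qed

text \<open>The number of degrees that occur in a power of \<open>b\<close> grows only linearly with the exponent,
  so the factor in \<open>nrm_filt_le\<close> disappears as well.\<close>

lemma nrm_selfadjoint_le: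
  assumes b: "b \<in> filt N" "star A b = b" and r: "0 \<le> r" and dom: "dominated b r"
  shows "nrm A b \<le> r"
proof (rule nrm_le_of_square_iter[of b r "2 * real N" 1])
  have bc: "b \<in> \<A>" using b filt_closed by blast
  fix n
  \<comment> \<open>Squaring doubles the range of degrees but squares the operator bound.\<close>
  have "square_iter b n \<in> filt (N * 2 ^ n) \<and> dominated (square_iter b n) (r ^ (2 ^ n))"
  proof (induction n)
    case (Suc n)
    have "square_iter b (Suc n) \<in> filt (N * 2 ^ n + N * 2 ^ n)"
      using Suc filt_mult by simp
    moreover have "dominated (square_iter b (Suc n)) (r ^ (2 ^ n) * r ^ (2 ^ n))"
      using Suc bc by (simp add: dominated_mult)
    moreover have "N * 2 ^ n + N * 2 ^ n = N * 2 ^ Suc n" "r ^ (2 ^ n) * r ^ (2 ^ n) = r ^ (2 ^ Suc n)"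
      by (simp_all add: mult_2 power_add add_mult_distrib2)
    ultimately show ?case by metis
  qed (use b dom in auto)
  thus "nrm A (square_iter b n) \<le> (2 * real N * 2 ^ n + 1) * r ^ (2 ^ n)"
    using nrm_filt_le[of "square_iter b n" "N * 2 ^ n" "r ^ (2 ^ n)"] r by (simp add: mult.assoc)
qed (use assms filt_closed in auto)

text \<open>Approximate \<open>a\<close> by some \<open>c\<close> in \<open>filt N\<close>. The
  states do not see \<open>a\<close>, so \<open>c\<close> is as small for them as the error
  \<open>d\<close>; then \<open>c\<close> is small in norm, and so is \<open>a\<close>.\<close>

lemma states_separate:
  assumes a: "a \<in> \<A>"
    and zero: "\<And>\<tau> y z. \<lbrakk>\<tau> \<in> \<Omega>; y \<in> \<A>; z \<in> \<A>\<rbrakk> \<Longrightarrow> \<tau> (y \<otimes> (a \<otimes> z)) = 0"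
  shows "a = \<zero>"
proof -
  have "nrm A a \<le> 0 + \<epsilon>" if \<epsilon>: "\<epsilon> > 0" for \<epsilon>
  proof -
    obtain N c where c: "c \<in> filt N" "nrm A (a \<ominus> c) < \<epsilon> / 2"
      by (rule filt_dense[OF gen a, of "\<epsilon> / 2"]) (use \<epsilon> in simp)
    have cc [simp]: "c \<in> \<A>" using c filt_closed by blast
    define d where "d = c \<ominus> a"
    have dc [simp]: "d \<in> \<A>" using a by (simp add: d_def)
    have cd: "c = a \<oplus> d" using a by (simp add: d_def)
    have nd: "nrm A d \<le> \<epsilon> / 2" using c nrm_minus_commute[of a c] a by (simp add: d_def)
    have "dominated c (\<epsilon> / 2)"
      unfolding dominated_def
    proof (intro ballI)
      fix \<tau> z assume \<tau>: "\<tau> \<in> \<Omega>" and z [simp]: "z \<in> \<A>"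
      have az [simp]: "a \<otimes> z \<in> \<A>" using a by simp
      have p: "pos_fun \<tau>" using \<Omega> \<tau> by blast
      have z1: "\<tau> (star A y \<otimes> (a \<otimes> z)) = 0" if "y \<in> \<A>" for y
        using zero[OF \<tau>, of "star A y" z] that by simp
      have z2: "\<tau> (star A (a \<otimes> z) \<otimes> y) = 0" if "y \<in> \<A>" for y
        using pos_fun_star[OF p, of "star A y \<otimes> (a \<otimes> z)"] z1[OF that] that by (simp add: star_mult[of "star A y"])
      have "\<tau> (star A (c \<otimes> z) \<otimes> (c \<otimes> z)) = \<tau> (star A (d \<otimes> z) \<otimes> (d \<otimes> z))"
        using a by (simp add: cd distrib_left distrib_right star_add pos_fun_add[OF p] z1 z2)
      hence "sq \<tau> (c \<otimes> z) = sq \<tau> (d \<otimes> z)" by (simp add: sq_def)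
      also have "\<dots> \<le> (nrm A d)\<^sup>2 * sq \<tau> z" using p by (intro sq_mult_le) auto
      also have "\<dots> \<le> (\<epsilon> / 2)\<^sup>2 * sq \<tau> z"
        using nd sq_nonneg[OF p z] by (intro mult_right_mono power_mono) auto
      finally show "sq \<tau> (c \<otimes> z) \<le> (\<epsilon> / 2)\<^sup>2 * sq \<tau> z" .
    qed
    \<comment> \<open>The norm estimate needs a self-adjoint element, so it is applied to
      \<open>star A c \<otimes> c\<close>; the extra factor \<open>nrm A c\<close> cancels through
      the C*-identity.\<close>
    hence "dominated (star A c \<otimes> c) (nrm A c * (\<epsilon> / 2))"
      using dominated_nrm[of "star A c"] by (intro dominated_mult) auto
    hence "nrm A (star A c \<otimes> c) \<le> nrm A c * (\<epsilon> / 2)"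
      using \<epsilon> by (intro nrm_selfadjoint_le[OF filt_mult[OF filt_star[OF c(1)] c(1)]]) (auto simp: star_mult)
    hence "nrm A c * nrm A c \<le> nrm A c * (\<epsilon> / 2)" by (simp add: cstar_identity power2_eq_square)
    hence "nrm A c \<le> \<epsilon> / 2" using \<epsilon> nrm_nonneg[OF cc] by (cases "nrm A c = 0") auto
    thus ?thesis using nrm_le_minus[OF a cc] c by simp
  qed
  hence "nrm A a \<le> 0" by (rule field_le_epsilon)
  thus ?thesis using nrm_nonneg[OF a] nrm_eq_0[OF a] by linarith
qed

end

section \<open>Vector states on square-integrable functions\<close>

lemma L2_funD:
  assumes "\<phi> \<in> L2_fun M"
  shows "\<phi> \<in> borel_measurable M" "integrable M (\<lambda>x. (cmod (\<phi> x))\<^sup>2)"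
  using assms by (auto simp: L2_fun_def)

lemma L2_rep_class:
  assumes "\<phi> \<in> L2_fun M"
  shows "L2_rep (L2_class M \<phi>) \<in> L2_fun M" "AE x in M. L2_rep (L2_class M \<phi>) x = \<phi> x"
proof -
  have "\<phi> \<in> L2_class M \<phi>" using assms by (simp add: L2_class_def)
  hence "L2_rep (L2_class M \<phi>) \<in> L2_class M \<phi>" unfolding L2_rep_def by (rule someI[of "\<lambda>f. f \<in> L2_class M \<phi>"])
  thus "L2_rep (L2_class M \<phi>) \<in> L2_fun M" "AE x in M. L2_rep (L2_class M \<phi>) x = \<phi> x"
    by (auto simp: L2_class_def)
qed

lemma L2_class_cong: "AE x in M. \<phi> x = \<psi> x \<Longrightarrow> L2_class M \<phi> = L2_class M \<psi>"
  unfolding L2_class_def by (auto elim: AE_mp)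

lemma L2_classE:
  assumes "F \<in> hcarrier (L2 M)"
  obtains \<phi> where "\<phi> \<in> L2_fun M" "F = L2_class M \<phi>"
  using assms by (auto simp: L2_def)

lemma L2_class_carrier [simp]: "\<phi> \<in> L2_fun M \<Longrightarrow> L2_class M \<phi> \<in> hcarrier (L2 M)"
  by (simp add: L2_def)

lemma L2_integrable_mult:
  assumes "\<phi> \<in> L2_fun M" "\<psi> \<in> L2_fun M"
  shows "integrable M (\<lambda>x. cnj (\<phi> x) * \<psi> x)"
proof (rule Bochner_Integration.integrable_bound)
  show "integrable M (\<lambda>x. (cmod (\<phi> x))\<^sup>2 + (cmod (\<psi> x))\<^sup>2)"
    using assms by (intro Bochner_Integration.integrable_add L2_funD)
  have "(\<lambda>x. cnj (\<phi> x)) \<in> borel_measurable M"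
    using L2_funD(1)[OF assms(1)]
    by (rule measurable_compose) (intro borel_measurable_continuous_onI continuous_intros)
  thus "(\<lambda>x. cnj (\<phi> x) * \<psi> x) \<in> borel_measurable M"
    using L2_funD(1)[OF assms(2)] by (rule borel_measurable_times)
  have "cmod (\<phi> x) * cmod (\<psi> x) \<le> (cmod (\<phi> x))\<^sup>2 + (cmod (\<psi> x))\<^sup>2" for x
  proof -
    have "0 \<le> cmod (\<phi> x) * cmod (\<psi> x)" by simp
    thus ?thesis using sum_squares_bound[of "cmod (\<phi> x)" "cmod (\<psi> x)"] by linarith
  qed
  thus "AE x in M. norm (cnj (\<phi> x) * \<psi> x) \<le> norm ((cmod (\<phi> x))\<^sup>2 + (cmod (\<psi> x))\<^sup>2)"
    by (simp add: norm_mult)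
qed

lemma L2_fun_add:
  assumes "\<phi> \<in> L2_fun M" "\<psi> \<in> L2_fun M"
  shows "(\<lambda>x. \<phi> x + \<psi> x) \<in> L2_fun M"
proof -
  have m: "(\<lambda>x. \<phi> x + \<psi> x) \<in> borel_measurable M"
    using L2_funD(1)[OF assms(1)] L2_funD(1)[OF assms(2)] by measurable
  have "integrable M (\<lambda>x. (cmod (\<phi> x + \<psi> x))\<^sup>2)"
  proof (rule Bochner_Integration.integrable_bound)
    show "integrable M (\<lambda>x. 2 * (cmod (\<phi> x))\<^sup>2 + 2 * (cmod (\<psi> x))\<^sup>2)"
      using assms by (intro Bochner_Integration.integrable_add integrable_mult_right L2_funD)
    show "(\<lambda>x. (cmod (\<phi> x + \<psi> x))\<^sup>2) \<in> borel_measurable M" using m by measurable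
    have "(cmod (\<phi> x + \<psi> x))\<^sup>2 \<le> 2 * (cmod (\<phi> x))\<^sup>2 + 2 * (cmod (\<psi> x))\<^sup>2" for x
    proof -
      have "(cmod (\<phi> x + \<psi> x))\<^sup>2 \<le> (cmod (\<phi> x) + cmod (\<psi> x))\<^sup>2"
        by (intro power_mono norm_triangle_ineq) auto
      also have "\<dots> \<le> 2 * (cmod (\<phi> x))\<^sup>2 + 2 * (cmod (\<psi> x))\<^sup>2"
        using sum_squares_bound[of "cmod (\<phi> x)" "cmod (\<psi> x)"] by (simp add: power2_sum)
      finally show ?thesis .
    qed
    thus "AE x in M. norm ((cmod (\<phi> x + \<psi> x))\<^sup>2) \<le> norm (2 * (cmod (\<phi> x))\<^sup>2 + 2 * (cmod (\<psi> x))\<^sup>2)"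
      by simp
  qed
  with m show ?thesis by (simp add: L2_fun_def)
qed

lemma L2_fun_scale:
  assumes "\<phi> \<in> L2_fun M"
  shows "(\<lambda>x. c * \<phi> x) \<in> L2_fun M"
  using L2_funD[OF assms] by (simp add: L2_fun_def norm_mult power_mult_distrib)

text \<open>The operations of \<open>L2\<close> use chosen representatives. Up to null sets the
  choice is immaterial, so any function of a class may be used to compute.\<close>

lemma hinner_class:
  assumes "\<phi> \<in> L2_fun M" "\<psi> \<in> L2_fun M"
  shows "hinner (L2 M) (L2_class M \<phi>) (L2_class M \<psi>) = (\<integral>x. cnj (\<phi> x) * \<psi> x \<partial>M)"
proof -
  let ?r = "\<lambda>\<phi>. L2_rep (L2_class M \<phi>)"
  have "hinner (L2 M) (L2_class M \<phi>) (L2_class M \<psi>) = (\<integral>x. cnj (?r \<phi> x) * ?r \<psi> x \<partial>M)"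
    by (simp add: L2_def)
  also have "\<dots> = (\<integral>x. cnj (\<phi> x) * \<psi> x \<partial>M)"
  proof (rule integral_cong_AE)
    show "(\<lambda>x. cnj (?r \<phi> x) * ?r \<psi> x) \<in> borel_measurable M"
      using L2_integrable_mult[OF L2_rep_class(1)[OF assms(1)] L2_rep_class(1)[OF assms(2)]] by simp
    show "(\<lambda>x. cnj (\<phi> x) * \<psi> x) \<in> borel_measurable M"
      using L2_integrable_mult[OF assms] by simp
    show "AE x in M. cnj (?r \<phi> x) * ?r \<psi> x = cnj (\<phi> x) * \<psi> x"
      using L2_rep_class(2)[OF assms(1)] L2_rep_class(2)[OF assms(2)] by eventually_elim simp
  qed
  finally show ?thesis .
qed

lemma hadd_class:
  assumes "\<phi> \<in> L2_fun M" "\<psi> \<in> L2_fun M"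
  shows "hadd (L2 M) (L2_class M \<phi>) (L2_class M \<psi>) = L2_class M (\<lambda>x. \<phi> x + \<psi> x)"
proof -
  have "AE x in M. L2_rep (L2_class M \<phi>) x + L2_rep (L2_class M \<psi>) x = \<phi> x + \<psi> x"
    using L2_rep_class(2)[OF assms(1)] L2_rep_class(2)[OF assms(2)] by eventually_elim simp
  thus ?thesis by (simp add: L2_def L2_class_cong)
qed

lemma hscale_class:
  assumes "\<phi> \<in> L2_fun M"
  shows "hscale (L2 M) c (L2_class M \<phi>) = L2_class M (\<lambda>x. c * \<phi> x)"
proof -
  have "AE x in M. c * L2_rep (L2_class M \<phi>) x = c * \<phi> x"
    using L2_rep_class(2)[OF assms] by eventually_elim simp
  thus ?thesis by (simp add: L2_def L2_class_cong)
qed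

lemma hinner_add_right:
  assumes "F \<in> hcarrier (L2 M)" "K \<in> hcarrier (L2 M)" "K' \<in> hcarrier (L2 M)"
  shows "hinner (L2 M) F (hadd (L2 M) K K') = hinner (L2 M) F K + hinner (L2 M) F K'"
  using assms
  by (elim L2_classE) (simp add: hadd_class hinner_class L2_fun_add distrib_left
      Bochner_Integration.integral_add L2_integrable_mult)

lemma hinner_scale_right:
  assumes "F \<in> hcarrier (L2 M)" "K \<in> hcarrier (L2 M)"
  shows "hinner (L2 M) F (hscale (L2 M) c K) = c * hinner (L2 M) F K"
  using assms
  by (elim L2_classE) (simp add: hscale_class hinner_class L2_fun_scale mult.left_commute)

lemma hinner_commute:
  assumes "F \<in> hcarrier (L2 M)" "K \<in> hcarrier (L2 M)"
  shows "hinner (L2 M) K F = cnj (hinner (L2 M) F K)"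
proof -
  from assms obtain \<phi> \<psi> where *: "\<phi> \<in> L2_fun M" "F = L2_class M \<phi>" "\<psi> \<in> L2_fun M" "K = L2_class M \<psi>"
    by (elim L2_classE)
  have "hinner (L2 M) K F = (\<integral>x. cnj (cnj (\<phi> x) * \<psi> x) \<partial>M)"
    by (simp add: * hinner_class mult.commute)
  also have "\<dots> = cnj (hinner (L2 M) F K)" 
    unfolding * hinner_class[OF *(1,3)] by (rule Bochner_Integration.integral_cnj)
  finally show ?thesis .
qed

lemma hinner_self_nonneg:
  assumes "F \<in> hcarrier (L2 M)"
  shows "0 \<le> Re (hinner (L2 M) F F)"
proof -
  from assms obtain \<phi> where \<phi>: "\<phi> \<in> L2_fun M" "F = L2_class M \<phi>" by (rule L2_classE)
  have "cnj (\<phi> x) * \<phi> x = complex_of_real ((cmod (\<phi> x))\<^sup>2)" for x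
    by (subst complex_norm_square) (rule mult.commute)
  hence "hinner (L2 M) F F = complex_of_real (\<integral>x. (cmod (\<phi> x))\<^sup>2 \<partial>M)"
    by (simp add: \<phi> hinner_class del: of_real_power)
  thus ?thesis by simp
qed

lemma representationD:
  assumes "representation A H \<pi>"
  shows "\<lbrakk>a \<in> carrier A; x \<in> hcarrier H\<rbrakk> \<Longrightarrow> \<pi> a x \<in> hcarrier H"
    and "\<lbrakk>a \<in> carrier A; b \<in> carrier A; x \<in> hcarrier H\<rbrakk> \<Longrightarrow> \<pi> (a \<oplus>\<^bsub>A\<^esub> b) x = hadd H (\<pi> a x) (\<pi> b x)"
    and "\<lbrakk>a \<in> carrier A; x \<in> hcarrier H\<rbrakk> \<Longrightarrow> \<pi> (c \<odot>\<^bsub>A\<^esub> a) x = hscale H c (\<pi> a x)"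
    and "\<lbrakk>a \<in> carrier A; b \<in> carrier A; x \<in> hcarrier H\<rbrakk> \<Longrightarrow> \<pi> (a \<otimes>\<^bsub>A\<^esub> b) x = \<pi> a (\<pi> b x)"
    and "\<lbrakk>a \<in> carrier A; x \<in> hcarrier H; y \<in> hcarrier H\<rbrakk> \<Longrightarrow>
      hinner H (\<pi> (star A a) x) y = hinner H x (\<pi> a y)"
  using assms by (auto simp: representation_def bounded_operators_def Pi_iff PiE_iff)

context cstar_algebra
begin

lemma pos_fun_vector_state:
  assumes \<pi>: "representation A (L2 M) \<pi>" and w: "w \<in> hcarrier (L2 M)"
  shows "pos_fun (\<lambda>x. hinner (L2 M) w (\<pi> x w))"
  unfolding pos_fun_def
proof (intro conjI ballI allI)
  note D = representationD[OF \<pi>]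
  fix x assume x: "x \<in> \<A>"
  show "hinner (L2 M) w (\<pi> (x \<oplus> y) w) = hinner (L2 M) w (\<pi> x w) + hinner (L2 M) w (\<pi> y w)"
    if "y \<in> \<A>" for y using that x w by (simp add: D(1,2) hinner_add_right)
  show "hinner (L2 M) w (\<pi> (c \<odot> x) w) = c * hinner (L2 M) w (\<pi> x w)" for c
    using x w by (simp add: D(1,3) hinner_scale_right)
  have "hinner (L2 M) w (\<pi> (star A x) w) = cnj (hinner (L2 M) (\<pi> (star A x) w) w)"
    using x w by (intro hinner_commute D(1)) auto
  thus "hinner (L2 M) w (\<pi> (star A x) w) = cnj (hinner (L2 M) w (\<pi> x w))"
    using x w by (simp add: D(5))
  have "hinner (L2 M) w (\<pi> (star A x \<otimes> x) w) = hinner (L2 M) (\<pi> x w) (\<pi> x w)"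
    using x w D(5)[of "star A x" w "\<pi> x w"] by (simp add: D(1,4))
  thus "0 \<le> Re (hinner (L2 M) w (\<pi> (star A x \<otimes> x) w))"
    using x w by (simp add: hinner_self_nonneg D(1))
qed

end

section \<open>Indicator vectors and their supports\<close>

definition ind_vec :: "'x measure \<Rightarrow> 'x set \<Rightarrow> ('x \<Rightarrow> complex) set" where
  "ind_vec M E = L2_class M (indicator E)"

lemma indicator_L2_fun:
  assumes "E \<in> sets M" "emeasure M E < \<infinity>"
  shows "(indicator E :: _ \<Rightarrow> complex) \<in> L2_fun M"
proof -
  have "(\<lambda>x. (cmod (indicator E x))\<^sup>2) = (indicator E :: _ \<Rightarrow> real)"
    by (auto simp: indicator_def)
  thus ?thesis using assms by (simp add: L2_fun_def)
qed

lemma hinner_ind_vec_nonzero: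
  assumes "E \<in> sets M" "emeasure M E < \<infinity>" "emeasure M E \<noteq> 0"
  shows "hinner (L2 M) (ind_vec M E) (ind_vec M E) \<noteq> 0"
proof -
  have "(\<lambda>x. cnj (indicator E x) * indicator E x) = (\<lambda>x. complex_of_real (indicator E x))"
    by (auto simp: indicator_def)
  hence "hinner (L2 M) (ind_vec M E) (ind_vec M E) = complex_of_real (measure M E)"
    using assms by (simp add: ind_vec_def hinner_class indicator_L2_fun sets.Int_space_eq2)
  moreover have "measure M E \<noteq> 0"
    using assms emeasure_eq_ennreal_measure[of M E] by (auto simp: less_top)
  ultimately show ?thesis by simp
qed

text \<open>An indicator function is square-integrable only for finite measure; \<sigma>-finiteness
  provides a piece of finite positive measure.\<close>

lemma finite_positive_subset:
  assumes "sigma_finite_measure M" "E \<in> sets M" "emeasure M E \<noteq> 0"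
  obtains E' where "E' \<in> sets M" "E' \<subseteq> E" "emeasure M E' < \<infinity>" "emeasure M E' \<noteq> 0"
proof -
  interpret sigma_finite_measure M by fact
  obtain B :: "nat \<Rightarrow> 'a set" where B: "range B \<subseteq> sets M" "(\<Union>i. B i) = space M" "\<And>i. emeasure M (B i) \<noteq> \<infinity>"
    by (rule sigma_finite) blast
  have "\<exists>i. emeasure M (E \<inter> B i) \<noteq> 0"
  proof (rule ccontr)
    assume "\<not> ?thesis"
    hence "(\<Union>i. E \<inter> B i) \<in> null_sets M" using assms B by (intro null_sets_UN) auto
    moreover have "(\<Union>i. E \<inter> B i) = E" using B(2) sets.sets_into_space[OF assms(2)] by auto
    ultimately show False using assms by auto
  qed
  then obtain i where i: "emeasure M (E \<inter> B i) \<noteq> 0" ..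
  have "emeasure M (E \<inter> B i) \<le> emeasure M (B i)" using B by (intro emeasure_mono) auto
  hence "emeasure M (E \<inter> B i) < \<infinity>" using B(3)[of i] by (auto simp: less_top top_unique)
  with i that[of "E \<inter> B i"] assms B show ?thesis by auto
qed

text \<open>Absolute continuity of the pushforward says that null sets have null preimages, which is
  what transporting an almost-everywhere statement requires.\<close>

lemma AE_pullback:
  assumes g: "g \<in> measurable (restrict_space M Y1) (restrict_space M Y2)"
    and Y: "Y1 \<in> sets M" "Y2 \<in> sets M"
    and ac: "absolutely_continuous (restrict_space M Y2) (pushforward M Y1 Y2 g)"
    and Q: "AE y in M. Q y"
  shows "AE x in M. x \<in> Y1 \<longrightarrow> Q (g x)"
proof -
  have "AE y in restrict_space M Y2. Q y"
    using Q Y by (subst AE_restrict_space_iff) (auto simp: sets.Int_space_eq1)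
  hence "AE y in pushforward M Y1 Y2 g. Q y"
    by (intro absolutely_continuous_AE[OF _ ac]) (auto simp: pushforward_def)
  hence "AE x in restrict_space M Y1. Q (g x)"
    unfolding pushforward_def by (rule AE_distrD[OF g])
  thus ?thesis using Y by (subst (asm) AE_restrict_space_iff) (auto simp: sets.Int_space_eq1)
qed

lemma branch_image_Cons:
  assumes "y \<in> branch_image G D f \<beta> E" "y \<in> D (rng G e)"
  shows "f e y \<in> branch_image G D f (e # \<beta>) E"
proof -
  from assms(1) obtain z where "z \<in> E" "z \<in> path_dom G D f \<beta>" "y = path_map f \<beta> z"
    by (auto simp: branch_image_def)
  with assms(2) show ?thesis unfolding branch_image_def by (intro image_eqI[of _ _ z]) auto
qed

lemma branch_image_mono: "E' \<subseteq> E \<Longrightarrow> branch_image G D f \<beta> E' \<subseteq> branch_image G D f \<beta> E"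
  by (auto simp: branch_image_def)

context ck_algebra
begin

lemma P_ind_vec:
  assumes "induced_representation G M R D f finv A S P \<pi>" "B \<in> \<V>"
    and "E \<in> sets M" "emeasure M E < \<infinity>" "E \<subseteq> D B"
  shows "\<pi> (P B) (ind_vec M E) = ind_vec M E"
proof -
  have "\<pi> (P B) (ind_vec M E) = L2_class M (\<lambda>x. indicator (D B) x * indicator E x)"
    using assms indicator_L2_fun[OF assms(3,4)] by (auto simp: induced_representation_def ind_vec_def)
  also have "(\<lambda>x. indicator (D B) x * indicator E x) = (indicator E :: _ \<Rightarrow> complex)"
    using assms(5) by (intro ext) (auto simp: indicator_def)
  finally show ?thesis by (simp add: ind_vec_def)
qed

text \<open>Each \<open>S e\<close> carries the support forward by \<open>f e\<close>. The image may
  fail to be measurable, so the support is described by an almost-everywhere implication.\<close>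

lemma lm_ind_vec_support:
  assumes bs: "branching_system G M R D f finv"
    and ind: "induced_representation G M R D f finv A S P \<pi>"
    and B: "B \<in> \<V>" and E: "E \<in> sets M" "emeasure M E < \<infinity>" "E \<subseteq> D B"
    and "set \<mu> \<subseteq> \<E>"
  shows "\<exists>\<phi>\<in>L2_fun M. \<pi> (lm \<mu> (P B)) (ind_vec M E) = L2_class M \<phi> \<and>
    (AE x in M. \<phi> x \<noteq> 0 \<longrightarrow> x \<in> branch_image G D f \<mu> E)"
  using assms(7)
proof (induction \<mu>)
  case Nil
  show ?case
  proof (intro bexI[of _ "indicator E"] conjI AE_I2 impI)
    show "\<pi> (lm [] (P B)) (ind_vec M E) = L2_class M (indicator E)"
      using P_ind_vec[OF ind B E] by (simp add: ind_vec_def)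
    fix x assume "(indicator E x :: complex) \<noteq> 0"
    thus "x \<in> branch_image G D f [] E" by (simp add: branch_image_def indicator_eq_0_iff)
  qed (rule indicator_L2_fun[OF E(1,2)])
next
  case (Cons e \<mu>)
  then obtain \<phi> where \<phi>: "\<phi> \<in> L2_fun M" "\<pi> (lm \<mu> (P B)) (ind_vec M E) = L2_class M \<phi>"
    "AE x in M. \<phi> x \<noteq> 0 \<longrightarrow> x \<in> branch_image G D f \<mu> E" by auto
  have e: "e \<in> \<E>" "set \<mu> \<subseteq> \<E>" using Cons.prems by auto
  have \<pi>: "representation A (L2 M) \<pi>" using ind by (simp add: induced_representation_def)
  have w: "ind_vec M E \<in> hcarrier (L2 M)" using indicator_L2_fun[OF E(1,2)] by (simp add: ind_vec_def)
  define \<psi> where "\<psi> = (\<lambda>x. if x \<in> R e then complex_of_real (sqrt (Phi_inv G M R D f e x)) * \<phi> (finv e x) else 0)"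
  have "\<pi> (lm (e # \<mu>) (P B)) (ind_vec M E) = \<pi> (S e) (L2_class M \<phi>)"
    using e B w \<phi>(2) by (simp add: representationD(4)[OF \<pi>])
  also have "\<dots> = L2_class M \<psi>"
    using ind e \<phi>(1) unfolding \<psi>_def by (auto simp: induced_representation_def)
  finally have eq: "\<pi> (lm (e # \<mu>) (P B)) (ind_vec M E) = L2_class M \<psi>" .
  have "\<pi> (lm (e # \<mu>) (P B)) (ind_vec M E) \<in> hcarrier (L2 M)"
    using e B w by (intro representationD(1)[OF \<pi>]) auto
  \<comment> \<open>Square-integrability of the explicit function \<psi> is not computed. The
    operator maps into the space, so the class has a square-integrable member, which equals \<psi>
    almost everywhere.\<close>
  then obtain \<phi>' where \<phi>': "\<phi>' \<in> L2_fun M" "\<pi> (lm (e # \<mu>) (P B)) (ind_vec M E) = L2_class M \<phi>'"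
    by (rule L2_classE)
  have "\<phi>' \<in> L2_class M \<psi>" using \<phi>' eq by (auto simp: L2_class_def)
  hence ae1: "AE x in M. \<phi>' x = \<psi> x" by (simp add: L2_class_def)
  have sets: "R e \<in> sets M" "D (rng G e) \<in> sets M"
    and meas: "finv e \<in> measurable (restrict_space M (R e)) (restrict_space M (D (rng G e)))"
    and ae2: "AE x in M. x \<in> R e \<longrightarrow> f e (finv e x) = x"
    and ac: "absolutely_continuous (restrict_space M (D (rng G e))) (pushforward M (R e) (D (rng G e)) (finv e))"
    using bs e by (auto simp: branching_system_def)
  have ae3: "AE x in M. x \<in> R e \<longrightarrow> (\<phi> (finv e x) \<noteq> 0 \<longrightarrow> finv e x \<in> branch_image G D f \<mu> E)"
    by (rule AE_pullback[OF meas sets ac \<phi>(3)])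
  have fD: "finv e x \<in> D (rng G e)" if "x \<in> R e" for x
    using measurable_space[OF meas, of x] that sets.sets_into_space[OF sets(1)]
    by (auto simp: space_restrict_space)
  have "AE x in M. \<phi>' x \<noteq> 0 \<longrightarrow> x \<in> branch_image G D f (e # \<mu>) E"
    using ae1 ae2 ae3
  proof eventually_elim
    fix x assume x: "\<phi>' x = \<psi> x" "x \<in> R e \<longrightarrow> f e (finv e x) = x"
      "x \<in> R e \<longrightarrow> (\<phi> (finv e x) \<noteq> 0 \<longrightarrow> finv e x \<in> branch_image G D f \<mu> E)"
    show "\<phi>' x \<noteq> 0 \<longrightarrow> x \<in> branch_image G D f (e # \<mu>) E"
    proof
      assume "\<phi>' x \<noteq> 0"
      hence r: "x \<in> R e" "\<phi> (finv e x) \<noteq> 0" using x(1) by (auto simp: \<psi>_def split: if_splits)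
      with x branch_image_Cons[of "finv e x" G D f \<mu> E e] fD[OF r(1)]
      show "x \<in> branch_image G D f (e # \<mu>) E" by auto
    qed
  qed
  with \<phi>' show ?case by blast
qed

lemma hinner_lm_ind_vec_zero:
  assumes bs: "branching_system G M R D f finv"
    and ind: "induced_representation G M R D f finv A S P \<pi>"
    and B: "B \<in> \<V>" and E: "E \<in> sets M" "emeasure M E < \<infinity>" "E \<subseteq> D B"
    and \<mu>: "set \<mu> \<subseteq> \<E>" and disj: "AE x in M. x \<notin> branch_image G D f \<mu> E \<inter> E"
  shows "hinner (L2 M) (ind_vec M E) (\<pi> (lm \<mu> (P B)) (ind_vec M E)) = 0"
proof -
  from lm_ind_vec_support[OF bs ind B E \<mu>] obtain \<phi> where \<phi>: "\<phi> \<in> L2_fun M"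
    "\<pi> (lm \<mu> (P B)) (ind_vec M E) = L2_class M \<phi>"
    "AE x in M. \<phi> x \<noteq> 0 \<longrightarrow> x \<in> branch_image G D f \<mu> E" by blast
  have "hinner (L2 M) (ind_vec M E) (\<pi> (lm \<mu> (P B)) (ind_vec M E)) =
      (\<integral>x. cnj (indicator E x) * \<phi> x \<partial>M)"
    unfolding \<phi>(2) unfolding ind_vec_def by (rule hinner_class[OF indicator_L2_fun[OF E(1,2)] \<phi>(1)])
  also have "\<dots> = 0"
  proof (rule integral_eq_zero_AE)
    show "AE x in M. cnj (indicator E x) * \<phi> x = 0"
      using \<phi>(3) disj by eventually_elim (auto simp: indicator_def)
  qed
  finally show ?thesis .
qed

end

theorem theorem8p3:
  fixes G :: "('v, 'e) ultragraph"
    and M :: "'x measure"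
    and R :: "'e \<Rightarrow> 'x set"
    and D :: "'v set \<Rightarrow> 'x set"
    and f finv :: "'e \<Rightarrow> 'x \<Rightarrow> 'x"
    and A :: "'a cstar"
    and S :: "'e \<Rightarrow> 'a"
    and P :: "'v set \<Rightarrow> 'a"
    and \<pi> :: "'a \<Rightarrow> ('x \<Rightarrow> complex) set \<Rightarrow> ('x \<Rightarrow> complex) set"
  assumes "wf_ultragraph G"
    and "universal_ck_algebra G A S P"
    and "sigma_finite_measure M"
    and "separable_hilbert (L2 M)"
    and "infinite_dimensional (L2 M)"
    and "branching_system G M R D f finv"
    and "\<And>B. B \<in> gen_verts G \<Longrightarrow> B \<noteq> {} \<Longrightarrow> emeasure M (D B) \<noteq> 0"
    and "induced_representation G M R D f finv A S P \<pi>"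
    and "\<And>\<alpha> (F :: nat set).
           ug_simple_cycle G \<alpha> \<Longrightarrow> \<not> has_exits G \<alpha> \<Longrightarrow> finite F \<Longrightarrow> (\<forall>n\<in>F. n > 0) \<Longrightarrow>
           \<exists>E. E \<in> sets M \<and> E \<subseteq> D {src G (hd \<alpha>)} \<and> emeasure M E \<noteq> 0 \<and>
               (\<forall>n\<in>F. AE x in M. x \<notin> branch_image G D f (iterate_path n \<alpha>) E \<inter> E)"
  shows "faithful A \<pi>"
proof -
  interpret cstar_algebra A using assms(2) by (simp add: universal_ck_algebra_def)
  interpret ck_algebra A G S P
    using assms(1,2) by unfold_locales (auto simp: universal_ck_algebra_def)
  have \<pi>: "representation A (L2 M) \<pi>" using assms(8) by (simp add: induced_representation_def)
  define \<Omega> where "\<Omega> = {\<lambda>x. hinner (L2 M) w (\<pi> x w) | w. w \<in> hcarrier (L2 M)}"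
  have ind_state: "(\<lambda>x. hinner (L2 M) (ind_vec M E) (\<pi> x (ind_vec M E))) \<in> \<Omega>"
    if "E \<in> sets M" "emeasure M E < \<infinity>" for E
    using indicator_L2_fun[OF that] unfolding \<Omega>_def ind_vec_def by auto
  interpret ck_states A G S P \<Omega>
  proof
    show "generated_cstar A (S ` edges G \<union> P ` gen_verts G) = carrier A"
      using assms(2) by (simp add: universal_ck_algebra_def)
    show "pos_fun \<tau>" if "\<tau> \<in> \<Omega>" for \<tau>
      using that pos_fun_vector_state[OF \<pi>] by (auto simp: \<Omega>_def)
    show "\<exists>\<tau>\<in>\<Omega>. \<tau> (P B) \<noteq> 0" if B: "B \<in> gen_verts G" "B \<noteq> {}" for B
    proof -
      have "D B \<in> sets M" using assms(6) B by (simp add: branching_system_def)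
      then obtain E where E: "E \<in> sets M" "E \<subseteq> D B" "emeasure M E < \<infinity>" "emeasure M E \<noteq> 0"
        using finite_positive_subset[OF assms(3)] assms(7)[OF B] by metis
      show ?thesis
        using P_ind_vec[OF assms(8) B(1) E(1,3,2)] hinner_ind_vec_nonzero[OF E(1,3,4)]
        by (intro bexI[OF _ ind_state[OF E(1,3)]]) simp
    qed
    fix \<alpha> and F :: "nat set"
    assume \<alpha>: "ug_simple_cycle G \<alpha>" "\<not> has_exits G \<alpha>" and F: "finite F" "\<forall>n\<in>F. n > 0"
    let ?v = "{src G (hd \<alpha>)}"
    from assms(9)[OF \<alpha> F] obtain E0 where E0: "E0 \<in> sets M" "E0 \<subseteq> D ?v" "emeasure M E0 \<noteq> 0"
      "\<And>n. n \<in> F \<Longrightarrow> AE x in M. x \<notin> branch_image G D f (iterate_path n \<alpha>) E0 \<inter> E0" by blast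
    \<comment> \<open>Shrinking \<open>E0\<close> preserves disjointness, since the branch image
      shrinks with it.\<close>
    obtain E where E: "E \<in> sets M" "E \<subseteq> E0" "emeasure M E < \<infinity>" "emeasure M E \<noteq> 0"
      using finite_positive_subset[OF assms(3) E0(1,3)] by metis
    have \<alpha>_edges: "\<alpha> \<noteq> []" "set \<alpha> \<subseteq> edges G"
      using \<alpha>(1) by (auto simp: ug_simple_cycle_def ug_cycle_def ug_path_def)
    hence v: "?v \<in> gen_verts G" by (cases \<alpha>) auto
    have ED: "E \<subseteq> D ?v" using E E0 by auto
    have "hinner (L2 M) (ind_vec M E) (\<pi> (lm (iterate_path n \<alpha>) (P ?v)) (ind_vec M E)) = 0"
      if n: "n \<in> F" for n
    proof (rule hinner_lm_ind_vec_zero[OF assms(6,8) v E(1,3) ED])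
      show "set (iterate_path n \<alpha>) \<subseteq> edges G" using \<alpha>_edges by (auto simp: iterate_path_def)
      show "AE x in M. x \<notin> branch_image G D f (iterate_path n \<alpha>) E \<inter> E"
        using E0(4)[OF n] by eventually_elim (use E(2) branch_image_mono[OF E(2)] in blast)
    qed
    thus "\<exists>\<tau>\<in>\<Omega>. \<tau> (P ?v) \<noteq> 0 \<and> (\<forall>n\<in>F. \<tau> (lm (iterate_path n \<alpha>) (P ?v)) = 0)"
      using P_ind_vec[OF assms(8) v E(1,3) ED] hinner_ind_vec_nonzero[OF E(1,3,4)]
      by (intro bexI[OF _ ind_state[OF E(1,3)]]) simp
  qed
  show ?thesis unfolding faithful_def
  proof (rule inj_onI)
    fix a b assume ab: "a \<in> carrier A" "b \<in> carrier A" and eq: "\<pi> a = \<pi> b"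
    have "a \<ominus>\<^bsub>A\<^esub> b = \<zero>\<^bsub>A\<^esub>"
    proof (rule states_separate)
      fix \<tau> y z assume \<tau>: "\<tau> \<in> \<Omega>" and yz: "y \<in> carrier A" "z \<in> carrier A"
      from \<tau> obtain w where w: "w \<in> hcarrier (L2 M)" "\<tau> = (\<lambda>x. hinner (L2 M) w (\<pi> x w))"
        by (auto simp: \<Omega>_def)
      have "\<pi> (y \<otimes>\<^bsub>A\<^esub> (a \<otimes>\<^bsub>A\<^esub> z)) w = \<pi> (y \<otimes>\<^bsub>A\<^esub> (b \<otimes>\<^bsub>A\<^esub> z)) w"
        using ab yz w eq by (simp add: representationD(1,4)[OF \<pi>])
      hence "\<tau> (y \<otimes>\<^bsub>A\<^esub> (a \<otimes>\<^bsub>A\<^esub> z)) = \<tau> (y \<otimes>\<^bsub>A\<^esub> (b \<otimes>\<^bsub>A\<^esub> z))" using w by simp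
      moreover have "y \<otimes>\<^bsub>A\<^esub> ((a \<ominus>\<^bsub>A\<^esub> b) \<otimes>\<^bsub>A\<^esub> z) = y \<otimes>\<^bsub>A\<^esub> (a \<otimes>\<^bsub>A\<^esub> z) \<ominus>\<^bsub>A\<^esub> y \<otimes>\<^bsub>A\<^esub> (b \<otimes>\<^bsub>A\<^esub> z)"
        using ab yz by (simp add: mult_minus_left mult_minus_right)
      ultimately show "\<tau> (y \<otimes>\<^bsub>A\<^esub> ((a \<ominus>\<^bsub>A\<^esub> b) \<otimes>\<^bsub>A\<^esub> z)) = 0"
        using ab yz \<Omega>[OF \<tau>] by (simp add: pos_fun_minus)
    qed (use ab in auto)
    thus "a = b" using ab by (simp add: minus_eq_zeroD)
  qed
qed

end
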